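(* Let $H\in(0,\frac12)$, $\alpha_H=H(2H-1)$, and let $f,g$ be functions of bounded variation on $[0,T]$. (i) If $T\ge1$, then $$\begin{aligned}\langle f,g\rangle_{\mathcal H}=\;&\alpha_H\Big(\int_1^T g(t)\,dt\int_0^{t-1}f(s)(t-s)^{2H-2}\,ds+\int_1^T f(s)\,ds\int_0^{s-1}g(t)(s-t)^{2H-2}\,dt\Big)\\&-H\int_0^T g(t)\,dt\int_{[0,T]}\big(t^{2H-1}-\operatorname{sgn}(t-s)|t-s|^{2H-1}\big)\,\nu_{\tilde f_t}(ds),\end{aligned}$$ where, for each parameter $t\in[0,T]$, $\tilde f_t(s)=f(s)\,\mathbf 1_{[(t-1)\vee0,\,(t+1)\wedge T]}(s)$. (ii) More generally, for any two numbers $\varepsilon_1,\varepsilon_2\in(0,T)$, with $\bar f_t(s)=f(s)\,\mathbf 1_{[(t-\varepsilon_1)\vee0,\,(t+\varepsilon_2)\wedge T]}(s)$, $$\begin{aligned}\langle f,g\rangle_{\mathcal H}=\;&\alpha_H\Big(\int_{\varepsilon_1}^T g(t)\,dt\int_0^{t-\varepsilon_1}f(s)(t-s)^{2H-2}\,ds+\int_{\varepsilon_2}^T f(s)\,ds\int_0^{s-\varepsilon_2}g(t)(s-t)^{2H-2}\,dt\Big)\\&-H\int_0^T g(t)\,dt\int_{[0,T]}\big(t^{2H-1}-\operatorname{sgn}(t-s)|t-s|^{2H-1}\big)\,\nu_{\bar f_t}(ds).\end{aligned}$$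
   Context: Let $B^H=(B^H_t)_{t\in[0,T]}$ be fractional Brownian motion with Hurst parameter $H$, i.e. the centered Gaussian process with covariance $R_H(t,s)=\frac12(t^{2H}+s^{2H}-|t-s|^{2H})$. $\mathcal H$ is the completion of the step functions on $[0,T]$ under the inner product determined by $\langle \mathbf 1_{[a,b)},\mathbf 1_{[c,d)}\rangle_{\mathcal H}=\mathbb E[(B^H_b-B^H_a)(B^H_d-B^H_c)]$; functions of bounded variation on $[0,T]$ are regarded as elements of $\mathcal H$. For a function $\varphi$ of bounded variation on $[0,T]$, let $\varphi^0$ be its extension by $0$ to $\mathbb R$, and let $\nu_\varphi$ be the restriction to $([0,T],\mathcal B([0,T]))$ of the (signed) Lebesgue–Stieltjes measure on $\mathbb R$ associated with $\varphi^0$ (right-continuity is not required; the measure of $(a,b]$ is $\varphi^0(b+)-\varphi^0(a+)$). For instance, if $\varphi=f\cdot\mathbf 1_{[a,b]}$ with $0\le a<b\le T$ and $f$ continuously differentiable, then $\nu_\varphi(dx)=f'(x)\mathbf 1_{[a,b]}(x)\,dx+f(a)\,\delta_a(dx)-f(b)\,\delta_b(dx)$, where $\delta_a$ is the Dirac point mass at $a$. Here $x\vee y=\max\{x,y\}$, $x\wedge y=\min\{x,y\}$. *)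

theory Defs
  imports "HOL-Probability.Probability"
begin

section \<open>Fractional Brownian motion\<close>

text \<open>Degenerate laws count as Gaussian: fractional Brownian motion vanishes at time 0.\<close>

definition gaussian_rv :: "'a measure \<Rightarrow> ('a \<Rightarrow> real) \<Rightarrow> bool" where
  "gaussian_rv M X \<longleftrightarrow> X \<in> borel_measurable M \<and>
     (\<exists>\<mu> \<sigma>. (\<sigma> = 0 \<and> (AE \<omega> in M. X \<omega> = \<mu>)) \<or>
            (\<sigma> > 0 \<and> distributed M lborel X (normal_density \<mu> \<sigma>)))"

definition gaussian_process :: "'a measure \<Rightarrow> 'i set \<Rightarrow> ('i \<Rightarrow> 'a \<Rightarrow> real) \<Rightarrow> bool" where
  "gaussian_process M I B \<longleftrightarrow>
     (\<forall>J c. finite J \<and> J \<subseteq> I \<longrightarrow> gaussian_rv M (\<lambda>\<omega>. \<Sum>t\<in>J. c t * B t \<omega>))"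

definition fbm_cov :: "real \<Rightarrow> real \<Rightarrow> real \<Rightarrow> real" where
  "fbm_cov H t s = (t powr (2 * H) + s powr (2 * H) - \<bar>t - s\<bar> powr (2 * H)) / 2"

definition fractional_brownian_motion ::
    "'a measure \<Rightarrow> real \<Rightarrow> real \<Rightarrow> (real \<Rightarrow> 'a \<Rightarrow> real) \<Rightarrow> bool" where
  "fractional_brownian_motion M H T B \<longleftrightarrow>
     prob_space M \<and> gaussian_process M {0..T} B \<and>
     (\<forall>t\<in>{0..T}. (LINT \<omega>|M. B t \<omega>) = 0) \<and>
     (\<forall>t\<in>{0..T}. \<forall>s\<in>{0..T}. (LINT \<omega>|M. B t \<omega> * B s \<omega>) = fbm_cov H t s)"


section \<open>The Hilbert space of the process\<close>

text \<open>A list of triples \<open>(c, a, b)\<close> represents the step function that is the sum of the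
  \<open>c * 1_[a,b)\<close>; representations are not unique.\<close>

definition step_rep :: "real \<Rightarrow> (real \<times> real \<times> real) list \<Rightarrow> bool" where
  "step_rep T xs \<longleftrightarrow> (\<forall>(c, a, b) \<in> set xs. 0 \<le> a \<and> a \<le> b \<and> b \<le> T)"

definition step_fun :: "(real \<times> real \<times> real) list \<Rightarrow> real \<Rightarrow> real" where
  "step_fun xs = (\<lambda>x. \<Sum>(c, a, b)\<leftarrow>xs. c * indicator {a..<b} x)"

definition step_functions :: "real \<Rightarrow> (real \<Rightarrow> real) set" where
  "step_functions T = {step_fun xs | xs. step_rep T xs}"

text \<open>The bilinear form on step functions determined by
  \<open>\<langle>1_[a,b), 1_[p,q)\<rangle> = E[(B_b - B_a) (B_q - B_p)]\<close>; its value does not depend on the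
  representations.\<close>

definition step_inner ::
    "'a measure \<Rightarrow> (real \<Rightarrow> 'a \<Rightarrow> real) \<Rightarrow> real \<Rightarrow> (real \<Rightarrow> real) \<Rightarrow> (real \<Rightarrow> real) \<Rightarrow> real" where
  "step_inner M B T \<phi> \<psi> = (THE r. \<forall>xs ys.
     step_rep T xs \<and> step_rep T ys \<and> \<phi> = step_fun xs \<and> \<psi> = step_fun ys \<longrightarrow>
     r = (\<Sum>(c, a, b)\<leftarrow>xs. \<Sum>(d, p, q)\<leftarrow>ys.
            c * d * (LINT \<omega>|M. (B b \<omega> - B a \<omega>) * (B q \<omega> - B p \<omega>))))"

definition step_dist ::
    "'a measure \<Rightarrow> (real \<Rightarrow> 'a \<Rightarrow> real) \<Rightarrow> real \<Rightarrow> (real \<Rightarrow> real) \<Rightarrow> (real \<Rightarrow> real) \<Rightarrow> real" where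
  "step_dist M B T \<phi> \<psi> = sqrt (step_inner M B T (\<lambda>x. \<phi> x - \<psi> x) (\<lambda>x. \<phi> x - \<psi> x))"

text \<open>The completion: Cauchy sequences of step functions modulo null sequences.\<close>

definition step_Cauchy ::
    "'a measure \<Rightarrow> (real \<Rightarrow> 'a \<Rightarrow> real) \<Rightarrow> real \<Rightarrow> (nat \<Rightarrow> real \<Rightarrow> real) set" where
  "step_Cauchy M B T = {\<phi>. (\<forall>n. \<phi> n \<in> step_functions T) \<and>
     (\<forall>e>0. \<exists>N. \<forall>m\<ge>N. \<forall>n\<ge>N. step_dist M B T (\<phi> m) (\<phi> n) < e)}"

definition step_null_rel ::
    "'a measure \<Rightarrow> (real \<Rightarrow> 'a \<Rightarrow> real) \<Rightarrow> real \<Rightarrow> ((nat \<Rightarrow> real \<Rightarrow> real) \<times> (nat \<Rightarrow> real \<Rightarrow> real)) set" where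
  "step_null_rel M B T = {(\<phi>, \<psi>). \<phi> \<in> step_Cauchy M B T \<and> \<psi> \<in> step_Cauchy M B T \<and>
     (\<lambda>n. step_dist M B T (\<phi> n) (\<psi> n)) \<longlonglongrightarrow> 0}"

definition H_space ::
    "'a measure \<Rightarrow> (real \<Rightarrow> 'a \<Rightarrow> real) \<Rightarrow> real \<Rightarrow> (nat \<Rightarrow> real \<Rightarrow> real) set set" where
  "H_space M B T = step_Cauchy M B T // step_null_rel M B T"

definition H_inner ::
    "'a measure \<Rightarrow> (real \<Rightarrow> 'a \<Rightarrow> real) \<Rightarrow> real \<Rightarrow>
     (nat \<Rightarrow> real \<Rightarrow> real) set \<Rightarrow> (nat \<Rightarrow> real \<Rightarrow> real) set \<Rightarrow> real" where
  "H_inner M B T X Y = (THE r. \<forall>\<phi>\<in>X. \<forall>\<psi>\<in>Y. (\<lambda>n. step_inner M B T (\<phi> n) (\<psi> n)) \<longlonglongrightarrow> r)"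

text \<open>For Hurst parameter below 1/2 the norm on step functions dominates a multiple of the
  \<open>L\<^sup>2([0,T])\<close> norm and is closable there, so the completion is a space of (classes of)
  square-integrable functions on \<open>[0,T]\<close>. A function \<open>f\<close> is regarded as the element of the completion
  whose Cauchy sequences converge to \<open>f\<close> in \<open>L\<^sup>2([0,T])\<close>.\<close>

definition H_elem ::
    "'a measure \<Rightarrow> (real \<Rightarrow> 'a \<Rightarrow> real) \<Rightarrow> real \<Rightarrow> (real \<Rightarrow> real) \<Rightarrow> (nat \<Rightarrow> real \<Rightarrow> real) set" where
  "H_elem M B T f = (THE X. X \<in> H_space M B T \<and>
     (\<exists>\<phi>\<in>X. (\<lambda>n. \<integral>\<^sup>+x\<in>{0..T}. ennreal ((\<phi> n x - f x)\<^sup>2) \<partial>lborel) \<longlonglongrightarrow> 0))"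


section \<open>Bounded variation and the signed Lebesgue--Stieltjes measure\<close>

definition variation_sums :: "(real \<Rightarrow> real) \<Rightarrow> real set \<Rightarrow> real set" where
  "variation_sums f S = {\<Sum>i<n. \<bar>f (p (Suc i)) - f (p i)\<bar> | n p. mono_on {..n} p \<and> p ` {..n} \<subseteq> S}"

definition bounded_variation_on :: "(real \<Rightarrow> real) \<Rightarrow> real set \<Rightarrow> bool" where
  "bounded_variation_on f S \<longleftrightarrow> bdd_above (variation_sums f S)"

definition total_variation_on :: "(real \<Rightarrow> real) \<Rightarrow> real set \<Rightarrow> real" where
  "total_variation_on f S = Sup (variation_sums f S)"

definition zero_ext :: "real \<Rightarrow> (real \<Rightarrow> real) \<Rightarrow> real \<Rightarrow> real" where
  "zero_ext T \<phi> x = (if x \<in> {0..T} then \<phi> x else 0)"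

text \<open>\<open>ls_fun T \<phi> x\<close> is \<open>\<phi>\<^sup>0(x+)\<close>, the right-continuous distribution function of the signed
  Lebesgue--Stieltjes measure of the zero extension \<open>\<phi>\<^sup>0\<close>. That measure is the difference of the two
  positive measures whose distribution functions are the positive and negative variation of
  \<open>ls_fun T \<phi>\<close> (its Jordan decomposition), so its value on \<open>(a,b]\<close> is \<open>\<phi>\<^sup>0(b+) - \<phi>\<^sup>0(a+)\<close>.\<close>

definition ls_fun :: "real \<Rightarrow> (real \<Rightarrow> real) \<Rightarrow> real \<Rightarrow> real" where
  "ls_fun T \<phi> x = Lim (at_right x) (zero_ext T \<phi>)"

definition ls_pos :: "real \<Rightarrow> (real \<Rightarrow> real) \<Rightarrow> real measure" where
  "ls_pos T \<phi> = restrict_space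
     (interval_measure (\<lambda>x. (total_variation_on (ls_fun T \<phi>) {..x} + ls_fun T \<phi> x) / 2)) {0..T}"

definition ls_neg :: "real \<Rightarrow> (real \<Rightarrow> real) \<Rightarrow> real measure" where
  "ls_neg T \<phi> = restrict_space
     (interval_measure (\<lambda>x. (total_variation_on (ls_fun T \<phi>) {..x} - ls_fun T \<phi> x) / 2)) {0..T}"

text \<open>The integral of \<open>h\<close> over \<open>[0,T]\<close> with respect to the signed measure \<open>\<nu>_\<phi>\<close>.\<close>

definition ls_integral :: "real \<Rightarrow> (real \<Rightarrow> real) \<Rightarrow> (real \<Rightarrow> real) \<Rightarrow> real" where
  "ls_integral T \<phi> h = (LINT s|ls_pos T \<phi>. h s) - (LINT s|ls_neg T \<phi>. h s)"

end

theory Submission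
  imports Defs
begin

text \<open>
  For \<open>H < 1/2\<close> the covariance form is a Gagliardo form: extending functions by zero to the real line,
  \<open>\<langle>\<phi>, \<psi>\<rangle> = H (1 - 2H) / 2 * \<integral>\<integral> (\<phi> x - \<phi> y) (\<psi> x - \<psi> y) \<bar>x - y\<bar> powr (2H - 2) dx dy\<close>.
  For step functions it suffices, by polarization, to compute the norm of one indicator
  (\<open>energy_indicator\<close>, \<open>step_inner_eq_energy\<close>). The process enters only through this identity;
  everything else is analysis of the double integral.

  A function \<open>f\<close> of bounded variation is the limit of step functions in \<open>L\<^sup>2\<close> and in energy, because
  differences of monotone functions are uniform limits of averages of indicators and
  \<open>\<integral>\<integral> \<bar>f x - f y\<bar> \<bar>x - y\<bar> powr (2H - 2)\<close> stays bounded along the approximation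
  (\<open>bounded_variation_approximation\<close>). Fatou's lemma shows that the energy is closable in \<open>L\<^sup>2\<close>
  (\<open>sq_distance_tendsto_of_L2\<close>), so \<open>f\<close> defines exactly one element of the completion and the inner
  product of two such elements is their energy (\<open>H_elem_eq\<close>, \<open>H_inner_eq_energy\<close>).

  The integral \<open>\<integral>\<integral> \<bar>f x - f y\<bar> \<bar>x - y\<bar> powr (2H - 2)\<close> being finite, antisymmetry of \<open>f x - f y\<close> turns the
  energy into \<open>H (1 - 2H) * \<integral> g x (\<integral> (f x - f y) \<bar>x - y\<bar> powr (2H - 2) dy) dx\<close>
  (\<open>energy_fibrewise\<close>). The inner integral exceeds the one for the cut-off of \<open>f\<close> to the window around \<open>x\<close>
  by \<open>- \<integral> f y \<bar>x - y\<bar> powr (2H - 2) dy\<close>, taken over the complement of the window, as the cut-off keeps the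
  value \<open>f x\<close>; this yields the two double integrals of the theorem (\<open>energy_near_far_split\<close>). For the windowed
  function, writing \<open>W x - W y\<close> as the Stieltjes measure of an interval and exchanging the order of
  integration gives
  \<open>(1 - 2H) * \<integral> (W x - W y) \<bar>x - y\<bar> powr (2H - 2) dy = \<integral> sgn (x - s) \<bar>x - s\<bar> powr (2H - 1) dW s\<close>
  (\<open>stieltjes_potential\<close>), and this is applied to both parts of the Jordan decomposition. The
  constant \<open>x powr (2H - 1)\<close> contributes nothing because the signed measure has total mass \<open>0\<close>.

  The outer integral of the theorem is a Bochner integral, which vanishes by definition on functions
  that are not measurable. Knowing the Stieltjes integral for almost every \<open>t\<close> is therefore not enough:
  it has to be a Borel function of \<open>t\<close> although both the measure and its Jordan decomposition move with
  \<open>t\<close>. This rests on the joint measurability of the total variation in the parameter and the endpoint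
  (\<open>total_variation_jointly_measurable\<close>).
\<close>

section \<open>Total variation and domination by nondecreasing functions\<close>

text \<open>Domination of the increments of \<open>\<phi>\<close> by those of \<open>S\<close> makes \<open>S\<close> and \<open>S - \<phi>\<close> nondecreasing. It replaces
  the total variation of \<open>\<phi>\<close> wherever an explicit \<open>S\<close> is easier to handle.\<close>

definition increments_le :: "(real \<Rightarrow> real) \<Rightarrow> (real \<Rightarrow> real) \<Rightarrow> bool" where
  "increments_le \<phi> S \<longleftrightarrow> (\<forall>a b. a \<le> b \<longrightarrow> \<bar>\<phi> b - \<phi> a\<bar> \<le> S b - S a)"

lemma increments_leD: "increments_le \<phi> S \<Longrightarrow> a \<le> b \<Longrightarrow> \<bar>\<phi> b - \<phi> a\<bar> \<le> S b - S a"
  by (simp add: increments_le_def)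

text \<open>A chain in \<open>X\<close> can be prolonged by the two points \<open>x\<close> and \<open>y\<close>.\<close>

lemma total_variation_on_add_le:
  fixes f :: "real \<Rightarrow> real"
  assumes "X \<subseteq> Y" "x \<in> X" "y \<in> Y" "X \<subseteq> {..x}" "x \<le> y" and bdd: "bdd_above (variation_sums f Y)"
  shows "total_variation_on f X + \<bar>f y - f x\<bar> \<le> total_variation_on f Y"
proof -
  have "v \<le> total_variation_on f Y - \<bar>f y - f x\<bar>" if v: "v \<in> variation_sums f X" for v
  proof -
    obtain n p where np: "v = (\<Sum>i<n. \<bar>f (p (Suc i)) - f (p i)\<bar>)" "mono_on {..n} p" "p ` {..n} \<subseteq> X"
      using v unfolding variation_sums_def by blast
    define q where "q = (\<lambda>i. if i \<le> n then p i else if i = Suc n then x else y)"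
    have pX: "p i \<in> X" if "i \<le> n" for i using np(3) that by auto
    have "mono_on {..Suc (Suc n)} q"
    proof (rule mono_onI)
      fix i j assume ij: "i \<in> {..Suc (Suc n)}" "j \<in> {..Suc (Suc n)}" "i \<le> j"
      have "p i \<le> x" "p i \<le> y" if "i \<le> n" for i
        using pX[OF that] assms(4,5) by force+
      moreover have "i \<le> n \<Longrightarrow> j \<le> n \<Longrightarrow> p i \<le> p j"
        using np(2) ij(3) by (auto simp: mono_on_def)
      ultimately show "q i \<le> q j" using ij assms(5) unfolding q_def by auto
    qed
    moreover have "q ` {..Suc (Suc n)} \<subseteq> Y"
      using pX assms(1,2,3) unfolding q_def by auto
    ultimately have "(\<Sum>i<Suc (Suc n). \<bar>f (q (Suc i)) - f (q i)\<bar>) \<in> variation_sums f Y"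
      unfolding variation_sums_def by blast
    then have "(\<Sum>i<Suc (Suc n). \<bar>f (q (Suc i)) - f (q i)\<bar>) \<le> total_variation_on f Y"
      unfolding total_variation_on_def using bdd by (rule cSup_upper)
    moreover have "(\<Sum>i<n. \<bar>f (q (Suc i)) - f (q i)\<bar>) = v"
      unfolding np(1) by (intro sum.cong) (auto simp: q_def)
    ultimately show ?thesis by (simp add: q_def)
  qed
  moreover have "variation_sums f X \<noteq> {}"
  proof -
    have "(\<Sum>i<0. \<bar>f (x) - f (x)\<bar>) \<in> variation_sums f X"
      using assms(2) unfolding variation_sums_def
      by (intro CollectI exI[of _ 0] exI[of _ "\<lambda>_. x"]) (auto intro: mono_onI)
    then show ?thesis by blast
  qed
  ultimately have "total_variation_on f X \<le> total_variation_on f Y - \<bar>f y - f x\<bar>"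
    unfolding total_variation_on_def by (intro cSup_least) auto
  then show ?thesis by simp
qed

lemma bdd_above_variation_sums_subset:
  "X \<subseteq> Y \<Longrightarrow> bdd_above (variation_sums f Y) \<Longrightarrow> bdd_above (variation_sums f X)"
  by (rule bdd_above_mono, assumption) (force simp: variation_sums_def)

lemma variation_sums_le:
  fixes F S :: "real \<Rightarrow> real"
  assumes "increments_le F S" "mono_on {..n} p"
  shows "(\<Sum>i<n. \<bar>F (p (Suc i)) - F (p i)\<bar>) \<le> S (p n) - S (p 0)"
proof -
  have "(\<Sum>i<n. \<bar>F (p (Suc i)) - F (p i)\<bar>) \<le> (\<Sum>i<n. S (p (Suc i)) - S (p i))"
    using assms(2) by (intro sum_mono increments_leD[OF assms(1)]) (auto simp: mono_on_def)
  also have "\<dots> = S (p n) - S (p 0)" by (rule sum_lessThan_telescope)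
  finally show ?thesis .
qed

lemma bdd_above_variation_sums_dominated:
  fixes F S :: "real \<Rightarrow> real"
  assumes dom: "increments_le F S" and S: "\<And>a. \<bar>S a\<bar> \<le> K"
  shows "bdd_above (variation_sums F X)"
proof (rule bdd_aboveI)
  fix v assume "v \<in> variation_sums F X"
  then obtain n p where np: "v = (\<Sum>i<n. \<bar>F (p (Suc i)) - F (p i)\<bar>)" "mono_on {..n} p"
      unfolding variation_sums_def by blast
  have "v \<le> S (p n) - S (p 0)" unfolding np(1) by (rule variation_sums_le[OF dom np(2)])
  also have "\<dots> \<le> 2 * K" using S[of "p n"] S[of "p 0"] by linarith
  finally show "v \<le> 2 * K" .
qed

text \<open>Cutting the links of a chain at \<open>x\<close>, by taking the minimum and the maximum of its points with \<open>x\<close>,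
  leaves a chain in \<open>{..x}\<close> and one in \<open>{x..y}\<close>; the second contributes at most \<open>S y - S x\<close>.\<close>

lemma total_variation_on_dominated:
  fixes F S :: "real \<Rightarrow> real"
  assumes dom: "increments_le F S" and S: "\<And>a. \<bar>S a\<bar> \<le> K"
    and "x \<le> y"
  shows "total_variation_on F {..y} \<le> total_variation_on F {..x} + (S y - S x)"
  unfolding total_variation_on_def[of F "{..y}"]
proof (rule cSup_least)
  have "(\<Sum>i<0. \<bar>F (x) - F (x)\<bar>) \<in> variation_sums F {..y}"
    using assms(3) unfolding variation_sums_def
    by (intro CollectI exI[of _ 0] exI[of _ "\<lambda>_. x"]) (auto intro: mono_onI)
  then show "variation_sums F {..y} \<noteq> {}" by blast
  fix v assume "v \<in> variation_sums F {..y}"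
  then obtain n p where np: "v = (\<Sum>i<n. \<bar>F (p (Suc i)) - F (p i)\<bar>)" "mono_on {..n} p" "p ` {..n} \<subseteq> {..y}"
      unfolding variation_sums_def by blast
  let ?p = "\<lambda>i. min x (p i)" and ?q = "\<lambda>i. max x (p i)"
  have mon: "p i \<le> p j" if "i \<le> j" "j \<le> n" for i j using np(2) that by (auto simp: mono_on_def)
  have "v \<le> (\<Sum>i<n. \<bar>F (?p (Suc i)) - F (?p i)\<bar> + \<bar>F (?q (Suc i)) - F (?q i)\<bar>)"
    unfolding np(1)
  proof (rule sum_mono)
    fix i assume "i \<in> {..<n}"
    then have "p i \<le> p (Suc i)" by (intro mon) auto
    then show "\<bar>F (p (Suc i)) - F (p i)\<bar>
        \<le> \<bar>F (?p (Suc i)) - F (?p i)\<bar> + \<bar>F (?q (Suc i)) - F (?q i)\<bar>"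
      by (auto simp: min_def max_def)
  qed
  also have "\<dots> = (\<Sum>i<n. \<bar>F (?p (Suc i)) - F (?p i)\<bar>) + (\<Sum>i<n. \<bar>F (?q (Suc i)) - F (?q i)\<bar>)"
    by (rule sum.distrib)
  also have "(\<Sum>i<n. \<bar>F (?p (Suc i)) - F (?p i)\<bar>) \<le> total_variation_on F {..x}"
    unfolding total_variation_on_def
  proof (rule cSup_upper)
    have "mono_on {..n} ?p" using mon by (intro mono_onI min.mono) auto
    then show "(\<Sum>i<n. \<bar>F (?p (Suc i)) - F (?p i)\<bar>) \<in> variation_sums F {..x}"
      unfolding variation_sums_def by (intro CollectI exI[of _ n] exI[of _ ?p]) auto
    show "bdd_above (variation_sums F {..x})"
      by (rule bdd_above_variation_sums_dominated[OF dom S])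
  qed
  also have "(\<Sum>i<n. \<bar>F (?q (Suc i)) - F (?q i)\<bar>) \<le> S (?q n) - S (?q 0)"
    using mon by (intro variation_sums_le[OF dom] mono_onI max.mono) auto
  also have "\<dots> \<le> S y - S x"
    using increments_leD[OF dom, of x "?q 0"] increments_leD[OF dom, of "?q n" y] np(3) assms(3) by force
  finally show "v \<le> total_variation_on F {..x} + (S y - S x)" by simp
qed

text \<open>The function \<open>w\<close> is the total variation on \<open>{0..x}\<close>, set to \<open>0\<close> outside \<open>{0..T}\<close> so that it is
  nonnegative everywhere.\<close>

lemma bounded_variation_dominating_mono:
  fixes f :: "real \<Rightarrow> real"
  assumes "bounded_variation_on f {0..T}" "0 < T"
  obtains w where "\<And>x. 0 \<le> w x" "\<And>x y. 0 \<le> x \<Longrightarrow> x \<le> y \<Longrightarrow> y \<le> T \<Longrightarrow> \<bar>f y - f x\<bar> \<le> w y - w x"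
proof -
  define w where "w x = total_variation_on f {0..x} - total_variation_on f {0..0}" for x
  have *: "\<bar>f y - f x\<bar> \<le> w y - w x" if "0 \<le> x" "x \<le> y" "y \<le> T" for x y
  proof -
    have "bdd_above (variation_sums f {0..y})"
      by (rule bdd_above_variation_sums_subset[of _ "{0..T}"])
        (use that assms in \<open>auto simp: bounded_variation_on_def\<close>)
    then show ?thesis using total_variation_on_add_le[of "{0..x}" "{0..y}" x y f] that
      unfolding w_def by simp
  qed
  define w' where "w' x = (if 0 \<le> x \<and> x \<le> T then w x else 0)" for x
  have "0 \<le> w' x" for x
    unfolding w'_def using *[of 0 x] by (auto simp: w_def)
  moreover have "\<bar>f y - f x\<bar> \<le> w' y - w' x" if "0 \<le> x" "x \<le> y" "y \<le> T" for x y
    using *[OF that] that unfolding w'_def by simp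
  ultimately show thesis using that by blast
qed

section \<open>The singular kernel\<close>

definition kern :: "real \<Rightarrow> real \<Rightarrow> real" where
  "kern H d = \<bar>d\<bar> powr (2 * H - 2)"

lemma kern_nonneg [simp]: "0 \<le> kern H d" by (simp add: kern_def)
lemma kern_commute: "kern H (x - y) = kern H (y - x)" by (simp add: kern_def abs_minus_commute)
lemma kern_measurable [measurable]: "kern H \<in> borel_measurable borel" unfolding kern_def by measurable

locale rough_hurst =
  fixes H :: real
  assumes H_pos: "0 < H" and H_half: "H < 1 / 2"
begin

lemma nn_integral_kern_tail:
  assumes "0 < d"
  shows "(\<integral>\<^sup>+z. ennreal (kern H z) * indicator {d..} z \<partial>lborel)
    = ennreal (d powr (2 * H - 1) / (1 - 2 * H))"
proof -
  have "((\<lambda>z. z powr (2 * H - 2)) has_integral -(d powr (2 * H - 2 + 1)) / (2 * H - 2 + 1)) {d..}"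
    using H_half assms by (intro has_integral_powr_to_inf) auto
  also have "-(d powr (2 * H - 2 + 1)) / (2 * H - 2 + 1) = d powr (2 * H - 1) / (1 - 2 * H)"
    using H_half by (simp add: field_simps)
  finally have "(kern H has_integral d powr (2 * H - 1) / (1 - 2 * H)) {d..}"
    by (rule has_integral_eq[rotated]) (use assms in \<open>auto simp: kern_def\<close>)
  then show ?thesis by (rule nn_integral_has_integral_lebesgue'[rotated]) simp
qed

lemma nn_integral_kern_right:
  assumes "x < s"
  shows "(\<integral>\<^sup>+y. ennreal (kern H (x - y)) * indicator {s..} y \<partial>lborel)
    = ennreal ((s - x) powr (2 * H - 1) / (1 - 2 * H))"
proof -
  have "(\<integral>\<^sup>+y. ennreal (kern H (x - y)) * indicator {s..} y \<partial>lborel)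
    = (\<integral>\<^sup>+y. ennreal (kern H (- x + 1 * y)) * indicator {s - x..} (- x + 1 * y) \<partial>lborel)"
    by (intro nn_integral_cong) (auto simp: indicator_def kern_commute[of H x])
  also have "\<dots> = (\<integral>\<^sup>+z. ennreal (kern H z) * indicator {s - x..} z \<partial>lborel)"
    by (subst nn_integral_real_affine[where c = 1 and t = "- x"]) auto
  finally show ?thesis using nn_integral_kern_tail[of "s - x"] assms by simp
qed

lemma nn_integral_kern_left:
  assumes "s < x"
  shows "(\<integral>\<^sup>+y. ennreal (kern H (x - y)) * indicator {..s} y \<partial>lborel)
    = ennreal ((x - s) powr (2 * H - 1) / (1 - 2 * H))"
proof -
  have "(\<integral>\<^sup>+y. ennreal (kern H (x - y)) * indicator {..s} y \<partial>lborel)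
    = (\<integral>\<^sup>+y. ennreal (kern H (x + (-1) * y)) * indicator {x - s..} (x + (-1) * y) \<partial>lborel)"
    by (intro nn_integral_cong) (auto simp: indicator_def)
  also have "\<dots> = (\<integral>\<^sup>+z. ennreal (kern H z) * indicator {x - s..} z \<partial>lborel)"
    by (subst nn_integral_real_affine[where c = "-1" and t = x]) auto
  finally show ?thesis using nn_integral_kern_tail[of "x - s"] assms by simp
qed

lemma nn_integral_powr_singular:
  assumes "a \<le> b"
  shows "(\<integral>\<^sup>+x. ennreal ((x - a) powr (2 * H - 1)) * indicator {a<..<b} x \<partial>lborel)
      = ennreal ((b - a) powr (2 * H) / (2 * H))"
    and "(\<integral>\<^sup>+x. ennreal ((b - x) powr (2 * H - 1)) * indicator {a<..<b} x \<partial>lborel)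
      = ennreal ((b - a) powr (2 * H) / (2 * H))"
proof -
  have "((\<lambda>z. z powr (2 * H - 1)) has_integral (b - a) powr (2 * H) / (2 * H)) {0..b - a}"
    using has_integral_powr_from_0[of "2 * H - 1" "b - a"] H_pos assms by simp
  then have *: "(\<integral>\<^sup>+z. ennreal (z powr (2 * H - 1)) * indicator {0..b - a} z \<partial>lborel)
      = ennreal ((b - a) powr (2 * H) / (2 * H))"
    by (rule nn_integral_has_integral_lebesgue'[rotated]) simp
  have "(\<integral>\<^sup>+x. ennreal ((x - a) powr (2 * H - 1)) * indicator {a<..<b} x \<partial>lborel)
     = (\<integral>\<^sup>+x. ennreal ((-a + 1 * x) powr (2 * H - 1)) * indicator {0..b - a} (-a + 1 * x) \<partial>lborel)"
    by (intro nn_integral_cong_AE, use AE_lborel_singleton[of a] AE_lborel_singleton[of b] in eventually_elim)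
      (auto simp: indicator_def)
  also have "\<dots> = (\<integral>\<^sup>+z. ennreal (z powr (2 * H - 1)) * indicator {0..b - a} z \<partial>lborel)"
    by (subst nn_integral_real_affine[where c = 1 and t = "- a"]) auto
  finally show "(\<integral>\<^sup>+x. ennreal ((x - a) powr (2 * H - 1)) * indicator {a<..<b} x \<partial>lborel)
      = ennreal ((b - a) powr (2 * H) / (2 * H))" using * by simp
  have "(\<integral>\<^sup>+x. ennreal ((b - x) powr (2 * H - 1)) * indicator {a<..<b} x \<partial>lborel)
     = (\<integral>\<^sup>+x. ennreal ((b + (-1) * x) powr (2 * H - 1)) * indicator {0..b - a} (b + (-1) * x) \<partial>lborel)"
    by (intro nn_integral_cong_AE, use AE_lborel_singleton[of a] AE_lborel_singleton[of b] in eventually_elim)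
      (auto simp: indicator_def)
  also have "\<dots> = (\<integral>\<^sup>+z. ennreal (z powr (2 * H - 1)) * indicator {0..b - a} z \<partial>lborel)"
    by (subst nn_integral_real_affine[where c = "-1" and t = b]) auto
  finally show "(\<integral>\<^sup>+x. ennreal ((b - x) powr (2 * H - 1)) * indicator {a<..<b} x \<partial>lborel)
      = ennreal ((b - a) powr (2 * H) / (2 * H))" using * by simp
qed

section \<open>Functions with finite energy\<close>

text \<open>The energy lives on the plane with the measure \<open>\<bar>x - y\<bar> powr (2H - 2) dx dy\<close>, which has infinite mass
  near the diagonal.\<close>

definition kernel_pair :: "(real \<times> real) measure" where
  "kernel_pair = density (lborel \<Otimes>\<^sub>M lborel) (\<lambda>(x, y). ennreal (kern H (x - y)))"

lemma sets_kernel_pair [measurable_cong]: "sets kernel_pair = sets (borel \<Otimes>\<^sub>M borel)"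
  unfolding kernel_pair_def sets_density by (intro sets_pair_measure_cong) simp_all

lemma space_kernel_pair [simp]: "space kernel_pair = UNIV"
  unfolding kernel_pair_def by (simp add: space_pair_measure)

lemma nn_integral_kernel_pair:
  assumes [measurable]: "f \<in> borel_measurable (borel \<Otimes>\<^sub>M borel)"
  shows "(\<integral>\<^sup>+p. f p \<partial>kernel_pair) = (\<integral>\<^sup>+x. \<integral>\<^sup>+y. ennreal (kern H (x - y)) * f (x, y) \<partial>lborel \<partial>lborel)"
proof -
  have "(\<integral>\<^sup>+p. f p \<partial>kernel_pair) = (\<integral>\<^sup>+p. (case p of (x, y) \<Rightarrow> ennreal (kern H (x - y))) * f p \<partial>(lborel \<Otimes>\<^sub>M lborel))"
    unfolding kernel_pair_def by (rule nn_integral_density) measurable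
  also have "\<dots> = (\<integral>\<^sup>+x. \<integral>\<^sup>+y. ennreal (kern H (x - y)) * f (x, y) \<partial>lborel \<partial>lborel)"
    by (subst lborel.nn_integral_fst[symmetric]) auto
  finally show ?thesis .
qed

lemma nn_integral_kernel_pair_swap:
  assumes [measurable]: "f \<in> borel_measurable (borel \<Otimes>\<^sub>M borel)"
  shows "(\<integral>\<^sup>+p. f (snd p, fst p) \<partial>kernel_pair) = (\<integral>\<^sup>+p. f p \<partial>kernel_pair)"
proof -
  have "(\<integral>\<^sup>+p. f p \<partial>kernel_pair) = (\<integral>\<^sup>+x. \<integral>\<^sup>+y. ennreal (kern H (x - y)) * f (x, y) \<partial>lborel \<partial>lborel)"
    by (rule nn_integral_kernel_pair) measurable
  also have "\<dots> = (\<integral>\<^sup>+y. \<integral>\<^sup>+x. ennreal (kern H (x - y)) * f (x, y) \<partial>lborel \<partial>lborel)"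
    by (rule lborel_pair.Fubini') measurable
  also have "\<dots> = (\<integral>\<^sup>+p. f (snd p, fst p) \<partial>kernel_pair)"
    by (subst nn_integral_kernel_pair) (auto simp: kern_commute)
  finally show ?thesis ..
qed

definition increment :: "(real \<Rightarrow> real) \<Rightarrow> real \<times> real \<Rightarrow> real" where
  "increment \<phi> p = \<phi> (fst p) - \<phi> (snd p)"

lemma increment_measurable [measurable]:
  assumes [measurable]: "\<phi> \<in> borel_measurable borel"
  shows "increment \<phi> \<in> borel_measurable (borel \<Otimes>\<^sub>M borel)"
  unfolding increment_def by measurable

abbreviation increment_mass :: "(real \<Rightarrow> real) \<Rightarrow> ennreal" where
  "increment_mass \<phi> \<equiv> \<integral>\<^sup>+p. ennreal \<bar>increment \<phi> p\<bar> \<partial>kernel_pair"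

text \<open>The increment has absolute value \<open>1\<close> exactly when one point lies in the interval and the other does not.
  The two tails of the kernel seen from a point \<open>x\<close> of the interval integrate to the powers \<open>2H - 1\<close> of
  the distances to \<open>a\<close> and \<open>b\<close>, and these to the power \<open>2H\<close> of the length.\<close>

lemma nn_integral_increment_indicator:
  assumes "a \<le> b"
  shows "increment_mass (indicator {a..<b}) = ennreal (2 * (b - a) powr (2 * H) / (H * (1 - 2 * H)))"
proof -
  let ?I = "{a..<b}"
  define f :: "real \<times> real \<Rightarrow> ennreal" where "f = (\<lambda>p. indicator ?I (fst p) * indicator (- ?I) (snd p))"
  have [measurable]: "f \<in> borel_measurable (borel \<Otimes>\<^sub>M borel)" unfolding f_def by measurable
  have "increment_mass (indicator ?I) = (\<integral>\<^sup>+p. f p + f (snd p, fst p) \<partial>kernel_pair)"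
    by (intro nn_integral_cong) (auto simp: f_def increment_def indicator_def)
  also have "\<dots> = (\<integral>\<^sup>+p. f p \<partial>kernel_pair) + (\<integral>\<^sup>+p. f (snd p, fst p) \<partial>kernel_pair)"
    by (rule nn_integral_add) measurable
  also have "\<dots> = 2 * (\<integral>\<^sup>+p. f p \<partial>kernel_pair)" by (simp add: nn_integral_kernel_pair_swap mult_2)
  also have "(\<integral>\<^sup>+p. f p \<partial>kernel_pair) = (\<integral>\<^sup>+x. \<integral>\<^sup>+y. ennreal (kern H (x - y)) * f (x, y) \<partial>lborel \<partial>lborel)"
    by (rule nn_integral_kernel_pair) measurable
  also have "\<dots> = (\<integral>\<^sup>+x. (ennreal ((x - a) powr (2 * H - 1)) * indicator {a<..<b} x
      + ennreal ((b - x) powr (2 * H - 1)) * indicator {a<..<b} x) * ennreal (1 / (1 - 2 * H)) \<partial>lborel)"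
  proof (rule nn_integral_cong_AE)
    have fib: "(\<integral>\<^sup>+y. ennreal (kern H (x - y)) * f (x, y) \<partial>lborel)
        = (ennreal ((x - a) powr (2 * H - 1)) * indicator {a<..<b} x
          + ennreal ((b - x) powr (2 * H - 1)) * indicator {a<..<b} x) * ennreal (1 / (1 - 2 * H))"
      if "x \<noteq> a" for x
    proof (cases "x \<in> {a<..<b}")
      case True
      have "(\<integral>\<^sup>+y. ennreal (kern H (x - y)) * f (x, y) \<partial>lborel)
          = (\<integral>\<^sup>+y. ennreal (kern H (x - y)) * indicator {..a} y + ennreal (kern H (x - y)) * indicator {b..} y \<partial>lborel)"
        by (intro nn_integral_cong_AE, use AE_lborel_singleton[of a] in eventually_elim)
          (use True in \<open>auto simp: indicator_def f_def\<close>)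
      also have "\<dots> = ennreal ((x - a) powr (2 * H - 1) / (1 - 2 * H)) + ennreal ((b - x) powr (2 * H - 1) / (1 - 2 * H))"
        using True by (subst nn_integral_add) (auto simp: nn_integral_kern_left nn_integral_kern_right)
      also have "\<dots> = (ennreal ((x - a) powr (2 * H - 1)) + ennreal ((b - x) powr (2 * H - 1))) * ennreal (1 / (1 - 2 * H))"
        unfolding distrib_right by (subst (1 2) ennreal_mult''[symmetric]) (use H_half in auto)
      finally show ?thesis using True by simp
    qed (use that in \<open>auto simp: f_def indicator_def\<close>)
    show "AE x in lborel. (\<integral>\<^sup>+y. ennreal (kern H (x - y)) * f (x, y) \<partial>lborel)
        = (ennreal ((x - a) powr (2 * H - 1)) * indicator {a<..<b} x
          + ennreal ((b - x) powr (2 * H - 1)) * indicator {a<..<b} x) * ennreal (1 / (1 - 2 * H))"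
      by (rule eventually_mono[OF AE_lborel_singleton[of a]]) (rule fib)
  qed
  also have "\<dots> = (ennreal ((b - a) powr (2 * H) / (2 * H)) + ennreal ((b - a) powr (2 * H) / (2 * H))) * ennreal (1 / (1 - 2 * H))"
    by (subst nn_integral_multc, measurable, subst nn_integral_add)
      (simp_all add: nn_integral_powr_singular[OF assms])
  also have "\<dots> = ennreal ((b - a) powr (2 * H) / (H * (1 - 2 * H)))"
  proof -
    have "(b - a) powr (2 * H) / (2 * H) + (b - a) powr (2 * H) / (2 * H) = (b - a) powr (2 * H) / H"
      by (simp add: field_simps)
    then show ?thesis using H_pos H_half
      by (subst ennreal_plus[symmetric], simp, simp, subst ennreal_mult''[symmetric]) auto
  qed
  also have "2 * ennreal ((b - a) powr (2 * H) / (H * (1 - 2 * H)))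
      = ennreal (2 * ((b - a) powr (2 * H) / (H * (1 - 2 * H))))"
    by (subst ennreal_mult') auto
  finally show ?thesis by simp
qed

end

context rough_hurst
begin

definition finite_energy :: "(real \<Rightarrow> real) \<Rightarrow> bool" where
  "finite_energy \<phi> \<longleftrightarrow> \<phi> \<in> borel_measurable borel \<and> integrable kernel_pair (\<lambda>p. (increment \<phi> p)\<^sup>2)"

text \<open>The constant makes the energy of the indicator of \<open>[a,b)\<close> equal to the variance \<open>(b - a) powr (2H)\<close> of the
  corresponding increment of fractional Brownian motion.\<close>

definition energy :: "(real \<Rightarrow> real) \<Rightarrow> (real \<Rightarrow> real) \<Rightarrow> real" where
  "energy \<phi> \<psi> = H * (1 - 2 * H) / 2 * (LINT p|kernel_pair. increment \<phi> p * increment \<psi> p)"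

lemma increment_add: "increment (\<lambda>x. \<phi> x + \<psi> x) p = increment \<phi> p + increment \<psi> p"
  and increment_diff: "increment (\<lambda>x. \<phi> x - \<psi> x) p = increment \<phi> p - increment \<psi> p"
  and increment_cmult: "increment (\<lambda>x. c * \<phi> x) p = c * increment \<phi> p"
  by (simp_all add: increment_def algebra_simps)

lemma finite_energy_measurable: "finite_energy \<phi> \<Longrightarrow> \<phi> \<in> borel_measurable borel"
  by (simp add: finite_energy_def)

lemma increment_measurable_kernel_pair:
  assumes "finite_energy \<phi>" shows "increment \<phi> \<in> borel_measurable kernel_pair"
  using increment_measurable[OF finite_energy_measurable[OF assms]]
  by (simp add: measurable_cong_sets[OF sets_kernel_pair refl])

lemma finite_energy_cmult: "finite_energy \<phi> \<Longrightarrow> finite_energy (\<lambda>x. c * \<phi> x)"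
  by (auto simp: finite_energy_def increment_cmult power_mult_distrib intro: borel_measurable_times)

lemma finite_energy_add:
  assumes "finite_energy \<phi>" "finite_energy \<psi>"
  shows "finite_energy (\<lambda>x. \<phi> x + \<psi> x)"
  unfolding finite_energy_def
proof
  show "(\<lambda>x. \<phi> x + \<psi> x) \<in> borel_measurable borel"
    using assms by (auto simp: finite_energy_def)
  have "integrable kernel_pair (\<lambda>p. 2 * (increment \<phi> p)\<^sup>2 + 2 * (increment \<psi> p)\<^sup>2)"
    using assms by (auto simp: finite_energy_def)
  then show "integrable kernel_pair (\<lambda>p. (increment (\<lambda>x. \<phi> x + \<psi> x) p)\<^sup>2)"
  proof (rule Bochner_Integration.integrable_bound)
    show "(\<lambda>p. (increment (\<lambda>x. \<phi> x + \<psi> x) p)\<^sup>2) \<in> borel_measurable kernel_pair"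
      unfolding increment_add using increment_measurable_kernel_pair[OF assms(1)] increment_measurable_kernel_pair[OF assms(2)] by measurable
    have "(a + b)\<^sup>2 \<le> 2 * a\<^sup>2 + 2 * b\<^sup>2" for a b :: real
      using sum_squares_ge_zero[of "a - b" 0] by (simp add: power2_eq_square algebra_simps)
    then show "AE p in kernel_pair. norm ((increment (\<lambda>x. \<phi> x + \<psi> x) p)\<^sup>2) \<le> norm (2 * (increment \<phi> p)\<^sup>2 + 2 * (increment \<psi> p)\<^sup>2)"
      unfolding increment_add by auto
  qed
qed

lemma finite_energy_diff:
  "finite_energy \<phi> \<Longrightarrow> finite_energy \<psi> \<Longrightarrow> finite_energy (\<lambda>x. \<phi> x - \<psi> x)"
  using finite_energy_add[of \<phi> "\<lambda>x. (- 1) * \<psi> x"] finite_energy_cmult[of \<psi> "- 1"] by simp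

lemma integrable_increment_mult_increment:
  assumes "finite_energy \<phi>" "finite_energy \<psi>"
  shows "integrable kernel_pair (\<lambda>p. increment \<phi> p * increment \<psi> p)"
proof -
  have "integrable kernel_pair (\<lambda>p. (increment \<phi> p)\<^sup>2 + (increment \<psi> p)\<^sup>2)"
    using assms by (auto simp: finite_energy_def)
  then show ?thesis
  proof (rule Bochner_Integration.integrable_bound)
    show "(\<lambda>p. increment \<phi> p * increment \<psi> p) \<in> borel_measurable kernel_pair"
      using increment_measurable_kernel_pair[OF assms(1)] increment_measurable_kernel_pair[OF assms(2)] by measurable
    have "\<bar>a * b\<bar> \<le> a\<^sup>2 + b\<^sup>2" for a b :: real
      using sum_squares_ge_zero[of "a - b" 0] sum_squares_ge_zero[of "a + b" 0]
        sum_squares_ge_zero[of a b]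
      by (simp add: power2_eq_square algebra_simps abs_le_iff)
    then show "AE p in kernel_pair. norm (increment \<phi> p * increment \<psi> p) \<le> norm ((increment \<phi> p)\<^sup>2 + (increment \<psi> p)\<^sup>2)" by auto
  qed
qed

lemma energy_commute: "energy \<phi> \<psi> = energy \<psi> \<phi>"
  by (simp add: energy_def mult.commute)

lemma energy_cmult_left: "energy (\<lambda>x. c * \<phi> x) \<psi> = c * energy \<phi> \<psi>"
  by (simp add: energy_def increment_cmult mult.assoc)

lemma energy_add_left:
  assumes "finite_energy \<phi>" "finite_energy \<psi>" "finite_energy \<theta>"
  shows "energy (\<lambda>x. \<phi> x + \<psi> x) \<theta> = energy \<phi> \<theta> + energy \<psi> \<theta>"
  using integrable_increment_mult_increment[OF assms(1,3)] integrable_increment_mult_increment[OF assms(2,3)]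
  by (simp add: energy_def increment_add distrib_left distrib_right)

lemma energy_diff_left:
  assumes "finite_energy \<phi>" "finite_energy \<psi>" "finite_energy \<theta>"
  shows "energy (\<lambda>x. \<phi> x - \<psi> x) \<theta> = energy \<phi> \<theta> - energy \<psi> \<theta>"
  using integrable_increment_mult_increment[OF assms(1,3)] integrable_increment_mult_increment[OF assms(2,3)]
  by (simp add: energy_def increment_diff right_diff_distrib left_diff_distrib)

lemma energy_diff_right:
  assumes "finite_energy \<phi>" "finite_energy \<psi>" "finite_energy \<theta>"
  shows "energy \<theta> (\<lambda>x. \<phi> x - \<psi> x) = energy \<theta> \<phi> - energy \<theta> \<psi>"
  using energy_diff_left[OF assms] by (simp add: energy_commute)

lemma energy_nonneg: "0 \<le> energy \<phi> \<phi>"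
  using H_pos H_half unfolding energy_def by simp

lemma energy_uminus: "energy (\<lambda>x. - \<phi> x) (\<lambda>x. - \<phi> x) = energy \<phi> \<phi>"
  by (simp add: energy_def increment_def algebra_simps)

lemma energy_diff_swap: "energy (\<lambda>x. \<phi> x - \<psi> x) (\<lambda>x. \<phi> x - \<psi> x) = energy (\<lambda>x. \<psi> x - \<phi> x) (\<lambda>x. \<psi> x - \<phi> x)"
  using energy_uminus[of "\<lambda>x. \<phi> x - \<psi> x"] by simp

lemma energy_diff_expand:
  assumes "finite_energy \<phi>" "finite_energy \<psi>"
  shows "energy (\<lambda>x. \<phi> x - \<psi> x) (\<lambda>x. \<phi> x - \<psi> x) = energy \<phi> \<phi> - 2 * energy \<phi> \<psi> + energy \<psi> \<psi>"
proof -
  note d = finite_energy_diff[OF assms]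
  show ?thesis
    using energy_diff_left[OF assms d] energy_diff_right[OF assms assms(1)]
      energy_diff_right[OF assms assms(2)] energy_commute[of \<phi> \<psi>] by simp
qed

lemma energy_add_expand:
  assumes "finite_energy \<phi>" "finite_energy \<psi>"
  shows "energy (\<lambda>x. \<phi> x + \<psi> x) (\<lambda>x. \<phi> x + \<psi> x) = energy \<phi> \<phi> + 2 * energy \<phi> \<psi> + energy \<psi> \<psi>"
proof -
  have "energy \<phi> (\<lambda>x. - 1 * \<psi> x) = - energy \<phi> \<psi>"
    using energy_cmult_left[of "- 1" \<psi> \<phi>] by (simp add: energy_commute)
  then show ?thesis
    using energy_diff_expand[OF assms(1) finite_energy_cmult[OF assms(2), of "- 1"]] energy_uminus[of \<psi>] by simp
qed

lemma energy_triangle: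
  assumes "finite_energy \<phi>" "finite_energy \<psi>" "finite_energy \<theta>"
  shows "energy (\<lambda>x. \<phi> x - \<theta> x) (\<lambda>x. \<phi> x - \<theta> x)
    \<le> 2 * energy (\<lambda>x. \<phi> x - \<psi> x) (\<lambda>x. \<phi> x - \<psi> x) + 2 * energy (\<lambda>x. \<psi> x - \<theta> x) (\<lambda>x. \<psi> x - \<theta> x)"
proof -
  note d = finite_energy_diff[OF assms(1,2)] finite_energy_diff[OF assms(2,3)]
  show ?thesis
    using energy_add_expand[OF d] energy_diff_expand[OF d]
      energy_nonneg[of "\<lambda>x. \<phi> x - \<psi> x - (\<psi> x - \<theta> x)"] by simp
qed

lemma energy_Cauchy_Schwarz:
  assumes "finite_energy \<phi>" "finite_energy \<psi>"
  shows "(energy \<phi> \<psi>)\<^sup>2 \<le> energy \<phi> \<phi> * energy \<psi> \<psi>"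
proof -
  have q: "0 \<le> energy \<phi> \<phi> - 2 * t * energy \<phi> \<psi> + t\<^sup>2 * energy \<psi> \<psi>" for t
  proof -
    have "energy (\<lambda>x. \<phi> x - t * \<psi> x) (\<lambda>x. \<phi> x - t * \<psi> x) = energy \<phi> \<phi> - 2 * t * energy \<phi> \<psi> + t\<^sup>2 * energy \<psi> \<psi>"
      using energy_diff_expand[OF assms(1) finite_energy_cmult[OF assms(2), of t]]
      by (simp add: energy_cmult_left energy_commute[of _ "\<lambda>x. t * \<psi> x"] energy_commute[of \<psi> \<phi>] power2_eq_square)
    then show ?thesis using energy_nonneg[of "\<lambda>x. \<phi> x - t * \<psi> x"] by simp
  qed
  show ?thesis
  proof (cases "energy \<psi> \<psi> = 0")
    case True
    have "energy \<phi> \<psi> = 0"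
    proof (rule ccontr)
      assume "energy \<phi> \<psi> \<noteq> 0"
      then show False using q[of "(energy \<phi> \<phi> + 1) / (2 * energy \<phi> \<psi>)"] True by simp
    qed
    then show ?thesis using True by simp
  next
    case False
    then have pos: "0 < energy \<psi> \<psi>" using energy_nonneg[of \<psi>] by simp
    have "0 \<le> energy \<phi> \<phi> - (energy \<phi> \<psi>)\<^sup>2 / energy \<psi> \<psi>"
      using q[of "energy \<phi> \<psi> / energy \<psi> \<psi>"] pos by (simp add: power2_eq_square field_simps)
    then show ?thesis using pos by (simp add: field_simps)
  qed
qed

lemma
  assumes "a \<le> b"
  shows finite_energy_indicator: "finite_energy (indicator {a..<b})"
    and energy_indicator: "energy (indicator {a..<b}) (indicator {a..<b}) = (b - a) powr (2 * H)"
proof -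
  have sq: "\<bar>increment (indicator {a..<b}) p\<bar> = (increment (indicator {a..<b}) p)\<^sup>2" for p
    by (auto simp: increment_def indicator_def)
  have [measurable]: "increment (indicator {a..<b}) \<in> borel_measurable (borel \<Otimes>\<^sub>M borel)" by measurable
  let ?v = "2 * (b - a) powr (2 * H) / (H * (1 - 2 * H))"
  have v: "0 \<le> ?v" using H_pos H_half by simp
  have i: "(\<integral>\<^sup>+p. ennreal ((increment (indicator {a..<b}) p)\<^sup>2) \<partial>kernel_pair) = ennreal ?v"
    using nn_integral_increment_indicator[OF assms] unfolding sq .
  have "has_bochner_integral kernel_pair (\<lambda>p. (increment (indicator {a..<b}) p)\<^sup>2) ?v"
    by (rule has_bochner_integral_nn_integral[OF _ _ v i]) auto
  then show "finite_energy (indicator {a..<b})"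
      and "energy (indicator {a..<b}) (indicator {a..<b}) = (b - a) powr (2 * H)"
    using H_pos H_half
    by (auto simp: finite_energy_def energy_def has_bochner_integral_iff power2_eq_square)
qed

text \<open>Polarization: the difference of the indicators of \<open>[0,t)\<close> and \<open>[0,s)\<close> is again an indicator, up to
  sign, so that all three norms are known.\<close>

lemma energy_initial_intervals:
  assumes "0 \<le> s" "0 \<le> t"
  shows "energy (indicator {0..<t}) (indicator {0..<s}) = fbm_cov H t s"
proof -
  have *: "energy (indicator {0..<t}) (indicator {0..<s}) = fbm_cov H t s" if "0 \<le> s" "s \<le> t" for s t
  proof -
    have "indicator {s..<t} = (\<lambda>x. indicator {0..<t} x - indicator {0..<s} x :: real)"
      using that by (auto simp: indicator_def fun_eq_iff)
    then show ?thesis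
      using energy_diff_expand[of "indicator {0..<t}" "indicator {0..<s}"] that
        finite_energy_indicator[of 0] energy_indicator[of 0] energy_indicator[of s t]
      by (simp add: fbm_cov_def)
  qed
  show ?thesis
  proof (cases "s \<le> t")
    case False
    then show ?thesis using *[of t s] assms
      by (simp add: energy_commute[of "indicator {0..<t}"] fbm_cov_def abs_minus_commute add.commute)
  qed (use * assms in auto)
qed

lemma energy_intervals:
  assumes "0 \<le> a" "a \<le> b" "0 \<le> p" "p \<le> q"
  shows "energy (indicator {a..<b}) (indicator {p..<q})
    = fbm_cov H b q - fbm_cov H b p - fbm_cov H a q + fbm_cov H a p"
proof -
  have *: "indicator {a..<b} = (\<lambda>x. indicator {0..<b} x - indicator {0..<a} x :: real)"
    if "0 \<le> a" "a \<le> b" for a b :: real using that by (auto simp: indicator_def fun_eq_iff)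
  note f = finite_energy_indicator[of 0]
  show ?thesis
    unfolding *[OF assms(1,2)] *[OF assms(3,4)]
    using assms f by (simp add: energy_diff_left energy_diff_right energy_initial_intervals finite_energy_diff)
qed

lemma step_fun_Cons: "step_fun ((c, a, b) # xs) = (\<lambda>x. c * indicator {a..<b} x + step_fun xs x)"
  by (simp add: step_fun_def)

lemma step_fun_Nil: "step_fun [] = (\<lambda>x. 0)" by (simp add: step_fun_def)

lemma finite_energy_zero: "finite_energy (\<lambda>x. 0)"
  by (simp add: finite_energy_def increment_def)

lemma energy_zero: "energy (\<lambda>x. 0) \<psi> = 0" by (simp add: energy_def increment_def)

lemma finite_energy_step_fun: "step_rep T xs \<Longrightarrow> finite_energy (step_fun xs)"
proof (induction xs)
  case (Cons z xs)
  then show ?case by (cases z)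
      (auto simp: step_fun_Cons step_rep_def intro!: finite_energy_add finite_energy_cmult finite_energy_indicator)
qed (simp add: step_fun_Nil finite_energy_zero)

lemma energy_step_fun_left:
  assumes "step_rep T xs" "finite_energy \<psi>"
  shows "energy (step_fun xs) \<psi> = (\<Sum>(c, a, b)\<leftarrow>xs. c * energy (indicator {a..<b}) \<psi>)"
  using assms(1)
proof (induction xs)
  case (Cons z xs)
  obtain c a b where z: "z = (c, a, b)" by (cases z)
  have "step_rep T xs" "a \<le> b" using Cons.prems by (auto simp: step_rep_def z)
  then show ?case using Cons.IH assms(2) finite_energy_step_fun[of T xs]
    by (simp add: z step_fun_Cons energy_add_left energy_cmult_left finite_energy_cmult finite_energy_indicator)
qed (simp add: step_fun_Nil energy_zero)

lemma energy_step_fun: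
  assumes "step_rep T xs" "step_rep T ys"
  shows "energy (step_fun xs) (step_fun ys) = (\<Sum>(c, a, b)\<leftarrow>xs. \<Sum>(d, p, q)\<leftarrow>ys.
            c * d * (fbm_cov H b q - fbm_cov H b p - fbm_cov H a q + fbm_cov H a p))"
proof -
  have "energy (step_fun xs) (step_fun ys) = (\<Sum>(c, a, b)\<leftarrow>xs. c * energy (indicator {a..<b}) (step_fun ys))"
    using energy_step_fun_left[OF assms(1) finite_energy_step_fun[OF assms(2)]] .
  also have "\<dots> = (\<Sum>(c, a, b)\<leftarrow>xs. \<Sum>(d, p, q)\<leftarrow>ys.
            c * d * (fbm_cov H b q - fbm_cov H b p - fbm_cov H a q + fbm_cov H a p))"
  proof (intro arg_cong[of _ _ sum_list] map_cong refl, safe)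
    fix c a b assume "(c, a, b) \<in> set xs"
    then have ab: "0 \<le> a" "a \<le> b" using assms(1) by (auto simp: step_rep_def)
    have "energy (indicator {a..<b}) (step_fun ys) = (\<Sum>(d, p, q)\<leftarrow>ys. d * energy (indicator {p..<q}) (indicator {a..<b}))"
      using energy_step_fun_left[OF assms(2) finite_energy_indicator[OF ab(2)]] by (simp add: energy_commute)
    also have "\<dots> = (\<Sum>(d, p, q)\<leftarrow>ys. d * (fbm_cov H b q - fbm_cov H b p - fbm_cov H a q + fbm_cov H a p))"
    proof (intro arg_cong[of _ _ sum_list] map_cong refl, safe)
      fix d p q assume "(d, p, q) \<in> set ys"
      then have "0 \<le> p" "p \<le> q" using assms(2) by (auto simp: step_rep_def)
      then show "d * energy (indicator {p..<q}) (indicator {a..<b})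
          = d * (fbm_cov H b q - fbm_cov H b p - fbm_cov H a q + fbm_cov H a p)"
        using energy_intervals[OF ab] by (simp add: energy_commute[of "indicator {p..<q}"])
    qed
    finally show "c * energy (indicator {a..<b}) (step_fun ys) = (\<Sum>(d, p, q)\<leftarrow>ys.
            c * d * (fbm_cov H b q - fbm_cov H b p - fbm_cov H a q + fbm_cov H a p))"
      by (simp add: sum_list_const_mult[symmetric] case_prod_unfold mult.assoc)
  qed
  finally show ?thesis .
qed

end

section \<open>The inner product of step functions\<close>

lemma gaussian_rv_square_integrable:
  assumes "prob_space M" "gaussian_rv M X"
  shows "integrable M (\<lambda>\<omega>. (X \<omega>)\<^sup>2)"
proof -
  interpret prob_space M by fact
  have [measurable]: "X \<in> borel_measurable M" using assms(2) by (simp add: gaussian_rv_def)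
  consider \<mu> where "AE \<omega> in M. X \<omega> = \<mu>"
    | \<mu> \<sigma> where "\<sigma> > 0" "distributed M lborel X (normal_density \<mu> \<sigma>)"
    using assms(2) by (auto simp: gaussian_rv_def)
  then show ?thesis
  proof cases
    case 1
    have "integrable M (\<lambda>\<omega>. \<mu>\<^sup>2)" by simp
    then show ?thesis
      by (rule integrable_cong_AE_imp) (use 1 in auto)
  next
    case 2
    have i: "integrable M (\<lambda>\<omega>. (X \<omega> - \<mu>) ^ k)" for k
      using distributed_integrable[OF 2(2), of "\<lambda>x. (x - \<mu>) ^ k"] integrable_normal_moment[OF 2(1)] by simp
    have "integrable M (\<lambda>\<omega>. (X \<omega> - \<mu>) ^ 2 + 2 * \<mu> * (X \<omega> - \<mu>) ^ 1 + \<mu>\<^sup>2)"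
      by (intro Bochner_Integration.integrable_add integrable_mult_right i integrable_const)
    moreover have "(X \<omega> - \<mu>) ^ 2 + 2 * \<mu> * (X \<omega> - \<mu>) ^ 1 + \<mu>\<^sup>2 = (X \<omega>)\<^sup>2" for \<omega>
      by (simp add: power2_eq_square algebra_simps)
    ultimately show ?thesis by simp
  qed
qed

text \<open>Expanding the product of increments needs the products \<open>B t * B s\<close> to be integrable, which the
  covariance formula alone does not give.\<close>

lemma fractional_brownian_motion_increments:
  assumes "fractional_brownian_motion M H T B" "a \<in> {0..T}" "b \<in> {0..T}" "p \<in> {0..T}" "q \<in> {0..T}"
  shows "(LINT \<omega>|M. (B b \<omega> - B a \<omega>) * (B q \<omega> - B p \<omega>))
    = fbm_cov H b q - fbm_cov H b p - fbm_cov H a q + fbm_cov H a p"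
proof -
  have "prob_space M" and g: "gaussian_process M {0..T} B"
    and cov: "\<And>t s. t \<in> {0..T} \<Longrightarrow> s \<in> {0..T} \<Longrightarrow> (LINT \<omega>|M. B t \<omega> * B s \<omega>) = fbm_cov H t s"
    using assms(1) by (auto simp: fractional_brownian_motion_def)
  have gr: "gaussian_rv M (B t)" if "t \<in> {0..T}" for t
    using g[unfolded gaussian_process_def, rule_format, of "{t}" "\<lambda>_. 1"] that by simp
  have i: "integrable M (\<lambda>\<omega>. B t \<omega> * B s \<omega>)" if "t \<in> {0..T}" "s \<in> {0..T}" for t s
  proof (rule Bochner_Integration.integrable_bound)
    show "integrable M (\<lambda>\<omega>. (B t \<omega>)\<^sup>2 + (B s \<omega>)\<^sup>2)"
      using that gaussian_rv_square_integrable[OF \<open>prob_space M\<close> gr] by auto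
    show "(\<lambda>\<omega>. B t \<omega> * B s \<omega>) \<in> borel_measurable M"
      using gr[OF that(1)] gr[OF that(2)] by (auto simp: gaussian_rv_def)
    have "\<bar>a * b\<bar> \<le> a\<^sup>2 + b\<^sup>2" for a b :: real
      using sum_squares_ge_zero[of "a - b" 0] sum_squares_ge_zero[of "a + b" 0]
        sum_squares_ge_zero[of a b]
      by (simp add: power2_eq_square algebra_simps abs_le_iff)
    then show "AE \<omega> in M. norm (B t \<omega> * B s \<omega>) \<le> norm ((B t \<omega>)\<^sup>2 + (B s \<omega>)\<^sup>2)" by auto
  qed
  have "(LINT \<omega>|M. (B b \<omega> - B a \<omega>) * (B q \<omega> - B p \<omega>))
    = (LINT \<omega>|M. (B b \<omega> * B q \<omega> - B b \<omega> * B p \<omega>) - (B a \<omega> * B q \<omega> - B a \<omega> * B p \<omega>))"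
    by (simp add: algebra_simps)
  also have "\<dots> = fbm_cov H b q - fbm_cov H b p - (fbm_cov H a q - fbm_cov H a p)"
    using assms(2-) i by (subst Bochner_Integration.integral_diff; simp add: cov)
  finally show ?thesis by simp
qed

lemma (in rough_hurst) step_inner_eq_energy:
  assumes fbm: "fractional_brownian_motion M H T B"
    and "\<phi> \<in> step_functions T" "\<psi> \<in> step_functions T"
  shows "step_inner M B T \<phi> \<psi> = energy \<phi> \<psi>"
proof -
  have eq: "(\<Sum>(c, a, b)\<leftarrow>xs. \<Sum>(d, p, q)\<leftarrow>ys.
            c * d * (LINT \<omega>|M. (B b \<omega> - B a \<omega>) * (B q \<omega> - B p \<omega>))) = energy (step_fun xs) (step_fun ys)"
    if "step_rep T xs" "step_rep T ys" for xs ys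
    unfolding energy_step_fun[OF that]
  proof (intro arg_cong[of _ _ sum_list] map_cong refl, safe)
    fix c a b assume 1: "(c, a, b) \<in> set xs"
    show "(\<Sum>(d, p, q)\<leftarrow>ys. c * d * (LINT \<omega>|M. (B b \<omega> - B a \<omega>) * (B q \<omega> - B p \<omega>)))
      = (\<Sum>(d, p, q)\<leftarrow>ys. c * d * (fbm_cov H b q - fbm_cov H b p - fbm_cov H a q + fbm_cov H a p))"
    proof (intro arg_cong[of _ _ sum_list] map_cong refl, safe)
      fix d p q assume 2: "(d, p, q) \<in> set ys"
      have "(LINT \<omega>|M. (B b \<omega> - B a \<omega>) * (B q \<omega> - B p \<omega>))
          = fbm_cov H b q - fbm_cov H b p - fbm_cov H a q + fbm_cov H a p"
        by (rule fractional_brownian_motion_increments[OF fbm])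
          (use 1 2 that in \<open>auto simp: step_rep_def\<close>)
      then show "c * d * (LINT \<omega>|M. (B b \<omega> - B a \<omega>) * (B q \<omega> - B p \<omega>))
          = c * d * (fbm_cov H b q - fbm_cov H b p - fbm_cov H a q + fbm_cov H a p)" by simp
    qed
  qed
  obtain xs ys where xy: "step_rep T xs" "\<phi> = step_fun xs" "step_rep T ys" "\<psi> = step_fun ys"
    using assms(2,3) by (auto simp: step_functions_def)
  show ?thesis
    unfolding step_inner_def
  proof (rule the_equality)
    fix r assume "\<forall>xs ys. step_rep T xs \<and> step_rep T ys \<and> \<phi> = step_fun xs \<and> \<psi> = step_fun ys \<longrightarrow>
     r = (\<Sum>(c, a, b)\<leftarrow>xs. \<Sum>(d, p, q)\<leftarrow>ys.
            c * d * (LINT \<omega>|M. (B b \<omega> - B a \<omega>) * (B q \<omega> - B p \<omega>)))"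
    then have "r = (\<Sum>(c, a, b)\<leftarrow>xs. \<Sum>(d, p, q)\<leftarrow>ys.
            c * d * (LINT \<omega>|M. (B b \<omega> - B a \<omega>) * (B q \<omega> - B p \<omega>)))" using xy by blast
    then show "r = energy \<phi> \<psi>" by (simp only: eq xy)
  qed (intro allI impI, elim conjE, simp only: eq)
qed

section \<open>Approximation of functions of bounded variation by step functions\<close>

text \<open>The extension of \<open>u\<close> from \<open>{0..T}\<close> to the line by constants, which preserves monotonicity; the extension
  by \<open>0\<close> does not.\<close>

definition monotone_clamp :: "real \<Rightarrow> (real \<Rightarrow> real) \<Rightarrow> real \<Rightarrow> real" where
  "monotone_clamp T u x = u (max 0 (min T x))"

lemma mono_monotone_clamp:
  assumes "mono_on {0..T} u" "0 < T" shows "mono (monotone_clamp T u)"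
  unfolding monotone_clamp_def
  by (intro monoI mono_onD[OF assms(1)]) (use assms(2) in auto)

lemma zero_ext_measurable_mono:
  assumes "mono_on {0..T} u" "0 < T" shows "zero_ext T u \<in> borel_measurable borel"
proof -
  have [measurable]: "monotone_clamp T u \<in> borel_measurable borel"
    using mono_monotone_clamp[OF assms] by (rule borel_measurable_mono)
  have "zero_ext T u = (\<lambda>x. indicator {0..T} x * monotone_clamp T u x)"
    by (auto simp: zero_ext_def monotone_clamp_def indicator_def fun_eq_iff min_def max_def)
  then show ?thesis by simp
qed

lemma card_nat_less:
  assumes "z \<le> real N" "0 \<le> z"
  shows "real (card {j. j < N \<and> real j < z}) \<in> {z..z + 1}"
proof -
  have "{j. j < N \<and> real j < z} = {..<nat \<lceil>z\<rceil>}"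
    using assms by (auto simp: less_ceiling_iff zless_nat_eq_int_zless)
  then show ?thesis using assms by simp
qed

context rough_hurst
begin

text \<open>The bound sees only the total weight of the indicators and not their number, which keeps it uniform
  along the approximations below.\<close>

lemma nn_integral_increment_step_fun:
  assumes "step_rep T xs" "0 < T"
  shows "increment_mass (step_fun xs)
    \<le> ennreal ((\<Sum>(c, a, b)\<leftarrow>xs. \<bar>c\<bar>) * (2 * T powr (2 * H) / (H * (1 - 2 * H))))"
  using assms(1)
proof (induction xs)
  case (Cons z xs)
  let ?C = "2 * T powr (2 * H) / (H * (1 - 2 * H))"
  have C: "0 \<le> ?C" using H_pos H_half by simp
  obtain c a b where z: "z = (c, a, b)" by (cases z)
  have xs: "step_rep T xs" and ab: "0 \<le> a" "a \<le> b" "b \<le> T" using Cons.prems by (auto simp: step_rep_def z)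
  have [measurable]: "step_fun xs \<in> borel_measurable borel"
    using finite_energy_step_fun[OF xs] by (rule finite_energy_measurable)
  have "increment_mass (step_fun (z # xs))
      \<le> (\<integral>\<^sup>+p. ennreal \<bar>c\<bar> * ennreal \<bar>increment (indicator {a..<b}) p\<bar> + ennreal \<bar>increment (step_fun xs) p\<bar> \<partial>kernel_pair)"
  proof (rule nn_integral_mono)
    fix p
    have "\<bar>increment (step_fun (z # xs)) p\<bar> \<le> \<bar>c\<bar> * \<bar>increment (indicator {a..<b}) p\<bar> + \<bar>increment (step_fun xs) p\<bar>"
      unfolding z step_fun_Cons increment_add increment_cmult
      by (rule order_trans[OF abs_triangle_ineq]) (simp add: abs_mult)
    then show "ennreal \<bar>increment (step_fun (z # xs)) p\<bar> \<le> ennreal \<bar>c\<bar> * ennreal \<bar>increment (indicator {a..<b}) p\<bar> + ennreal \<bar>increment (step_fun xs) p\<bar>"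
      by (simp add: ennreal_mult[symmetric] ennreal_plus[symmetric] del: ennreal_plus)
  qed
  also have "\<dots> = ennreal \<bar>c\<bar> * increment_mass (indicator {a..<b}) + increment_mass (step_fun xs)"
    by (simp add: nn_integral_add nn_integral_cmult)
  also have "\<dots> \<le> ennreal \<bar>c\<bar> * ennreal ?C + ennreal ((\<Sum>(c, a, b)\<leftarrow>xs. \<bar>c\<bar>) * ?C)"
  proof (intro add_mono mult_left_mono Cons.IH xs)
    have "2 * (b - a) powr (2 * H) / (H * (1 - 2 * H)) \<le> ?C"
      using H_pos H_half ab by (intro divide_right_mono mult_left_mono powr_mono2) auto
    then show "increment_mass (indicator {a..<b}) \<le> ennreal ?C"
      unfolding nn_integral_increment_indicator[OF ab(2)] by (rule ennreal_leI)
  qed simp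
  also have "\<dots> = ennreal ((\<Sum>(c, a, b)\<leftarrow>z # xs. \<bar>c\<bar>) * ?C)"
  proof -
    have e: "ennreal x * ennreal ?C + ennreal (y * ?C) = ennreal ((x + y) * ?C)" if "0 \<le> x" "0 \<le> y" for x y
      using that C by (simp only: ennreal_mult[symmetric] ennreal_plus[symmetric] mult_nonneg_nonneg distrib_right)
    have "0 \<le> (\<Sum>(c, a, b)\<leftarrow>xs. \<bar>c\<bar>)" by (intro sum_list_nonneg) auto
    then show ?thesis using e[of "\<bar>c\<bar>"] by (simp add: z)
  qed
  finally show ?case .
qed (simp add: step_fun_Nil increment_def)

text \<open>Layer cake: \<open>u\<close> is the integral over \<open>c\<close> of the indicators of \<open>{u > c}\<close>, which are intervals ending at
  \<open>T\<close>. Replacing the integral by its Riemann sum of mesh \<open>1/m\<close> rounds \<open>u\<close> up to the next multiple of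
  \<open>1/m\<close>, and the weights of the indicators still add up to about \<open>u T\<close>.\<close>

lemma monotone_step_approximation:
  assumes u: "mono_on {0..T} u" "\<And>x. x \<in> {0..T} \<Longrightarrow> 0 \<le> u x" and T: "0 < T"
  obtains \<phi> C where "0 \<le> C" "\<And>n. \<phi> n \<in> step_functions T"
    "\<And>n. AE x in lborel. \<bar>\<phi> n x - zero_ext T u x\<bar> \<le> 1 / real (Suc n)"
    "\<And>n. increment_mass (\<phi> n) \<le> ennreal C"
proof -
  define K where "K = u T"
  have K: "0 \<le> K" "u x \<le> K" if "x \<in> {0..T}" for x
    using u(2)[of T] T mono_onD[OF u(1), of x T] that unfolding K_def by auto
  have K0: "0 \<le> K" using K[of 0] T by simp
  \<comment> \<open>The point at which \<open>u\<close> passes the level \<open>c\<close>; it is \<open>T\<close> if the level is never exceeded.\<close>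
  define a where "a c = Inf ({x \<in> {0..T}. u x > c} \<union> {T})" for c
  have bdd: "bdd_below ({x \<in> {0..T}. u x > c} \<union> {T})" for c
    by (rule bdd_belowI[of _ 0]) (use T in auto)
  have a0: "0 \<le> a c" "a c \<le> T" for c
    unfolding a_def using T bdd by (auto intro!: cInf_greatest cInf_lower)
  \<comment> \<open>At \<open>x = a c\<close> either value of the indicator is possible; these points are discarded as a null set.\<close>
  have level: "a c < x \<longleftrightarrow> c < u x" if "0 \<le> x" "x < T" "x \<noteq> a c" for c x
  proof
    assume "a c < x"
    then obtain y where "y \<in> {x \<in> {0..T}. u x > c} \<union> {T}" "y < x"
      unfolding a_def using cInf_lessD[of "{x \<in> {0..T}. u x > c} \<union> {T}" x] by blast
    then show "c < u x" using that mono_onD[OF u(1), of y x] by auto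
  next
    assume "c < u x"
    then have "a c \<le> x" unfolding a_def using that bdd by (intro cInf_lower) auto
    then show "a c < x" using that by simp
  qed
  define N where "N m = nat \<lceil>real m * K\<rceil>" for m
  define xs where "xs m = map (\<lambda>j. (1 / real m, a (real j / real m), T)) [0..<N m]" for m
  have N: "real (N m) \<le> real m * K + 1" "real m * K \<le> real (N m)" for m
    unfolding N_def using K0 by (simp_all add: of_nat_nat)
  have rep: "step_rep T (xs m)" for m
    unfolding step_rep_def xs_def using a0 by auto
  have val: "step_fun (xs m) x = real (card {j. j < N m \<and> a (real j / real m) \<le> x}) / real m * indicator {..<T} x" for m x
  proof -
    have "step_fun (xs m) x = (\<Sum>j<N m. 1 / real m * indicator {a (real j / real m)..<T} x)"
      unfolding step_fun_def xs_def by (simp add: comp_def interv_sum_list_conv_sum_set_nat atLeast0LessThan)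
    also have "\<dots> = (\<Sum>j<N m. if a (real j / real m) \<le> x then 1 / real m * indicator {..<T} x else 0)"
      by (intro sum.cong) (auto simp: indicator_def)
    also have "\<dots> = (\<Sum>j | j < N m \<and> a (real j / real m) \<le> x. 1 / real m * indicator {..<T} x)"
      by (simp add: sum.If_cases Int_def)
    finally show ?thesis by simp
  qed
  let ?C = "(K + 1) * (2 * T powr (2 * H) / (H * (1 - 2 * H)))"
  show thesis
  proof (rule that[of ?C "\<lambda>n. step_fun (xs (Suc n))"])
    show "0 \<le> ?C" using K0 H_pos H_half by simp
    fix n :: nat
    let ?m = "Suc n"
    have rescale: "z / m \<in> {v..v + 1 / m}" if "0 < m" "z \<in> {m * v..m * v + 1}" for m z v :: real
      using that by (auto simp: field_simps)
    show "step_fun (xs ?m) \<in> step_functions T" using rep by (auto simp: step_functions_def)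
    have "AE x in lborel. x \<notin> insert T ((\<lambda>j. a (real j / real ?m)) ` {..<N ?m})"
      by (intro AE_not_in finite_imp_null_set_lborel) auto
    then show "AE x in lborel. \<bar>step_fun (xs ?m) x - zero_ext T u x\<bar> \<le> 1 / real ?m"
    proof (rule eventually_mono)
      fix x assume x: "x \<notin> insert T ((\<lambda>j. a (real j / real ?m)) ` {..<N ?m})"
      consider "x < 0" | "T < x" | "0 \<le> x" "x < T" using x by fastforce
      then show "\<bar>step_fun (xs ?m) x - zero_ext T u x\<bar> \<le> 1 / real ?m"
      proof cases
        case 1
        then have "\<not> a (real j / real ?m) \<le> x" for j using a0(1)[of "real j / real ?m"] by linarith
        then show ?thesis unfolding val using 1 by (simp add: zero_ext_def)
      next
        case 3
        have "{j. j < N ?m \<and> a (real j / real ?m) \<le> x} = {j. j < N ?m \<and> real j < real ?m * u x}"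
        proof (intro Collect_cong conj_cong refl)
          fix j assume "j < N ?m"
          then have ne: "x \<noteq> a (real j / real ?m)" using x by auto
          then have "a (real j / real ?m) \<le> x \<longleftrightarrow> a (real j / real ?m) < x" by auto
          also have "\<dots> \<longleftrightarrow> real j / real ?m < u x" by (rule level[OF 3 ne])
          also have "\<dots> \<longleftrightarrow> real j < real ?m * u x" by (simp add: field_simps)
          finally show "a (real j / real ?m) \<le> x \<longleftrightarrow> real j < real ?m * u x" .
        qed
        moreover have "real ?m * u x \<le> real (N ?m)"
          using K(2)[of x] 3 by (intro order_trans[OF mult_left_mono N(2)]) auto
        then have "real (card {j. j < N ?m \<and> real j < real ?m * u x}) \<in> {real ?m * u x..real ?m * u x + 1}"
          using u(2)[of x] 3 by (intro card_nat_less) auto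
        ultimately have "real (card {j. j < N ?m \<and> a (real j / real ?m) \<le> x}) \<in> {real ?m * u x..real ?m * u x + 1}"
          by simp
        then have "real (card {j. j < N ?m \<and> a (real j / real ?m) \<le> x}) / real ?m \<in> {u x..u x + 1 / real ?m}"
          by (rule rescale[rotated]) simp
        then show ?thesis unfolding val using 3 by (auto simp: zero_ext_def)
      qed (auto simp: val zero_ext_def)
    qed
    have "(\<Sum>(c, a, b)\<leftarrow>xs ?m. \<bar>c\<bar>) = real (N ?m) / real ?m"
      unfolding xs_def by (simp add: comp_def sum_list_triv)
    also have "\<dots> \<le> (real ?m * K + 1) / real ?m" by (intro divide_right_mono N) simp
    also have "\<dots> \<le> K + 1" using K0 by (simp add: field_simps)
    finally have le: "(\<Sum>(c, a, b)\<leftarrow>xs ?m. \<bar>c\<bar>) \<le> K + 1" .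
    show "increment_mass (step_fun (xs ?m)) \<le> ennreal ?C"
      by (rule order_trans[OF nn_integral_increment_step_fun[OF rep T]], intro ennreal_leI mult_right_mono le)
        (use H_pos H_half in auto)
  qed
qed

end

lemma step_functions_diff:
  assumes "\<phi> \<in> step_functions T" "\<psi> \<in> step_functions T"
  shows "(\<lambda>x. \<phi> x - \<psi> x) \<in> step_functions T"
proof -
  obtain xs ys where *: "\<phi> = step_fun xs" "step_rep T xs" "\<psi> = step_fun ys" "step_rep T ys"
    using assms by (auto simp: step_functions_def)
  define zs where "zs = xs @ map (\<lambda>(c, a, b). (- c, a, b)) ys"
  have "step_fun zs = (\<lambda>x. \<phi> x - \<psi> x)"
    unfolding zs_def * step_fun_def
    by (rule ext, induction ys) (simp_all add: case_prod_unfold)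
  moreover have "step_rep T zs" using *(2,4) unfolding zs_def step_rep_def by auto
  ultimately show ?thesis unfolding step_functions_def by (intro CollectI exI[of _ zs]) simp
qed

lemma bounded_variation_mono_difference:
  assumes "bounded_variation_on f {0..T}" "0 < T"
  obtains u v where "mono_on {0..T} u" "mono_on {0..T} v"
    "\<And>x. x \<in> {0..T} \<Longrightarrow> 0 \<le> u x" "\<And>x. x \<in> {0..T} \<Longrightarrow> 0 \<le> v x"
    "\<And>x. x \<in> {0..T} \<Longrightarrow> f x = u x - v x"
proof -
  obtain w where "\<And>x. 0 \<le> w x" and w: "\<And>x y. 0 \<le> x \<Longrightarrow> x \<le> y \<Longrightarrow> y \<le> T \<Longrightarrow> \<bar>f y - f x\<bar> \<le> w y - w x"
    by (rule bounded_variation_dominating_mono[OF assms]) (rule that; assumption)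
  show thesis
  proof (rule that[of "\<lambda>x. w x - w 0 + (f x - f 0) + \<bar>f 0\<bar>" "\<lambda>x. w x - w 0 + \<bar>f 0\<bar> - f 0"])
    fix x assume "x \<in> {0..T}"
    then show "0 \<le> w x - w 0 + (f x - f 0) + \<bar>f 0\<bar>" "0 \<le> w x - w 0 + \<bar>f 0\<bar> - f 0"
      using w[of 0 x] by auto
  next
    show "mono_on {0..T} (\<lambda>x. w x - w 0 + (f x - f 0) + \<bar>f 0\<bar>)"
    proof (rule mono_onI)
      fix r s assume "r \<in> {0..T}" "s \<in> {0..T}" "r \<le> s"
      then show "w r - w 0 + (f r - f 0) + \<bar>f 0\<bar> \<le> w s - w 0 + (f s - f 0) + \<bar>f 0\<bar>"
        using w[of r s] by auto
    qed
    show "mono_on {0..T} (\<lambda>x. w x - w 0 + \<bar>f 0\<bar> - f 0)"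
    proof (rule mono_onI)
      fix r s assume "r \<in> {0..T}" "s \<in> {0..T}" "r \<le> s"
      then show "w r - w 0 + \<bar>f 0\<bar> - f 0 \<le> w s - w 0 + \<bar>f 0\<bar> - f 0"
        using w[of r s] by auto
    qed
  qed simp
qed

lemma zero_ext_measurable:
  assumes "bounded_variation_on f {0..T}" "0 < T" shows "zero_ext T f \<in> borel_measurable borel"
proof -
  obtain u v where uv: "mono_on {0..T} u" "mono_on {0..T} v"
    "\<And>x. x \<in> {0..T} \<Longrightarrow> 0 \<le> u x" "\<And>x. x \<in> {0..T} \<Longrightarrow> 0 \<le> v x"
    "\<And>x. x \<in> {0..T} \<Longrightarrow> f x = u x - v x"
    by (rule bounded_variation_mono_difference[OF assms]) (rule that; assumption)
  have "zero_ext T f = (\<lambda>x. zero_ext T u x - zero_ext T v x)"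
    using uv(5) by (auto simp: zero_ext_def)
  then show ?thesis using zero_ext_measurable_mono[OF uv(1) assms(2)] zero_ext_measurable_mono[OF uv(2) assms(2)] by simp
qed

lemma zero_ext_bounded:
  assumes "bounded_variation_on f {0..T}" "0 < T"
  obtains K where "0 \<le> K" "\<And>x. \<bar>zero_ext T f x\<bar> \<le> K"
proof -
  obtain w where w: "\<And>x. 0 \<le> w x" "\<And>x y. 0 \<le> x \<Longrightarrow> x \<le> y \<Longrightarrow> y \<le> T \<Longrightarrow> \<bar>f y - f x\<bar> \<le> w y - w x"
    by (rule bounded_variation_dominating_mono[OF assms]) (rule that; assumption)
  have wT: "0 \<le> w T - w 0" using w(2)[of 0 T] assms(2) by auto
  have "\<bar>zero_ext T f x\<bar> \<le> \<bar>f 0\<bar> + (w T - w 0)" for x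
    using w(2)[of 0 x] w(2)[of x T] wT by (auto simp: zero_ext_def)
  then show thesis using wT by (intro that[of "\<bar>f 0\<bar> + (w T - w 0)"]) auto
qed

lemma (in rough_hurst) bounded_variation_step_approximation:
  assumes f: "bounded_variation_on f {0..T}" and T: "0 < T"
  obtains \<phi> C where "0 \<le> C" "\<And>n. \<phi> n \<in> step_functions T"
    "\<And>n. AE x in lborel. \<bar>\<phi> n x - zero_ext T f x\<bar> \<le> 2 / real (Suc n)"
    "\<And>n. increment_mass (\<phi> n) \<le> ennreal C"
proof -
  obtain u v where uv: "mono_on {0..T} u" "mono_on {0..T} v" "\<And>x. x \<in> {0..T} \<Longrightarrow> 0 \<le> u x"
    "\<And>x. x \<in> {0..T} \<Longrightarrow> 0 \<le> v x" "\<And>x. x \<in> {0..T} \<Longrightarrow> f x = u x - v x"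
    by (rule bounded_variation_mono_difference[OF assms]) (rule that; assumption)
  obtain \<phi> C where \<phi>: "0 \<le> C" "\<And>n. \<phi> n \<in> step_functions T"
    "\<And>n. AE x in lborel. \<bar>\<phi> n x - zero_ext T u x\<bar> \<le> 1 / real (Suc n)"
    "\<And>n. increment_mass (\<phi> n) \<le> ennreal C"
    by (rule monotone_step_approximation[OF uv(1,3) T], assumption) (rule that; assumption)
  obtain \<psi> C' where \<psi>: "0 \<le> C'" "\<And>n. \<psi> n \<in> step_functions T"
    "\<And>n. AE x in lborel. \<bar>\<psi> n x - zero_ext T v x\<bar> \<le> 1 / real (Suc n)"
    "\<And>n. increment_mass (\<psi> n) \<le> ennreal C'"
    by (rule monotone_step_approximation[OF uv(2,4) T], assumption) (rule that; assumption)
  show thesis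
  proof (rule that[of "C + C'" "\<lambda>n x. \<phi> n x - \<psi> n x"])
    fix n
    show "(\<lambda>x. \<phi> n x - \<psi> n x) \<in> step_functions T" by (intro step_functions_diff \<phi> \<psi>)
    show "AE x in lborel. \<bar>\<phi> n x - \<psi> n x - zero_ext T f x\<bar> \<le> 2 / real (Suc n)"
      using \<phi>(3)[of n] \<psi>(3)[of n]
    proof eventually_elim
      case (elim x)
      have "zero_ext T f x = zero_ext T u x - zero_ext T v x"
        using uv(5) by (auto simp: zero_ext_def)
      then show ?case using elim by (auto simp: abs_le_iff)
    qed
    have [measurable]: "\<phi> n \<in> borel_measurable borel" "\<psi> n \<in> borel_measurable borel"
      using \<phi>(2)[of n] \<psi>(2)[of n] finite_energy_step_fun finite_energy_measurable
      by (auto simp: step_functions_def)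
    have "increment_mass (\<lambda>x. \<phi> n x - \<psi> n x) \<le> (\<integral>\<^sup>+p. ennreal \<bar>increment (\<phi> n) p\<bar> + ennreal \<bar>increment (\<psi> n) p\<bar> \<partial>kernel_pair)"
      unfolding increment_diff by (intro nn_integral_mono) (auto simp: ennreal_plus[symmetric] simp del: ennreal_plus intro!: ennreal_leI)
    also have "\<dots> = increment_mass (\<phi> n) + increment_mass (\<psi> n)"
      by (simp add: nn_integral_add)
    also have "\<dots> \<le> ennreal (C + C')"
      using \<phi>(1) \<phi>(4)[of n] \<psi>(1) \<psi>(4)[of n] by (auto intro: add_mono)
    finally show "increment_mass (\<lambda>x. \<phi> n x - \<psi> n x) \<le> ennreal (C + C')" .
  qed (use \<phi>(1) \<psi>(1) in simp)
qed

context rough_hurst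
begin

section \<open>Bounded variation implies finite energy\<close>

lemma AE_kernel_pair:
  assumes "AE x in lborel. P x"
  shows "AE p in kernel_pair. P (fst p) \<and> P (snd p)"
proof -
  obtain N where N: "{x. \<not> P x} \<subseteq> N" "N \<in> null_sets lborel"
    using assms by (auto simp: eventually_ae_filter)
  have [measurable]: "N \<in> sets borel" using N(2) by (auto simp: null_sets_def)
  have a: "AE x in lborel. x \<notin> N" by (rule AE_not_in[OF N(2)])
  have "AE p in lborel \<Otimes>\<^sub>M lborel. fst p \<notin> N \<and> snd p \<notin> N"
  proof (rule lborel_pair.AE_pair_measure)
    show "{p \<in> space (lborel \<Otimes>\<^sub>M lborel). fst p \<notin> N \<and> snd p \<notin> N} \<in> sets (lborel \<Otimes>\<^sub>M lborel)"
      by measurable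
    show "AE x in lborel. AE y in lborel. fst (x, y) \<notin> N \<and> snd (x, y) \<notin> N"
      using a by eventually_elim (use a in simp)
  qed
  then have "AE p in lborel \<Otimes>\<^sub>M lborel. P (fst p) \<and> P (snd p)"
    by (rule eventually_mono) (use N(1) in auto)
  then show ?thesis
    unfolding kernel_pair_def by (subst AE_density, measurable) (erule eventually_mono, simp)
qed

lemma step_function_finite_energy: "\<phi> \<in> step_functions T \<Longrightarrow> finite_energy \<phi>"
  by (auto simp: step_functions_def intro: finite_energy_step_fun)

text \<open>Fatou's lemma along the step functions of the preceding approximation. The integral of the first power
  of the increment is finite here, and not only that of its square; this is what later allows Fubini's
  theorem without cutting off the singularity.\<close>

lemma nn_integral_increment_zero_ext_finite:
  assumes f: "bounded_variation_on f {0..T}" and T: "0 < T"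
  shows "increment_mass (zero_ext T f) < \<infinity>"
proof -
  obtain \<phi> C where \<phi>: "0 \<le> C" "\<And>n. \<phi> n \<in> step_functions T"
    "\<And>n. AE x in lborel. \<bar>\<phi> n x - zero_ext T f x\<bar> \<le> 2 / real (Suc n)"
    "\<And>n. increment_mass (\<phi> n) \<le> ennreal C"
    by (rule bounded_variation_step_approximation[OF f T]) (rule that; assumption)
  have [measurable]: "\<phi> n \<in> borel_measurable borel" for n
    by (rule finite_energy_measurable[OF step_function_finite_energy[OF \<phi>(2)]])
  have "AE x in lborel. \<forall>n. \<bar>\<phi> n x - zero_ext T f x\<bar> \<le> 2 / real (Suc n)"
    using \<phi>(3) by (simp add: AE_all_countable)
  then have "AE x in lborel. (\<lambda>n. \<phi> n x) \<longlonglongrightarrow> zero_ext T f x"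
  proof (rule eventually_mono)
    fix x assume x: "\<forall>n. \<bar>\<phi> n x - zero_ext T f x\<bar> \<le> 2 / real (Suc n)"
    have "(\<lambda>n. 2 / real (Suc n)) \<longlonglongrightarrow> 0"
      using tendsto_mult_right_zero[OF LIMSEQ_inverse_real_of_nat, of 2] by (simp add: divide_inverse)
    then have "(\<lambda>n. \<phi> n x - zero_ext T f x) \<longlonglongrightarrow> 0"
      by (rule Lim_null_comparison[rotated]) (use x in auto)
    then show "(\<lambda>n. \<phi> n x) \<longlonglongrightarrow> zero_ext T f x" by (rule LIM_zero_cancel)
  qed
  then have "AE p in kernel_pair. (\<lambda>n. \<phi> n (fst p)) \<longlonglongrightarrow> zero_ext T f (fst p) \<and> (\<lambda>n. \<phi> n (snd p)) \<longlonglongrightarrow> zero_ext T f (snd p)"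
    by (rule AE_kernel_pair)
  then have lim: "AE p in kernel_pair. ennreal \<bar>increment (zero_ext T f) p\<bar> = liminf (\<lambda>n. ennreal \<bar>increment (\<phi> n) p\<bar>)"
  proof (rule eventually_mono, elim conjE)
    fix p assume "(\<lambda>n. \<phi> n (fst p)) \<longlonglongrightarrow> zero_ext T f (fst p)" "(\<lambda>n. \<phi> n (snd p)) \<longlonglongrightarrow> zero_ext T f (snd p)"
    then have "(\<lambda>n. ennreal \<bar>increment (\<phi> n) p\<bar>) \<longlonglongrightarrow> ennreal \<bar>increment (zero_ext T f) p\<bar>"
      unfolding increment_def by (intro tendsto_ennrealI tendsto_rabs tendsto_diff)
    then show "ennreal \<bar>increment (zero_ext T f) p\<bar> = liminf (\<lambda>n. ennreal \<bar>increment (\<phi> n) p\<bar>)"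
      by (rule lim_imp_Liminf[OF sequentially_bot, symmetric])
  qed
  have "increment_mass (zero_ext T f) = (\<integral>\<^sup>+p. liminf (\<lambda>n. ennreal \<bar>increment (\<phi> n) p\<bar>) \<partial>kernel_pair)"
    by (rule nn_integral_cong_AE[OF lim])
  also have "\<dots> \<le> liminf (\<lambda>n. \<integral>\<^sup>+p. ennreal \<bar>increment (\<phi> n) p\<bar> \<partial>kernel_pair)"
    by (rule nn_integral_liminf) measurable
  also have "\<dots> \<le> limsup (\<lambda>n. \<integral>\<^sup>+p. ennreal \<bar>increment (\<phi> n) p\<bar> \<partial>kernel_pair)"
    by (rule Liminf_le_Limsup) simp
  also have "\<dots> \<le> ennreal C"
    by (rule Limsup_bounded) (use \<phi>(4) in auto)
  also have "\<dots> < \<infinity>" by simp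
  finally show ?thesis .
qed

lemma integrable_increment_zero_ext:
  assumes f: "bounded_variation_on f {0..T}" and T: "0 < T"
  shows "integrable kernel_pair (increment (zero_ext T f))"
proof (rule integrableI_bounded)
  have [measurable]: "zero_ext T f \<in> borel_measurable borel" by (rule zero_ext_measurable[OF f T])
  show "increment (zero_ext T f) \<in> borel_measurable kernel_pair" by measurable
qed (use nn_integral_increment_zero_ext_finite[OF f T] in simp)

lemma finite_energy_zero_ext:
  assumes f: "bounded_variation_on f {0..T}" and T: "0 < T"
  shows "finite_energy (zero_ext T f)"
  unfolding finite_energy_def
proof
  show m[measurable]: "zero_ext T f \<in> borel_measurable borel" by (rule zero_ext_measurable[OF f T])
  obtain K where K: "0 \<le> K" "\<And>x. \<bar>zero_ext T f x\<bar> \<le> K"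
    by (rule zero_ext_bounded[OF f T]) (rule that; assumption)
  have "integrable kernel_pair (\<lambda>p. 2 * K * increment (zero_ext T f) p)"
    by (intro integrable_mult_right integrable_increment_zero_ext f T)
  then show "integrable kernel_pair (\<lambda>p. (increment (zero_ext T f) p)\<^sup>2)"
  proof (rule Bochner_Integration.integrable_bound)
    show "(\<lambda>p. (increment (zero_ext T f) p)\<^sup>2) \<in> borel_measurable kernel_pair" by measurable
    have "(increment (zero_ext T f) p)\<^sup>2 \<le> \<bar>2 * K * increment (zero_ext T f) p\<bar>" for p
    proof -
      have "\<bar>increment (zero_ext T f) p\<bar> \<le> 2 * K"
        unfolding increment_def using K(2)[of "fst p"] K(2)[of "snd p"] by linarith
      then have "\<bar>increment (zero_ext T f) p\<bar> * \<bar>increment (zero_ext T f) p\<bar> \<le> 2 * K * \<bar>increment (zero_ext T f) p\<bar>"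
        by (rule mult_right_mono) simp
      then show ?thesis using K(1) by (simp add: abs_mult power2_eq_square abs_mult_self_eq)
    qed
    then show "AE p in kernel_pair. norm ((increment (zero_ext T f) p)\<^sup>2) \<le> norm (2 * K * increment (zero_ext T f) p)" by simp
  qed
qed

section \<open>The completion\<close>

definition sq_distance :: "(real \<Rightarrow> real) \<Rightarrow> (real \<Rightarrow> real) \<Rightarrow> real" where
  "sq_distance \<phi> \<psi> = energy (\<lambda>x. \<phi> x - \<psi> x) (\<lambda>x. \<phi> x - \<psi> x)"

lemma sq_distance_nonneg: "0 \<le> sq_distance \<phi> \<psi>" unfolding sq_distance_def by (rule energy_nonneg)
lemma sq_distance_commute: "sq_distance \<phi> \<psi> = sq_distance \<psi> \<phi>" unfolding sq_distance_def by (rule energy_diff_swap)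
lemma sq_distance_triangle:
  "finite_energy \<phi> \<Longrightarrow> finite_energy \<psi> \<Longrightarrow> finite_energy \<theta> \<Longrightarrow> sq_distance \<phi> \<theta> \<le> 2 * sq_distance \<phi> \<psi> + 2 * sq_distance \<psi> \<theta>"
  unfolding sq_distance_def by (rule energy_triangle)

lemma sq_distance_eq_nn_integral:
  assumes "finite_energy \<phi>" "finite_energy \<psi>"
  shows "ennreal (sq_distance \<phi> \<psi>) = ennreal (H * (1 - 2 * H) / 2) * (\<integral>\<^sup>+p. ennreal ((increment \<phi> p - increment \<psi> p)\<^sup>2) \<partial>kernel_pair)"
proof -
  have "integrable kernel_pair (\<lambda>p. (increment \<phi> p - increment \<psi> p)\<^sup>2)"
    using finite_energy_diff[OF assms] by (simp add: finite_energy_def increment_diff)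
  then have "(\<integral>\<^sup>+p. ennreal ((increment \<phi> p - increment \<psi> p)\<^sup>2) \<partial>kernel_pair) = ennreal (LINT p|kernel_pair. (increment \<phi> p - increment \<psi> p)\<^sup>2)"
    by (rule nn_integral_eq_integral) simp
  then show ?thesis using H_pos H_half
    by (simp add: sq_distance_def energy_def increment_diff power2_eq_square ennreal_mult'[symmetric])
qed

lemma sq_distance_tendsto_trans:
  assumes "\<And>n. finite_energy (\<phi> n)" "\<And>n. finite_energy (\<psi> n)" "\<And>n. finite_energy (\<theta> n)"
    and "(\<lambda>n. sq_distance (\<phi> n) (\<psi> n)) \<longlonglongrightarrow> 0" "(\<lambda>n. sq_distance (\<psi> n) (\<theta> n)) \<longlonglongrightarrow> 0"
  shows "(\<lambda>n. sq_distance (\<phi> n) (\<theta> n)) \<longlonglongrightarrow> 0"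
proof (rule Lim_null_comparison)
  show "\<forall>\<^sub>F n in sequentially. norm (sq_distance (\<phi> n) (\<theta> n)) \<le> 2 * sq_distance (\<phi> n) (\<psi> n) + 2 * sq_distance (\<psi> n) (\<theta> n)"
    using sq_distance_triangle[OF assms(1-3)] by (simp add: sq_distance_nonneg)
  show "(\<lambda>n. 2 * sq_distance (\<phi> n) (\<psi> n) + 2 * sq_distance (\<psi> n) (\<theta> n)) \<longlonglongrightarrow> 0"
    using tendsto_add[OF tendsto_mult_left[OF assms(4), of 2] tendsto_mult_left[OF assms(5), of 2]] by simp
qed

lemma step_fun_outside: "\<phi> \<in> step_functions T \<Longrightarrow> x \<notin> {0..T} \<Longrightarrow> \<phi> x = 0"
proof -
  have "step_rep T xs \<Longrightarrow> x \<notin> {0..T} \<Longrightarrow> step_fun xs x = 0" for xs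
    by (induction xs) (auto simp: step_fun_def step_rep_def indicator_def)
  then show "\<phi> \<in> step_functions T \<Longrightarrow> x \<notin> {0..T} \<Longrightarrow> \<phi> x = 0" by (auto simp: step_functions_def)
qed

lemma L2_distance_zero_ext:
  assumes "\<phi> \<in> step_functions T"
  shows "(\<integral>\<^sup>+x\<in>{0..T}. ennreal ((\<phi> x - f x)\<^sup>2) \<partial>lborel) = (\<integral>\<^sup>+x. ennreal ((\<phi> x - zero_ext T f x)\<^sup>2) \<partial>lborel)"
  by (intro nn_integral_cong) (auto simp: zero_ext_def indicator_def step_fun_outside[OF assms])

text \<open>If \<open>\<bar>\<phi> - f\<bar> \<le> d\<close> almost everywhere, the squared increment of \<open>\<phi> - f\<close> is at most \<open>2 d\<close> times the sum of the
  absolute increments of \<open>\<phi>\<close> and \<open>f\<close>, whose integrals are bounded. Uniform approximation thus controls the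
  energy.\<close>

lemma bounded_variation_approximation:
  assumes f: "bounded_variation_on f {0..T}" and T: "0 < T"
  obtains \<phi> where "\<And>n. \<phi> n \<in> step_functions T" "(\<lambda>n. sq_distance (\<phi> n) (zero_ext T f)) \<longlonglongrightarrow> 0"
    "(\<lambda>n. \<integral>\<^sup>+x\<in>{0..T}. ennreal ((\<phi> n x - f x)\<^sup>2) \<partial>lborel) \<longlonglongrightarrow> 0"
proof -
  obtain \<phi> C where \<phi>: "0 \<le> C" "\<And>n. \<phi> n \<in> step_functions T"
    "\<And>n. AE x in lborel. \<bar>\<phi> n x - zero_ext T f x\<bar> \<le> 2 / real (Suc n)"
    "\<And>n. increment_mass (\<phi> n) \<le> ennreal C"
    by (rule bounded_variation_step_approximation[OF f T]) (rule that; assumption)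
  let ?f = "zero_ext T f"
  have fe: "finite_energy (\<phi> n)" for n by (rule step_function_finite_energy[OF \<phi>(2)])
  have [measurable]: "\<phi> n \<in> borel_measurable borel" "?f \<in> borel_measurable borel" for n
    by (intro finite_energy_measurable fe, rule zero_ext_measurable[OF f T])
  obtain C' where C': "0 \<le> C'" "increment_mass ?f \<le> ennreal C'"
    using nn_integral_increment_zero_ext_finite[OF f T]
    by (metis (no_types, lifting) ennreal_cases infinity_ennreal_def less_irrefl order_refl)
  have null: "(\<lambda>n. 2 / real (Suc n)) \<longlonglongrightarrow> 0"
    using tendsto_mult_right_zero[OF LIMSEQ_inverse_real_of_nat, of 2] by (simp add: divide_inverse)
  have "sq_distance (\<phi> n) ?f \<le> H * (1 - 2 * H) / 2 * (2 * (2 / real (Suc n)) * (C + C'))" for n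
  proof -
    let ?d = "2 / real (Suc n)"
    have "AE p in kernel_pair. \<bar>\<phi> n (fst p) - ?f (fst p)\<bar> \<le> ?d \<and> \<bar>\<phi> n (snd p) - ?f (snd p)\<bar> \<le> ?d"
      by (rule AE_kernel_pair[OF \<phi>(3)])
    then have "AE p in kernel_pair. ennreal ((increment (\<phi> n) p - increment ?f p)\<^sup>2) \<le> ennreal (2 * ?d) * (ennreal \<bar>increment (\<phi> n) p\<bar> + ennreal \<bar>increment ?f p\<bar>)"
    proof (rule eventually_mono, elim conjE)
      fix p assume "\<bar>\<phi> n (fst p) - ?f (fst p)\<bar> \<le> ?d" "\<bar>\<phi> n (snd p) - ?f (snd p)\<bar> \<le> ?d"
      then have "\<bar>increment (\<phi> n) p - increment ?f p\<bar> \<le> 2 * ?d" unfolding increment_def by linarith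
      moreover have "\<bar>increment (\<phi> n) p - increment ?f p\<bar> \<le> \<bar>increment (\<phi> n) p\<bar> + \<bar>increment ?f p\<bar>" by simp
      ultimately have "\<bar>increment (\<phi> n) p - increment ?f p\<bar> * \<bar>increment (\<phi> n) p - increment ?f p\<bar> \<le> 2 * ?d * (\<bar>increment (\<phi> n) p\<bar> + \<bar>increment ?f p\<bar>)"
        by (intro mult_mono) auto
      then have "(increment (\<phi> n) p - increment ?f p)\<^sup>2 \<le> 2 * ?d * (\<bar>increment (\<phi> n) p\<bar> + \<bar>increment ?f p\<bar>)"
        by (simp only: power2_eq_square abs_mult_self_eq)
      then have "ennreal ((increment (\<phi> n) p - increment ?f p)\<^sup>2) \<le> ennreal (2 * ?d * (\<bar>increment (\<phi> n) p\<bar> + \<bar>increment ?f p\<bar>))"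
        by (rule ennreal_leI)
      also have "\<dots> = ennreal (2 * ?d) * (ennreal \<bar>increment (\<phi> n) p\<bar> + ennreal \<bar>increment ?f p\<bar>)"
        by (subst ennreal_mult) auto
      finally show "ennreal ((increment (\<phi> n) p - increment ?f p)\<^sup>2) \<le> ennreal (2 * ?d) * (ennreal \<bar>increment (\<phi> n) p\<bar> + ennreal \<bar>increment ?f p\<bar>)" .
    qed
    then have "(\<integral>\<^sup>+p. ennreal ((increment (\<phi> n) p - increment ?f p)\<^sup>2) \<partial>kernel_pair)
        \<le> (\<integral>\<^sup>+p. ennreal (2 * ?d) * (ennreal \<bar>increment (\<phi> n) p\<bar> + ennreal \<bar>increment ?f p\<bar>) \<partial>kernel_pair)"
      by (rule nn_integral_mono_AE)
    also have "\<dots> = ennreal (2 * ?d) * (increment_mass (\<phi> n) + increment_mass ?f)"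
      by (subst nn_integral_cmult, measurable, subst nn_integral_add) auto
    also have "\<dots> \<le> ennreal (2 * ?d) * (ennreal C + ennreal C')"
      by (intro mult_left_mono add_mono \<phi> C') simp
    also have "\<dots> = ennreal (2 * ?d * (C + C'))"
      using \<phi>(1) C'(1) by (subst ennreal_plus[symmetric], simp, simp, subst ennreal_mult[symmetric]) auto
    finally have "(\<integral>\<^sup>+p. ennreal ((increment (\<phi> n) p - increment ?f p)\<^sup>2) \<partial>kernel_pair) \<le> ennreal (2 * ?d * (C + C'))" .
    then have "ennreal (sq_distance (\<phi> n) ?f) \<le> ennreal (H * (1 - 2 * H) / 2) * ennreal (2 * ?d * (C + C'))"
      unfolding sq_distance_eq_nn_integral[OF fe finite_energy_zero_ext[OF f T]] by (rule mult_left_mono) simp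
    also have "\<dots> = ennreal (H * (1 - 2 * H) / 2 * (2 * ?d * (C + C')))"
      using H_pos H_half by (intro ennreal_mult'[symmetric]) simp
    finally show ?thesis using H_pos H_half \<phi>(1) C'(1) by (subst (asm) ennreal_le_iff) auto
  qed
  moreover have e: "H * (1 - 2 * H) / 2 * (2 * d * (C + C')) = H * (1 - 2 * H) * (C + C') * d" for d
    by (simp add: field_simps)
  ultimately have "norm (sq_distance (\<phi> n) ?f) \<le> H * (1 - 2 * H) * (C + C') * (2 / real (Suc n))" for n
    unfolding real_norm_def abs_of_nonneg[OF sq_distance_nonneg] by (simp only: e)
  then have g: "(\<lambda>n. sq_distance (\<phi> n) ?f) \<longlonglongrightarrow> 0"
    by (intro Lim_null_comparison[OF always_eventually tendsto_mult_right_zero[OF null]] allI)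
  have "(\<lambda>n. \<integral>\<^sup>+x\<in>{0..T}. ennreal ((\<phi> n x - f x)\<^sup>2) \<partial>lborel) \<longlonglongrightarrow> 0"
  proof (rule tendsto_sandwich[OF _ _ tendsto_const])
    have "(\<integral>\<^sup>+x\<in>{0..T}. ennreal ((\<phi> n x - f x)\<^sup>2) \<partial>lborel) \<le> ennreal ((2 / real (Suc n))\<^sup>2 * T)" for n
    proof -
      have "(\<integral>\<^sup>+x\<in>{0..T}. ennreal ((\<phi> n x - f x)\<^sup>2) \<partial>lborel) \<le> (\<integral>\<^sup>+x. ennreal ((2 / real (Suc n))\<^sup>2) * indicator {0..T} x \<partial>lborel)"
      proof (rule nn_integral_mono_AE, rule eventually_mono[OF \<phi>(3)[of n]])
        fix x assume x: "\<bar>\<phi> n x - zero_ext T f x\<bar> \<le> 2 / real (Suc n)"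
        show "ennreal ((\<phi> n x - f x)\<^sup>2) * indicator {0..T} x \<le> ennreal ((2 / real (Suc n))\<^sup>2) * indicator {0..T} x"
        proof (cases "x \<in> {0..T}")
          case True
          then have "\<bar>\<phi> n x - f x\<bar> \<le> 2 / real (Suc n)" using x by (simp add: zero_ext_def)
          then have "(\<phi> n x - f x)\<^sup>2 \<le> (2 / real (Suc n))\<^sup>2"
            by (metis abs_ge_zero power2_abs power_mono)
          then show ?thesis using True by (simp add: ennreal_leI)
        qed simp
      qed
      also have "\<dots> = ennreal ((2 / real (Suc n))\<^sup>2 * T)"
        using T by (subst nn_integral_cmult_indicator) (auto simp: ennreal_mult)
      finally show ?thesis .
    qed
    then show "\<forall>\<^sub>F n in sequentially. (\<integral>\<^sup>+x\<in>{0..T}. ennreal ((\<phi> n x - f x)\<^sup>2) \<partial>lborel) \<le> ennreal ((2 / real (Suc n))\<^sup>2 * T)"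
      by simp
    have "(\<lambda>n. (2 / real (Suc n))\<^sup>2 * T) \<longlonglongrightarrow> 0\<^sup>2 * T"
      by (intro tendsto_mult_right tendsto_power null)
    then show "(\<lambda>n. ennreal ((2 / real (Suc n))\<^sup>2 * T)) \<longlonglongrightarrow> 0"
      using tendsto_ennrealI[of _ "0\<^sup>2 * T"] by simp
  qed simp
  then show thesis by (rule that[OF \<phi>(2) g])
qed

end

context rough_hurst
begin

text \<open>Closability. A subsequence \<open>\<phi> (s k)\<close> converges to \<open>f\<close> almost everywhere, so Fatou's lemma bounds the distance
  of \<open>\<phi> n\<close> to \<open>f\<close> by the distances of \<open>\<phi> n\<close> to \<open>\<phi> (s k)\<close>, which the Cauchy property makes small.\<close>

lemma sq_distance_tendsto_of_L2:
  assumes f: "bounded_variation_on f {0..T}" and T: "0 < T"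
    and \<phi>: "\<And>n. \<phi> n \<in> step_functions T"
    and Cauchy: "\<And>e. 0 < e \<Longrightarrow> \<exists>N. \<forall>m\<ge>N. \<forall>n\<ge>N. sq_distance (\<phi> m) (\<phi> n) < e"
    and L2: "(\<lambda>n. \<integral>\<^sup>+x\<in>{0..T}. ennreal ((\<phi> n x - f x)\<^sup>2) \<partial>lborel) \<longlonglongrightarrow> 0"
  shows "(\<lambda>n. sq_distance (\<phi> n) (zero_ext T f)) \<longlonglongrightarrow> 0"
proof -
  let ?f = "zero_ext T f"
  let ?L = "\<lambda>n. \<integral>\<^sup>+x. ennreal ((\<phi> n x - ?f x)\<^sup>2) \<partial>lborel"
  have fe: "finite_energy (\<phi> n)" "finite_energy ?f" for n
    by (rule step_function_finite_energy[OF \<phi>], rule finite_energy_zero_ext[OF f T])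
  have [measurable]: "\<phi> n \<in> borel_measurable borel" "?f \<in> borel_measurable borel" for n
    by (rule finite_energy_measurable[OF fe(1)], rule finite_energy_measurable[OF fe(2)])
  have L: "?L \<longlonglongrightarrow> 0" using L2 unfolding L2_distance_zero_ext[OF \<phi>] .
  have "\<forall>\<^sub>F n in sequentially. ?L n < 1" by (rule order_tendstoD(2)[OF L]) simp
  \<comment> \<open>The first terms may be at infinite distance as far as the hypotheses tell, so the sequence is shifted.\<close>
  then obtain N0 where N0: "\<And>n. N0 \<le> n \<Longrightarrow> ?L n < 1" by (auto simp: eventually_sequentially)
  define v where "v n x = (\<phi> (n + N0) x - ?f x)\<^sup>2" for n x
  have v: "integrable lborel (v n)" for n
  proof (rule integrableI_bounded)
    show "v n \<in> borel_measurable lborel" unfolding v_def by measurable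
    have "?L (n + N0) < \<infinity>" using N0[of "n + N0"] by (simp add: less_trans[OF _ ennreal_one_less_top])
    then show "(\<integral>\<^sup>+x. ennreal (norm (v n x)) \<partial>lborel) < \<infinity>" by (simp add: v_def)
  qed
  have vL: "(LINT x|lborel. norm (v n x)) = enn2real (?L (n + N0))" for n
    by (subst integral_eq_nn_integral) (auto simp: v_def)
  have "(\<lambda>n. LINT x|lborel. norm (v n x)) \<longlonglongrightarrow> 0"
    unfolding vL using LIMSEQ_ignore_initial_segment[OF L, of N0]
    by (intro tendsto_enn2real) simp_all
  then obtain r :: "nat \<Rightarrow> nat" where r: "strict_mono r" "AE x in lborel. (\<lambda>n. v (r n) x) \<longlonglongrightarrow> 0"
    using tendsto_L1_AE_subseq[of lborel v, OF v] by blast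
  define s where "s n = r n + N0" for n
  have s: "n \<le> s n" for n using seq_suble[OF r(1), of n] by (simp add: s_def)
  have "AE x in lborel. (\<lambda>n. \<phi> (s n) x) \<longlonglongrightarrow> ?f x"
  proof (rule eventually_mono[OF r(2)])
    fix x assume "(\<lambda>n. v (r n) x) \<longlonglongrightarrow> 0"
    then have "(\<lambda>n. sqrt (v (r n) x)) \<longlonglongrightarrow> 0" using tendsto_real_sqrt by fastforce
    then have "(\<lambda>n. \<phi> (s n) x - ?f x) \<longlonglongrightarrow> 0"
      by (simp add: v_def s_def tendsto_rabs_zero_iff)
    then show "(\<lambda>n. \<phi> (s n) x) \<longlonglongrightarrow> ?f x" by (rule LIM_zero_cancel)
  qed
  note lim = AE_kernel_pair[OF this]
  show ?thesis
  proof (rule metric_LIMSEQ_I)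
    fix e :: real assume "0 < e"
    then obtain N where N: "\<And>m n. N \<le> m \<Longrightarrow> N \<le> n \<Longrightarrow> sq_distance (\<phi> m) (\<phi> n) < e / 2"
      using Cauchy[of "e / 2"] by fastforce
    have "sq_distance (\<phi> n) ?f \<le> e / 2" if n: "N \<le> n" for n
    proof -
      let ?c = "ennreal (H * (1 - 2 * H) / 2)"
      let ?K = "e / 2 / (H * (1 - 2 * H) / 2)"
      have cK: "?c * ennreal ?K = ennreal (e / 2)"
        using H_pos H_half by (subst ennreal_mult'[symmetric]) auto
      let ?G = "\<lambda>k p. ennreal ((increment (\<phi> n) p - increment (\<phi> (s k)) p)\<^sup>2)"
      have "AE p in kernel_pair. ennreal ((increment (\<phi> n) p - increment ?f p)\<^sup>2) = liminf (\<lambda>k. ?G k p)"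
      proof (rule eventually_mono[OF lim], elim conjE)
        fix p assume "(\<lambda>n. \<phi> (s n) (fst p)) \<longlonglongrightarrow> ?f (fst p)" "(\<lambda>n. \<phi> (s n) (snd p)) \<longlonglongrightarrow> ?f (snd p)"
        then have "(\<lambda>k. ?G k p) \<longlonglongrightarrow> ennreal ((increment (\<phi> n) p - increment ?f p)\<^sup>2)"
          unfolding increment_def by (intro tendsto_ennrealI tendsto_power tendsto_diff tendsto_const)
        then show "ennreal ((increment (\<phi> n) p - increment ?f p)\<^sup>2) = liminf (\<lambda>k. ?G k p)"
          by (rule lim_imp_Liminf[OF sequentially_bot, symmetric])
      qed
      then have "(\<integral>\<^sup>+p. ennreal ((increment (\<phi> n) p - increment ?f p)\<^sup>2) \<partial>kernel_pair) = (\<integral>\<^sup>+p. liminf (\<lambda>k. ?G k p) \<partial>kernel_pair)"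
        by (rule nn_integral_cong_AE)
      also have "\<dots> \<le> liminf (\<lambda>k. \<integral>\<^sup>+p. ?G k p \<partial>kernel_pair)"
        by (rule nn_integral_liminf) measurable
      also have "\<dots> \<le> limsup (\<lambda>k. \<integral>\<^sup>+p. ?G k p \<partial>kernel_pair)"
        by (rule Liminf_le_Limsup) simp
      also have "\<dots> \<le> ennreal ?K"
      proof (rule Limsup_bounded)
        show "\<forall>\<^sub>F k in sequentially. (\<integral>\<^sup>+p. ?G k p \<partial>kernel_pair) \<le> ennreal ?K"
          using eventually_ge_at_top[of N]
        proof eventually_elim
          case (elim k)
          then have "sq_distance (\<phi> n) (\<phi> (s k)) < e / 2" using n order_trans[OF elim s] by (intro N)
          then have "ennreal (sq_distance (\<phi> n) (\<phi> (s k))) \<le> ennreal (e / 2)" by (intro ennreal_leI) simp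
          then have "?c * (\<integral>\<^sup>+p. ?G k p \<partial>kernel_pair) \<le> ?c * ennreal ?K"
            unfolding sq_distance_eq_nn_integral[OF fe(1) fe(1)] cK .
          then show ?case using H_pos H_half by (subst (asm) ennreal_mult_le_mult_iff) auto
        qed
      qed
      finally have "ennreal (sq_distance (\<phi> n) ?f) \<le> ?c * ennreal ?K"
        unfolding sq_distance_eq_nn_integral[OF fe] by (rule mult_left_mono) simp
      then show ?thesis using \<open>0 < e\<close> unfolding cK by (subst (asm) ennreal_le_iff) auto
    qed
    then show "\<exists>no. \<forall>n\<ge>no. dist (sq_distance (\<phi> n) ?f) 0 < e"
      using \<open>0 < e\<close> sq_distance_nonneg by (intro exI[of _ N]) (fastforce simp: dist_real_def)
  qed
qed

context
  fixes M :: "'a measure" and B :: "real \<Rightarrow> 'a \<Rightarrow> real" and T :: real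
  assumes fbm: "fractional_brownian_motion M H T B" and T: "0 < T"
begin

lemma step_dist_eq_sq_distance:
  assumes "\<phi> \<in> step_functions T" "\<psi> \<in> step_functions T"
  shows "step_dist M B T \<phi> \<psi> = sqrt (sq_distance \<phi> \<psi>)"
  using step_inner_eq_energy[OF fbm step_functions_diff[OF assms] step_functions_diff[OF assms]]
  by (simp add: step_dist_def sq_distance_def)

lemma step_Cauchy_iff:
  "\<phi> \<in> step_Cauchy M B T \<longleftrightarrow> (\<forall>n. \<phi> n \<in> step_functions T) \<and>
     (\<forall>e>0. \<exists>N. \<forall>m\<ge>N. \<forall>n\<ge>N. sq_distance (\<phi> m) (\<phi> n) < e)"
proof (cases "\<forall>n. \<phi> n \<in> step_functions T")
  case True
  then have d: "step_dist M B T (\<phi> m) (\<phi> n) = sqrt (sq_distance (\<phi> m) (\<phi> n))" for m n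
    by (simp add: step_dist_eq_sq_distance)
  have "(\<forall>e>0. \<exists>N. \<forall>m\<ge>N. \<forall>n\<ge>N. sqrt (sq_distance (\<phi> m) (\<phi> n)) < e)
      \<longleftrightarrow> (\<forall>e>0. \<exists>N. \<forall>m\<ge>N. \<forall>n\<ge>N. sq_distance (\<phi> m) (\<phi> n) < e)"
  proof (intro iffI allI impI)
    fix e :: real assume *: "\<forall>e>0. \<exists>N. \<forall>m\<ge>N. \<forall>n\<ge>N. sqrt (sq_distance (\<phi> m) (\<phi> n)) < e" "0 < e"
    show "\<exists>N. \<forall>m\<ge>N. \<forall>n\<ge>N. sq_distance (\<phi> m) (\<phi> n) < e"
      using *(1)[rule_format, of "sqrt e"] *(2) by simp
  next
    fix e :: real assume *: "\<forall>e>0. \<exists>N. \<forall>m\<ge>N. \<forall>n\<ge>N. sq_distance (\<phi> m) (\<phi> n) < e" "0 < e"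
    then obtain N where "\<And>m n. N \<le> m \<Longrightarrow> N \<le> n \<Longrightarrow> sq_distance (\<phi> m) (\<phi> n) < e\<^sup>2"
      by (meson zero_less_power)
    then show "\<exists>N. \<forall>m\<ge>N. \<forall>n\<ge>N. sqrt (sq_distance (\<phi> m) (\<phi> n)) < e"
      using \<open>0 < e\<close> real_less_lsqrt[OF less_imp_le, of e] by (intro exI[of _ N]) simp
  qed
  then show ?thesis using True by (simp add: step_Cauchy_def d)
qed (auto simp: step_Cauchy_def)

lemma step_null_rel_iff:
  "(\<phi>, \<psi>) \<in> step_null_rel M B T \<longleftrightarrow> \<phi> \<in> step_Cauchy M B T \<and> \<psi> \<in> step_Cauchy M B T \<and>
     (\<lambda>n. sq_distance (\<phi> n) (\<psi> n)) \<longlonglongrightarrow> 0"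
proof (cases "\<phi> \<in> step_Cauchy M B T \<and> \<psi> \<in> step_Cauchy M B T")
  case True
  then have "step_dist M B T (\<phi> n) (\<psi> n) = sqrt (sq_distance (\<phi> n) (\<psi> n))" for n
    by (simp add: step_Cauchy_iff step_dist_eq_sq_distance)
  moreover have "(\<lambda>n. sqrt (sq_distance (\<phi> n) (\<psi> n))) \<longlonglongrightarrow> 0 \<longleftrightarrow> (\<lambda>n. sq_distance (\<phi> n) (\<psi> n)) \<longlonglongrightarrow> 0"
  proof
    assume "(\<lambda>n. sqrt (sq_distance (\<phi> n) (\<psi> n))) \<longlonglongrightarrow> 0"
    from tendsto_power[OF this, of 2] show "(\<lambda>n. sq_distance (\<phi> n) (\<psi> n)) \<longlonglongrightarrow> 0" by (simp add: sq_distance_nonneg)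
  next
    assume "(\<lambda>n. sq_distance (\<phi> n) (\<psi> n)) \<longlonglongrightarrow> 0"
    from tendsto_real_sqrt[OF this] show "(\<lambda>n. sqrt (sq_distance (\<phi> n) (\<psi> n))) \<longlonglongrightarrow> 0" by simp
  qed
  ultimately show ?thesis using True by (simp add: step_null_rel_def)
qed (auto simp: step_null_rel_def)

lemma Cauchy_of_sq_distance_tendsto:
  assumes "\<And>n. \<phi> n \<in> step_functions T" "finite_energy f" "(\<lambda>n. sq_distance (\<phi> n) f) \<longlonglongrightarrow> 0"
  shows "\<phi> \<in> step_Cauchy M B T"
  unfolding step_Cauchy_iff
proof (intro conjI allI impI assms(1))
  fix e :: real assume "0 < e"
  then obtain N where N: "\<And>n. N \<le> n \<Longrightarrow> sq_distance (\<phi> n) f < e / 4"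
    using order_tendstoD(2)[OF assms(3), of "e / 4"] by (auto simp: eventually_sequentially)
  have "sq_distance (\<phi> m) (\<phi> n) < e" if "N \<le> m" "N \<le> n" for m n
    using sq_distance_triangle[of "\<phi> m" f "\<phi> n"] N[OF that(1)] N[OF that(2)] sq_distance_commute[of f "\<phi> n"]
      step_function_finite_energy[OF assms(1)] assms(2) by fastforce
  then show "\<exists>N. \<forall>m\<ge>N. \<forall>n\<ge>N. sq_distance (\<phi> m) (\<phi> n) < e" by blast
qed

text \<open>An equivalence class of Cauchy sequences is described by its limit in energy, once one of its members
  converges.\<close>

lemma null_class_eq:
  assumes f: "finite_energy f" and \<phi>: "\<And>n. \<phi> n \<in> step_functions T" "(\<lambda>n. sq_distance (\<phi> n) f) \<longlonglongrightarrow> 0"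
  shows "step_null_rel M B T `` {\<phi>} = {\<psi> \<in> step_Cauchy M B T. (\<lambda>n. sq_distance (\<psi> n) f) \<longlonglongrightarrow> 0}"
proof (intro set_eqI iffI)
  note fe = step_function_finite_energy[OF \<phi>(1)]
  note C = Cauchy_of_sq_distance_tendsto[OF \<phi>(1) f \<phi>(2)]
  {
    fix \<psi> assume "\<psi> \<in> step_null_rel M B T `` {\<phi>}"
    then have \<psi>: "\<psi> \<in> step_Cauchy M B T" "(\<lambda>n. sq_distance (\<psi> n) (\<phi> n)) \<longlonglongrightarrow> 0"
      by (auto simp: step_null_rel_iff sq_distance_commute)
    then have "finite_energy (\<psi> n)" for n by (auto simp: step_Cauchy_iff step_function_finite_energy[of _ T])
    then have "(\<lambda>n. sq_distance (\<psi> n) f) \<longlonglongrightarrow> 0" using sq_distance_tendsto_trans[OF _ fe f \<psi>(2) \<phi>(2)] by simp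
    with \<psi> show "\<psi> \<in> {\<psi> \<in> step_Cauchy M B T. (\<lambda>n. sq_distance (\<psi> n) f) \<longlonglongrightarrow> 0}" by simp
  next
    fix \<psi> assume "\<psi> \<in> {\<psi> \<in> step_Cauchy M B T. (\<lambda>n. sq_distance (\<psi> n) f) \<longlonglongrightarrow> 0}"
    then have \<psi>: "\<psi> \<in> step_Cauchy M B T" "(\<lambda>n. sq_distance f (\<psi> n)) \<longlonglongrightarrow> 0"
      by (auto simp: sq_distance_commute)
    then have "finite_energy (\<psi> n)" for n by (auto simp: step_Cauchy_iff step_function_finite_energy[of _ T])
    then have "(\<lambda>n. sq_distance (\<phi> n) (\<psi> n)) \<longlonglongrightarrow> 0" using sq_distance_tendsto_trans[OF fe f _ \<phi>(2) \<psi>(2)] by simp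
    with \<psi> C show "\<psi> \<in> step_null_rel M B T `` {\<phi>}" by (simp add: step_null_rel_iff)
  }
qed

text \<open>Existence of the class comes from the approximation of \<open>f\<close>; uniqueness is closability, which turns
  convergence in \<open>L\<^sup>2\<close> of a Cauchy sequence into convergence in energy.\<close>

lemma H_elem_eq:
  assumes f: "bounded_variation_on f {0..T}"
  shows "H_elem M B T f = {\<psi> \<in> step_Cauchy M B T. (\<lambda>n. sq_distance (\<psi> n) (zero_ext T f)) \<longlonglongrightarrow> 0}" (is "_ = ?X")
  unfolding H_elem_def
proof (rule the_equality)
  note fe = finite_energy_zero_ext[OF f T]
  obtain \<phi> where \<phi>: "\<And>n. \<phi> n \<in> step_functions T" "(\<lambda>n. sq_distance (\<phi> n) (zero_ext T f)) \<longlonglongrightarrow> 0"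
    "(\<lambda>n. \<integral>\<^sup>+x\<in>{0..T}. ennreal ((\<phi> n x - f x)\<^sup>2) \<partial>lborel) \<longlonglongrightarrow> 0"
    by (rule bounded_variation_approximation[OF f T]) (rule that; assumption)
  note C = Cauchy_of_sq_distance_tendsto[OF \<phi>(1) fe \<phi>(2)]
  have "?X \<in> H_space M B T"
    unfolding H_space_def null_class_eq[OF fe \<phi>(1,2), symmetric] by (rule quotientI[OF C])
  moreover have "\<phi> \<in> ?X" using C \<phi>(2) by simp
  ultimately show "?X \<in> H_space M B T \<and>
      (\<exists>\<phi>\<in>?X. (\<lambda>n. \<integral>\<^sup>+x\<in>{0..T}. ennreal ((\<phi> n x - f x)\<^sup>2) \<partial>lborel) \<longlonglongrightarrow> 0)"
    using \<phi>(3) by blast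
next
  note fe = finite_energy_zero_ext[OF f T]
  fix X assume X: "X \<in> H_space M B T \<and>
      (\<exists>\<phi>\<in>X. (\<lambda>n. \<integral>\<^sup>+x\<in>{0..T}. ennreal ((\<phi> n x - f x)\<^sup>2) \<partial>lborel) \<longlonglongrightarrow> 0)"
  then obtain \<phi> \<psi> where \<psi>: "X = step_null_rel M B T `` {\<psi>}"
    and \<phi>: "\<phi> \<in> X" "(\<lambda>n. \<integral>\<^sup>+x\<in>{0..T}. ennreal ((\<phi> n x - f x)\<^sup>2) \<partial>lborel) \<longlonglongrightarrow> 0"
    unfolding H_space_def by (elim conjE bexE quotientE) 
  have r: "\<psi> \<in> step_Cauchy M B T" "\<phi> \<in> step_Cauchy M B T" "(\<lambda>n. sq_distance (\<psi> n) (\<phi> n)) \<longlonglongrightarrow> 0"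
    using \<phi>(1) unfolding \<psi> by (auto simp: step_null_rel_iff)
  have st: "\<psi> n \<in> step_functions T" "\<phi> n \<in> step_functions T" for n
    using r by (auto simp: step_Cauchy_iff)
  have "(\<lambda>n. sq_distance (\<phi> n) (zero_ext T f)) \<longlonglongrightarrow> 0"
    by (rule sq_distance_tendsto_of_L2[OF f T st(2) _ \<phi>(2)]) (use r(2) in \<open>auto simp: step_Cauchy_iff\<close>)
  then have "(\<lambda>n. sq_distance (\<psi> n) (zero_ext T f)) \<longlonglongrightarrow> 0"
    by (rule sq_distance_tendsto_trans[OF step_function_finite_energy[OF st(1)] step_function_finite_energy[OF st(2)] fe r(3)])
  then show "X = ?X" unfolding \<psi> by (rule null_class_eq[OF fe st(1)])
qed

lemma H_inner_eq_energy:
  assumes f: "bounded_variation_on f {0..T}" and g: "bounded_variation_on g {0..T}"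
  shows "H_inner M B T (H_elem M B T f) (H_elem M B T g) = energy (zero_ext T f) (zero_ext T g)"
  unfolding H_inner_def
proof (rule the_equality)
  let ?f = "zero_ext T f" and ?g = "zero_ext T g"
  note fef = finite_energy_zero_ext[OF f T] and feg = finite_energy_zero_ext[OF g T]
  have lim: "(\<lambda>n. step_inner M B T (\<phi> n) (\<psi> n)) \<longlonglongrightarrow> energy ?f ?g"
    if \<phi>: "\<phi> \<in> H_elem M B T f" and \<psi>: "\<psi> \<in> H_elem M B T g" for \<phi> \<psi>
  proof -
    have st: "\<phi> n \<in> step_functions T" "\<psi> n \<in> step_functions T" for n
      using \<phi> \<psi> unfolding H_elem_eq[OF f] H_elem_eq[OF g] by (auto simp: step_Cauchy_iff)
    have l: "(\<lambda>n. sq_distance (\<phi> n) ?f) \<longlonglongrightarrow> 0" "(\<lambda>n. sq_distance (\<psi> n) ?g) \<longlonglongrightarrow> 0"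
      using \<phi> \<psi> unfolding H_elem_eq[OF f] H_elem_eq[OF g] by auto
    note fe = step_function_finite_energy[OF st(1)] step_function_finite_energy[OF st(2)]
    have cs: "\<bar>energy \<alpha> \<beta>\<bar> \<le> sqrt (energy \<alpha> \<alpha>) * sqrt (energy \<beta> \<beta>)" if "finite_energy \<alpha>" "finite_energy \<beta>" for \<alpha> \<beta>
      using real_sqrt_le_mono[OF energy_Cauchy_Schwarz[OF that]] by (simp add: real_sqrt_mult)
    have split: "energy (\<phi> n) (\<psi> n) - energy ?f ?g
        = energy (\<lambda>x. \<phi> n x - ?f x) (\<lambda>x. \<psi> n x - ?g x) + energy (\<lambda>x. \<phi> n x - ?f x) ?g + energy ?f (\<lambda>x. \<psi> n x - ?g x)" for n
      using fe fef feg
      by (simp add: energy_diff_left energy_diff_right finite_energy_diff)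
    let ?a = "\<lambda>n. sqrt (sq_distance (\<phi> n) ?f)" and ?b = "\<lambda>n. sqrt (sq_distance (\<psi> n) ?g)"
    have "(\<lambda>n. energy (\<phi> n) (\<psi> n) - energy ?f ?g) \<longlonglongrightarrow> 0"
    proof (rule Lim_null_comparison[OF always_eventually])
      show "\<forall>n. norm (energy (\<phi> n) (\<psi> n) - energy ?f ?g)
          \<le> ?a n * ?b n + ?a n * sqrt (energy ?g ?g) + sqrt (energy ?f ?f) * ?b n"
      proof
        fix n
        note d = finite_energy_diff[OF fe(1)[of n] fef] finite_energy_diff[OF fe(2)[of n] feg]
        show "norm (energy (\<phi> n) (\<psi> n) - energy ?f ?g)
          \<le> ?a n * ?b n + ?a n * sqrt (energy ?g ?g) + sqrt (energy ?f ?f) * ?b n"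
          unfolding split real_norm_def sq_distance_def
          using cs[OF d] cs[OF d(1) feg] cs[OF fef d(2)] by linarith
      qed
      have ab: "?a \<longlonglongrightarrow> 0" "?b \<longlonglongrightarrow> 0"
        using tendsto_real_sqrt[OF l(1)] tendsto_real_sqrt[OF l(2)] by simp_all
      show "(\<lambda>n. ?a n * ?b n + ?a n * sqrt (energy ?g ?g) + sqrt (energy ?f ?f) * ?b n) \<longlonglongrightarrow> 0"
        using tendsto_add[OF tendsto_add[OF tendsto_mult[OF ab] tendsto_mult_right[OF ab(1)]] tendsto_mult_left[OF ab(2)]]
        by simp
    qed
    then show ?thesis
      unfolding step_inner_eq_energy[OF fbm st] by (rule LIM_zero_cancel)
  qed
  then show "\<forall>\<phi>\<in>H_elem M B T f. \<forall>\<psi>\<in>H_elem M B T g.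
      (\<lambda>n. step_inner M B T (\<phi> n) (\<psi> n)) \<longlonglongrightarrow> energy ?f ?g" by blast
  fix r assume r: "\<forall>\<phi>\<in>H_elem M B T f. \<forall>\<psi>\<in>H_elem M B T g. (\<lambda>n. step_inner M B T (\<phi> n) (\<psi> n)) \<longlonglongrightarrow> r"
  have ne: "\<exists>\<phi>. \<phi> \<in> H_elem M B T h" if h: "bounded_variation_on h {0..T}" for h
  proof -
    obtain \<phi> where \<phi>: "\<And>n. \<phi> n \<in> step_functions T" "(\<lambda>n. sq_distance (\<phi> n) (zero_ext T h)) \<longlonglongrightarrow> 0"
      "(\<lambda>n. \<integral>\<^sup>+x\<in>{0..T}. ennreal ((\<phi> n x - h x)\<^sup>2) \<partial>lborel) \<longlonglongrightarrow> 0"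
      by (rule bounded_variation_approximation[OF h T]) (rule that; assumption)
    then show ?thesis
      unfolding H_elem_eq[OF h] using Cauchy_of_sq_distance_tendsto[OF \<phi>(1) finite_energy_zero_ext[OF h T] \<phi>(2)] by blast
  qed
  obtain \<phi> \<psi> where "\<phi> \<in> H_elem M B T f" "\<psi> \<in> H_elem M B T g" using ne[OF f] ne[OF g] by blast
  then show "r = energy ?f ?g" using LIMSEQ_unique[OF r[rule_format] lim] by blast
qed

end

end

context rough_hurst
begin

section \<open>The energy as an iterated integral\<close>

lemma kernel_pair_altdef: "kernel_pair = density (lborel \<Otimes>\<^sub>M lborel) (\<lambda>p. ennreal (kern H (fst p - snd p)))"
  unfolding kernel_pair_def by (simp add: case_prod_unfold)

lemma
  fixes F :: "real \<times> real \<Rightarrow> real"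
  assumes F[measurable]: "F \<in> borel_measurable (borel \<Otimes>\<^sub>M borel)"
  shows integrable_kernel_pair_iff: "integrable kernel_pair F \<longleftrightarrow> integrable (lborel \<Otimes>\<^sub>M lborel) (\<lambda>p. F p * kern H (fst p - snd p))"
    and integral_kernel_pair: "(LINT p|kernel_pair. F p) = (LINT p|(lborel \<Otimes>\<^sub>M lborel). F p * kern H (fst p - snd p))"
proof -
  have F': "F \<in> borel_measurable (lborel \<Otimes>\<^sub>M lborel)" by measurable
  show "integrable kernel_pair F \<longleftrightarrow> integrable (lborel \<Otimes>\<^sub>M lborel) (\<lambda>p. F p * kern H (fst p - snd p))"
    unfolding kernel_pair_altdef by (subst integrable_density[OF F']) (auto simp: mult.commute)
  show "(LINT p|kernel_pair. F p) = (LINT p|(lborel \<Otimes>\<^sub>M lborel). F p * kern H (fst p - snd p))"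
    unfolding kernel_pair_altdef by (subst integral_density[OF F']) (auto simp: mult.commute)
qed

lemma integral_kernel_pair_swap:
  fixes F :: "real \<times> real \<Rightarrow> real"
  assumes F[measurable]: "F \<in> borel_measurable (borel \<Otimes>\<^sub>M borel)"
  shows "(LINT p|kernel_pair. F (snd p, fst p)) = (LINT p|kernel_pair. F p)"
proof -
  let ?G = "\<lambda>p. F p * kern H (fst p - snd p)"
  have "(LINT p|(lborel \<Otimes>\<^sub>M lborel). (case p of (x, y) \<Rightarrow> ?G (y, x))) = (LINT p|(lborel \<Otimes>\<^sub>M lborel). ?G p)"
    by (rule lborel_pair.integral_product_swap) measurable
  then show ?thesis
    by (simp add: integral_kernel_pair case_prod_unfold kern_commute[of H "snd _"])
qed

text \<open>Expanding \<open>g x - g y\<close> gives two absolutely convergent integrals, since \<open>g\<close> is bounded and the increment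
  of \<open>f\<close> is integrable. The exchange of \<open>x\<close> and \<open>y\<close> turns the second into the negative of the first.\<close>

lemma energy_fibrewise:
  assumes f: "bounded_variation_on f {0..T}" and g: "bounded_variation_on g {0..T}" and T: "0 < T"
  defines "W \<equiv> \<lambda>x y. (zero_ext T f x - zero_ext T f y) * kern H (x - y)"
  shows "AE x in lborel. integrable lborel (W x)"
    and "integrable lborel (\<lambda>x. zero_ext T g x * (LINT y|lborel. W x y))"
    and "energy (zero_ext T f) (zero_ext T g) = H * (1 - 2 * H) * (LINT x|lborel. zero_ext T g x * (LINT y|lborel. W x y))"
proof -
  let ?f = "zero_ext T f" and ?g = "zero_ext T g"
  have [measurable]: "?f \<in> borel_measurable borel" "?g \<in> borel_measurable borel"
    by (rule zero_ext_measurable[OF f T], rule zero_ext_measurable[OF g T])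
  obtain K where K: "0 \<le> K" "\<And>x. \<bar>?g x\<bar> \<le> K"
    by (rule zero_ext_bounded[OF g T]) (rule that; assumption)
  have iD: "integrable kernel_pair (increment ?f)" by (rule integrable_increment_zero_ext[OF f T])
  have bnd: "integrable kernel_pair (\<lambda>p. h p * increment ?f p)"
    if [measurable]: "h \<in> borel_measurable (borel \<Otimes>\<^sub>M borel)" and h: "\<And>p. \<bar>h p\<bar> \<le> K" for h
  proof (rule Bochner_Integration.integrable_bound)
    show "integrable kernel_pair (\<lambda>p. K * increment ?f p)" using iD by simp
    show "(\<lambda>p. h p * increment ?f p) \<in> borel_measurable kernel_pair" by measurable
    show "AE p in kernel_pair. norm (h p * increment ?f p) \<le> norm (K * increment ?f p)"
      using h K(1) by (auto simp: abs_mult intro!: mult_right_mono)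
  qed
  have i1: "integrable kernel_pair (\<lambda>p. ?g (fst p) * increment ?f p)" and i2: "integrable kernel_pair (\<lambda>p. ?g (snd p) * increment ?f p)"
    by (rule bnd; use K(2) in simp)+
  have "integrable (lborel \<Otimes>\<^sub>M lborel) (\<lambda>p. increment ?f p * kern H (fst p - snd p))"
    using iD by (subst (asm) integrable_kernel_pair_iff) auto
  from lborel_pair.AE_integrable_fst'[OF this]
  show "AE x in lborel. integrable lborel (W x)" by (simp add: W_def increment_def)
  have i3: "integrable (lborel \<Otimes>\<^sub>M lborel) (\<lambda>p. ?g (fst p) * increment ?f p * kern H (fst p - snd p))"
    using i1 by (subst (asm) integrable_kernel_pair_iff) auto
  from lborel_pair.integrable_fst'[OF this]
  show "integrable lborel (\<lambda>x. ?g x * (LINT y|lborel. W x y))"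
    by (simp add: W_def increment_def mult.assoc)
  have "energy ?f ?g = H * (1 - 2 * H) / 2 * ((LINT p|kernel_pair. ?g (fst p) * increment ?f p - ?g (snd p) * increment ?f p))"
    unfolding energy_def by (intro arg_cong2[where f = "(*)"] Bochner_Integration.integral_cong refl)
      (simp add: increment_def algebra_simps)
  also have "\<dots> = H * (1 - 2 * H) / 2 * ((LINT p|kernel_pair. ?g (fst p) * increment ?f p) - (LINT p|kernel_pair. ?g (snd p) * increment ?f p))"
    by (subst Bochner_Integration.integral_diff[OF i1 i2]) simp
  also have "(LINT p|kernel_pair. ?g (snd p) * increment ?f p) = (LINT p|kernel_pair. ?g (fst p) * (- increment ?f p))"
    by (subst integral_kernel_pair_swap[symmetric]) (auto simp: increment_def intro!: Bochner_Integration.integral_cong)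
  also have "\<dots> = - (LINT p|kernel_pair. ?g (fst p) * increment ?f p)" by simp
  also have "(LINT p|kernel_pair. ?g (fst p) * increment ?f p) = (LINT p|(lborel \<Otimes>\<^sub>M lborel). ?g (fst p) * increment ?f p * kern H (fst p - snd p))"
    by (rule integral_kernel_pair) measurable
  also have "\<dots> = (LINT x|lborel. ?g x * (LINT y|lborel. W x y))"
    unfolding lborel_pair.integral_fst'[OF i3, symmetric] by (simp add: W_def increment_def mult.assoc)
  finally show "energy ?f ?g = H * (1 - 2 * H) * (LINT x|lborel. ?g x * (LINT y|lborel. W x y))"
    by simp
qed

lemma kern_far_bound: "0 < \<epsilon> \<Longrightarrow> \<epsilon> \<le> \<bar>d\<bar> \<Longrightarrow> kern H d \<le> \<epsilon> powr (2 * H - 2)"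
  unfolding kern_def using H_half by (intro powr_mono2') auto

text \<open>At distance at least \<open>\<epsilon>\<close> from the diagonal the kernel is bounded, so Fubini's theorem applies to the
  product \<open>g x * f y\<close> itself.\<close>

lemma far_field:
  assumes f: "bounded_variation_on f {0..T}" and g: "bounded_variation_on g {0..T}" and T: "0 < T"
    and \<epsilon>: "0 < \<epsilon>"
  defines "F \<equiv> \<lambda>p. zero_ext T g (fst p) * (zero_ext T f (snd p) * kern H (fst p - snd p) * indicator {..fst p - \<epsilon>} (snd p))"
  shows "integrable (lborel \<Otimes>\<^sub>M lborel) F"
    and "(LINT p|(lborel \<Otimes>\<^sub>M lborel). F p)
      = (LINT t:{\<epsilon>..T}|lborel. g t * (LINT s:{0..t - \<epsilon>}|lborel. f s * (t - s) powr (2 * H - 2)))"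
proof -
  let ?f = "zero_ext T f" and ?g = "zero_ext T g"
  have [measurable]: "?f \<in> borel_measurable borel" "?g \<in> borel_measurable borel"
    by (rule zero_ext_measurable[OF f T], rule zero_ext_measurable[OF g T])
  obtain K where K: "0 \<le> K" "\<And>x. \<bar>?g x\<bar> \<le> K"
    by (rule zero_ext_bounded[OF g T]) (rule that; assumption)
  obtain L where L: "0 \<le> L" "\<And>x. \<bar>?f x\<bar> \<le> L"
    by (rule zero_ext_bounded[OF f T]) (rule that; assumption)
  let ?S = "{0..T} \<times> {0..T}" and ?c = "K * (L * \<epsilon> powr (2 * H - 2))"
  show iF: "integrable (lborel \<Otimes>\<^sub>M lborel) F"
  proof (rule Bochner_Integration.integrable_bound)
    have "emeasure (lborel \<Otimes>\<^sub>M lborel) ?S < \<infinity>"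
      by (subst lborel.emeasure_pair_measure_Times) (auto simp: ennreal_mult_less_top emeasure_lborel_Icc_eq)
    then show "integrable (lborel \<Otimes>\<^sub>M lborel) (\<lambda>p. ?c * indicator ?S p)"
      by (intro integrable_mult_right integrable_real_indicator) auto
    show "F \<in> borel_measurable (lborel \<Otimes>\<^sub>M lborel)" unfolding F_def indicator_def atMost_iff by measurable
    have "\<bar>F p\<bar> \<le> ?c * indicator ?S p" for p
    proof (cases "p \<in> ?S \<and> snd p \<le> fst p - \<epsilon>")
      case True
      have "\<bar>F p\<bar> = \<bar>?g (fst p)\<bar> * (\<bar>?f (snd p)\<bar> * kern H (fst p - snd p))"
        using True by (simp add: F_def abs_mult)
      also have "\<dots> \<le> ?c"
        using True K L \<epsilon> by (intro mult_mono kern_far_bound mult_nonneg_nonneg) auto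
      finally show ?thesis using True by simp
    next
      case False
      then have "F p = 0" by (cases p) (auto simp: F_def zero_ext_def)
      then show ?thesis using K L by simp
    qed
    then show "AE p in lborel \<Otimes>\<^sub>M lborel. norm (F p) \<le> norm (?c * indicator ?S p)"
      using K L by auto
  qed
  have inner: "(LINT y|lborel. ?f y * kern H (x - y) * indicator {..x - \<epsilon>} y)
      = (LINT s:{0..x - \<epsilon>}|lborel. f s * (x - s) powr (2 * H - 2))" if "x \<le> T" for x
    unfolding set_lebesgue_integral_def
    by (intro Bochner_Integration.integral_cong)
      (use that \<epsilon> in \<open>auto simp: zero_ext_def kern_def indicator_def\<close>)
  have "(LINT p|(lborel \<Otimes>\<^sub>M lborel). F p) = (LINT x|lborel. ?g x * (LINT y|lborel. ?f y * kern H (x - y) * indicator {..x - \<epsilon>} y))"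
    unfolding lborel_pair.integral_fst'[OF iF, symmetric] by (simp add: F_def)
  also have "\<dots> = (LINT t:{\<epsilon>..T}|lborel. g t * (LINT s:{0..t - \<epsilon>}|lborel. f s * (t - s) powr (2 * H - 2)))"
    unfolding set_lebesgue_integral_def[of _ "{\<epsilon>..T}"]
  proof (intro Bochner_Integration.integral_cong refl)
    fix x
    show "?g x * (LINT y|lborel. ?f y * kern H (x - y) * indicator {..x - \<epsilon>} y)
      = indicator {\<epsilon>..T} x *\<^sub>R (g x * (LINT s:{0..x - \<epsilon>}|lborel. f s * (x - s) powr (2 * H - 2)))"
    proof (cases "x \<in> {\<epsilon>..T}")
      case True
      then show ?thesis using inner \<epsilon> by (auto simp: zero_ext_def)
    next
      case False
      then have "?g x = 0 \<or> (x \<le> T \<and> x < \<epsilon>)" by (auto simp: zero_ext_def)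
      then show ?thesis
      proof
        assume x: "x \<le> T \<and> x < \<epsilon>"
        then have e: "{0..x - \<epsilon>} = {}" by auto
        show ?thesis using False unfolding inner[OF conjunct1[OF x]] by (simp add: e set_lebesgue_integral_def)
      qed (use False in simp)
    qed
  qed
  finally show "(LINT p|(lborel \<Otimes>\<^sub>M lborel). F p)
      = (LINT t:{\<epsilon>..T}|lborel. g t * (LINT s:{0..t - \<epsilon>}|lborel. f s * (t - s) powr (2 * H - 2)))" .
qed

text \<open>The windowed function \<open>z x\<close> agrees with \<open>f\<close> at \<open>x\<close>, so replacing \<open>f\<close> by \<open>z x\<close> affects only the term
  \<open>f y\<close>, and only outside the window. The second double integral of the conclusion appears with
  its variables exchanged. The function \<open>L\<close> stands for the Stieltjes integral; its measurability is a
  hypothesis because an integral of a function that is measurable only after a change on a null set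
  would be \<open>0\<close>.\<close>

lemma energy_near_far_split:
  fixes L :: "real \<Rightarrow> real"
  assumes f: "bounded_variation_on f {0..T}" and g: "bounded_variation_on g {0..T}" and T: "0 < T"
    and \<epsilon>: "0 < \<epsilon>\<^sub>1" "0 < \<epsilon>\<^sub>2"
  defines "z \<equiv> \<lambda>t. zero_ext T (\<lambda>s. f s * indicator {max (t - \<epsilon>\<^sub>1) 0..min (t + \<epsilon>\<^sub>2) T} s)"
  assumes L: "AE x in lborel. 0 < x \<longrightarrow> x < T \<longrightarrow>
        L x = - (1 - 2 * H) * (LINT y|lborel. (z x x - z x y) * kern H (x - y))"
    and L_meas [measurable]: "(\<lambda>x. zero_ext T g x * L x) \<in> borel_measurable borel"
  shows "energy (zero_ext T f) (zero_ext T g) =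
        H * (2 * H - 1) *
          ((LINT t:{\<epsilon>\<^sub>1..T}|lborel. g t * (LINT s:{0..t - \<epsilon>\<^sub>1}|lborel. f s * (t - s) powr (2 * H - 2))) +
           (LINT s:{\<epsilon>\<^sub>2..T}|lborel. f s * (LINT t:{0..s - \<epsilon>\<^sub>2}|lborel. g t * (s - t) powr (2 * H - 2))))
        - H * (LINT t:{0..T}|lborel. g t * L t)"
proof -
  let ?f = "zero_ext T f" and ?g = "zero_ext T g"
  have [measurable]: "?f \<in> borel_measurable borel" "?g \<in> borel_measurable borel"
    by (rule zero_ext_measurable[OF f T], rule zero_ext_measurable[OF g T])
  obtain K where K: "0 \<le> K" "\<And>x. \<bar>?f x\<bar> \<le> K"
    by (rule zero_ext_bounded[OF f T]) (rule that; assumption)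
  define W where "W x y = (?f x - ?f y) * kern H (x - y)" for x y
  define Fa where "Fa x y = ?f y * kern H (x - y) * indicator {..x - \<epsilon>\<^sub>1} y" for x y
  define Fb where "Fb x y = ?f y * kern H (x - y) * indicator {x + \<epsilon>\<^sub>2..} y" for x y
  note W = energy_fibrewise[OF f g T, folded W_def]
  let ?A = "LINT t:{\<epsilon>\<^sub>1..T}|lborel. g t * (LINT s:{0..t - \<epsilon>\<^sub>1}|lborel. f s * (t - s) powr (2 * H - 2))"
  let ?B = "LINT s:{\<epsilon>\<^sub>2..T}|lborel. f s * (LINT t:{0..s - \<epsilon>\<^sub>2}|lborel. g t * (s - t) powr (2 * H - 2))"
  note far_a = far_field[OF f g T \<epsilon>(1)] and far_b = far_field[OF g f T \<epsilon>(2)]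
  have ga: "integrable lborel (\<lambda>x. ?g x * (LINT y|lborel. Fa x y))" "(LINT x|lborel. ?g x * (LINT y|lborel. Fa x y)) = ?A"
    using lborel_pair.integrable_fst'[OF far_a(1)] lborel_pair.integral_fst'[OF far_a(1)] far_a(2)
    unfolding Fa_def by simp_all
  let ?G = "\<lambda>p. ?f (fst p) * (?g (snd p) * kern H (fst p - snd p) * indicator {..fst p - \<epsilon>\<^sub>2} (snd p))"
  have G_swap: "(case p of (x, y) \<Rightarrow> ?G (y, x)) = ?g (fst p) * Fb (fst p) (snd p)" for p
    by (auto simp: Fb_def indicator_def kern_commute[of H "snd p"] case_prod_unfold)
  have gb': "integrable (lborel \<Otimes>\<^sub>M lborel) (\<lambda>p. ?g (fst p) * Fb (fst p) (snd p))"
    "(LINT p|(lborel \<Otimes>\<^sub>M lborel). ?g (fst p) * Fb (fst p) (snd p)) = ?B"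
    using lborel_pair.integrable_product_swap[OF far_b(1)]
      lborel_pair.integral_product_swap[OF borel_measurable_integrable[OF far_b(1)]] far_b(2)
    unfolding G_swap by simp_all
  have gb: "integrable lborel (\<lambda>x. ?g x * (LINT y|lborel. Fb x y))" "(LINT x|lborel. ?g x * (LINT y|lborel. Fb x y)) = ?B"
    using lborel_pair.integrable_fst'[OF gb'(1)] lborel_pair.integral_fst'[OF gb'(1)] gb'(2) by simp_all
  have bnd: "integrable lborel (\<lambda>y. ?f y * kern H (x - y) * indicator S y)"
    if [measurable]: "S \<in> sets borel" and S: "\<And>y. y \<in> S \<Longrightarrow> \<epsilon> \<le> \<bar>x - y\<bar>" and "0 < \<epsilon>" for S x \<epsilon>
  proof (rule Bochner_Integration.integrable_bound)
    show "integrable lborel (\<lambda>y. K * \<epsilon> powr (2 * H - 2) * indicator {0..T} y)"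
      by (intro integrable_mult_right integrable_real_indicator) (auto simp: emeasure_lborel_Icc_eq)
    show "(\<lambda>y. ?f y * kern H (x - y) * indicator S y) \<in> borel_measurable lborel" by measurable
    have "\<bar>?f y * kern H (x - y) * indicator S y\<bar> \<le> K * \<epsilon> powr (2 * H - 2) * indicator {0..T} y" for y
    proof (cases "y \<in> S \<inter> {0..T}")
      case True
      then show ?thesis using K S[of y] \<open>0 < \<epsilon>\<close>
        by (auto simp: abs_mult intro!: mult_mono kern_far_bound)
    qed (use K(1) in \<open>auto simp: zero_ext_def indicator_def\<close>)
    then show "AE y in lborel. norm (?f y * kern H (x - y) * indicator S y) \<le> norm (K * \<epsilon> powr (2 * H - 2) * indicator {0..T} y)"
      using K(1) by auto
  qed
  have near: "(LINT y|lborel. (z x x - z x y) * kern H (x - y))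
      = (LINT y|lborel. W x y) + (LINT y|lborel. Fa x y) + (LINT y|lborel. Fb x y)"
    if x: "0 < x" "x < T" and iW: "integrable lborel (W x)" for x
  proof -
    have ia: "integrable lborel (Fa x)" unfolding Fa_def by (rule bnd[OF _ _ \<epsilon>(1)]) auto
    have ib: "integrable lborel (Fb x)" unfolding Fb_def by (rule bnd[OF _ _ \<epsilon>(2)]) auto
    have [measurable]: "z x \<in> borel_measurable borel"
    proof -
      have "z x = (\<lambda>y. ?f y * indicator {max (x - \<epsilon>\<^sub>1) 0..min (x + \<epsilon>\<^sub>2) T} y)"
        by (auto simp: z_def zero_ext_def)
      then show ?thesis by simp
    qed
    have "(LINT y|lborel. (z x x - z x y) * kern H (x - y)) = (LINT y|lborel. W x y + Fa x y + Fb x y)"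
    proof (rule integral_cong_AE)
      show "(\<lambda>y. W x y + Fa x y + Fb x y) \<in> borel_measurable lborel"
        using iW ia ib by auto
      have ptw: "(z x x - z x y) * kern H (x - y) = W x y + Fa x y + Fb x y"
        if "y \<noteq> x - \<epsilon>\<^sub>1" "y \<noteq> x + \<epsilon>\<^sub>2" for y
      proof -
        have 1: "z x x = ?f x" using x \<epsilon> by (simp add: z_def zero_ext_def)
        have 2: "z x y = ?f y - ?f y * indicator {..x - \<epsilon>\<^sub>1} y - ?f y * indicator {x + \<epsilon>\<^sub>2..} y"
          using x \<epsilon> that by (auto simp: z_def zero_ext_def indicator_def)
        show ?thesis unfolding 1 2 W_def Fa_def Fb_def by (simp add: algebra_simps)
      qed
      show "AE y in lborel. (z x x - z x y) * kern H (x - y) = W x y + Fa x y + Fb x y"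
        using AE_lborel_singleton[of "x - \<epsilon>\<^sub>1"] AE_lborel_singleton[of "x + \<epsilon>\<^sub>2"]
        by eventually_elim (rule ptw)
    qed measurable
    then show ?thesis using iW ia ib by simp
  qed
  have "(LINT x|lborel. ?g x * L x) = (LINT x|lborel. - (1 - 2 * H) *
      (?g x * (LINT y|lborel. W x y) + ?g x * (LINT y|lborel. Fa x y) + ?g x * (LINT y|lborel. Fb x y)))"
  proof (rule integral_cong_AE)
    show "AE x in lborel. ?g x * L x = - (1 - 2 * H) *
      (?g x * (LINT y|lborel. W x y) + ?g x * (LINT y|lborel. Fa x y) + ?g x * (LINT y|lborel. Fb x y))"
      using L W(1) AE_lborel_singleton[of 0] AE_lborel_singleton[of T]
    proof eventually_elim
      case (elim x)
      show ?case
      proof (cases "0 < x \<and> x < T")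
        case True
        then have "L x = - (1 - 2 * H) * ((LINT y|lborel. W x y) + (LINT y|lborel. Fa x y) + (LINT y|lborel. Fb x y))"
          using elim(1) near[OF _ _ elim(2)] by simp
        then show ?thesis by (simp only: distrib_left mult.left_commute)
      next
        case False
        then show ?thesis using elim by (auto simp: zero_ext_def)
      qed
    qed
  qed (use W(2) ga(1) gb(1) in auto)
  also have "\<dots> = - (1 - 2 * H) * ((LINT x|lborel. ?g x * (LINT y|lborel. W x y)) + ?A + ?B)"
    using W(2) ga gb by simp
  finally have eq: "(LINT x|lborel. ?g x * L x) = - (1 - 2 * H) * ((LINT x|lborel. ?g x * (LINT y|lborel. W x y)) + ?A + ?B)" .
  have "(LINT t:{0..T}|lborel. g t * L t) = (LINT x|lborel. ?g x * L x)"
    unfolding set_lebesgue_integral_def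
    by (intro Bochner_Integration.integral_cong) (auto simp: zero_ext_def)
  moreover have "H * (1 - 2 * H) * w = H * (2 * H - 1) * (a + b) - H * (- (1 - 2 * H) * (w + a + b))" for w a b
    by (simp add: algebra_simps)
  ultimately show ?thesis unfolding W(3) eq by (simp only:)
qed

end

section \<open>Right limits\<close>

lemma mono_tendsto_at_right:
  fixes f :: "real \<Rightarrow> real"
  assumes "mono f"
  shows "\<exists>l. (f \<longlongrightarrow> l) (at_right x)"
proof (intro exI order_tendstoI)
  let ?l = "Inf (f ` {x<..})"
  have bdd: "bdd_below (f ` {x<..})"
    by (rule bdd_belowI2[of _ "f x"]) (use assms in \<open>auto simp: mono_def\<close>)
  show "\<forall>\<^sub>F y in at_right x. a < f y" if "a < ?l" for a
  proof -
    have "a < f y" if "x < y" for y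
      using cInf_lower[OF _ bdd, of "f y"] that \<open>a < ?l\<close> by fastforce
    then show ?thesis by (simp add: eventually_at_filter)
  qed
  show "\<forall>\<^sub>F y in at_right x. f y < a" if lt: "?l < a" for a
  proof -
    obtain y0 where y0: "x < y0" "f y0 < a"
      using cInf_lessD[OF _ lt] by auto
    have "f y < a" if "y < y0" for y
      using monoD[OF assms, of y y0] y0 that by simp
    then show ?thesis unfolding eventually_at_right_field using y0 by blast
  qed
qed

lemma dominated_mono:
  fixes \<phi> S :: "real \<Rightarrow> real"
  assumes "increments_le \<phi> S"
  shows "mono S" "mono (\<lambda>x. S x - \<phi> x)"
proof -
  show "mono S"
  proof (rule monoI)
    fix a b :: real assume "a \<le> b"
    then show "S a \<le> S b" using increments_leD[OF assms, of a b] by linarith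
  qed
  show "mono (\<lambda>x. S x - \<phi> x)"
  proof (rule monoI)
    fix a b :: real assume "a \<le> b"
    then show "S a - \<phi> a \<le> S b - \<phi> b" using increments_leD[OF assms, of a b] by linarith
  qed
qed

text \<open>The distribution function of a Lebesgue--Stieltjes measure is the right limit of a function that need
  not be right-continuous. The lemmas below transport domination of increments to right limits.\<close>

definition right_limit :: "(real \<Rightarrow> real) \<Rightarrow> real \<Rightarrow> real" where
  "right_limit \<phi> x = Lim (at_right x) \<phi>"

lemma right_limitI: "(\<phi> \<longlongrightarrow> l) (at_right x) \<Longrightarrow> right_limit \<phi> x = l"
  unfolding right_limit_def by (rule tendsto_Lim) simp

context
  fixes \<phi> S :: "real \<Rightarrow> real"
  assumes dom: "increments_le \<phi> S"
begin

lemma tendsto_right_limit_mono: "(S \<longlongrightarrow> right_limit S x) (at_right x)"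
proof -
  obtain l where l: "(S \<longlongrightarrow> l) (at_right x)"
    using mono_tendsto_at_right[OF dominated_mono(1)[OF dom]] by blast
  show ?thesis unfolding right_limitI[OF l] by (rule l)
qed

lemma tendsto_right_limit: "(\<phi> \<longlongrightarrow> right_limit \<phi> x) (at_right x)"
proof -
  obtain l l' where "(S \<longlongrightarrow> l) (at_right x)" "((\<lambda>x. S x - \<phi> x) \<longlongrightarrow> l') (at_right x)"
    using mono_tendsto_at_right[OF dominated_mono(1)[OF dom]] mono_tendsto_at_right[OF dominated_mono(2)[OF dom]] by blast
  then have "((\<lambda>x. S x - (S x - \<phi> x)) \<longlongrightarrow> l - l') (at_right x)" by (rule tendsto_diff)
  then have l: "(\<phi> \<longlongrightarrow> l - l') (at_right x)" by simp
  show ?thesis unfolding right_limitI[OF l] by (rule l)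
qed

lemma right_limit_dominated: "increments_le (right_limit \<phi>) (right_limit S)"
  unfolding increments_le_def
proof (intro allI impI)
  fix a b :: real assume "a \<le> b"
  have \<phi>: "((\<lambda>h. \<phi> (h + c)) \<longlongrightarrow> right_limit \<phi> c) (at_right 0)" for c
    using tendsto_right_limit[of c] by (simp add: filterlim_at_right_to_0[of _ _ c])
  have S: "((\<lambda>h. S (h + c)) \<longlongrightarrow> right_limit S c) (at_right 0)" for c
    using tendsto_right_limit_mono[of c] by (simp add: filterlim_at_right_to_0[of _ _ c])
  show "\<bar>right_limit \<phi> b - right_limit \<phi> a\<bar> \<le> right_limit S b - right_limit S a"
  proof (rule tendsto_le)
    show "((\<lambda>h. S (h + b) - S (h + a)) \<longlongrightarrow> right_limit S b - right_limit S a) (at_right 0)"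
      by (intro tendsto_diff S)
    show "((\<lambda>h. \<bar>\<phi> (h + b) - \<phi> (h + a)\<bar>) \<longlongrightarrow> \<bar>right_limit \<phi> b - right_limit \<phi> a\<bar>) (at_right 0)"
      by (intro tendsto_rabs tendsto_diff \<phi>)
    show "\<forall>\<^sub>F h in at_right 0. \<bar>\<phi> (h + b) - \<phi> (h + a)\<bar> \<le> S (h + b) - S (h + a)"
      using increments_leD[OF dom] \<open>a \<le> b\<close> by simp
  qed simp
qed

lemma right_limit_between:
  assumes "a < b"
  shows "S a \<le> right_limit S a" "right_limit S a \<le> S b"
proof -
  note m = monoD[OF dominated_mono(1)[OF dom]]
  show "S a \<le> right_limit S a"
    by (rule tendsto_lowerbound[OF tendsto_right_limit_mono])
      (auto simp: eventually_at_filter intro!: always_eventually m)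
  show "right_limit S a \<le> S b"
  proof (rule tendsto_upperbound[OF tendsto_right_limit_mono])
    show "\<forall>\<^sub>F y in at_right a. S y \<le> S b"
      unfolding eventually_at_right_field using assms by (intro exI[of _ b]) (auto intro: m)
  qed simp
qed

lemma right_limit_mono_right_continuous: "continuous (at_right a) (right_limit S)"
  unfolding continuous_within
proof (rule order_tendstoI)
  fix c assume c: "c < right_limit S a"
  have "c < right_limit S y" if "a < y" for y
    using increments_leD[OF right_limit_dominated, of a y] that c by linarith
  then show "\<forall>\<^sub>F y in at_right a. c < right_limit S y" by (simp add: eventually_at_filter)
next
  fix c assume c: "right_limit S a < c"
  have "\<forall>\<^sub>F y in at_right a. S y < c" by (rule order_tendstoD(2)[OF tendsto_right_limit_mono c])
  then obtain b where b: "a < b" "\<And>y. a < y \<Longrightarrow> y < b \<Longrightarrow> S y < c"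
    unfolding eventually_at_right_field by blast
  have "right_limit S y < c" if "a < y" "y < b" for y
    using right_limit_between(2)[of y "(y + b) / 2"] b(2)[of "(y + b) / 2"] that by (simp add: field_simps)
  then show "\<forall>\<^sub>F y in at_right a. right_limit S y < c"
    unfolding eventually_at_right_field using b(1) by blast
qed

text \<open>Continuity of the majorant at \<open>x\<close> is inherited by \<open>\<phi>\<close>. For the right limit of \<open>S\<close> it follows by squeezing
  between \<open>S y\<close> and \<open>S (y + \<bar>y - x\<bar>)\<close>: the argument of the latter exceeds \<open>y\<close>, and it tends to
  \<open>x\<close> from both sides.\<close>

lemma right_limit_at_cont:
  assumes "isCont S x"
  shows "right_limit \<phi> x = \<phi> x" "right_limit S x = S x" "isCont (right_limit S) x"
proof -
  have S: "(S \<longlongrightarrow> S x) (at x)" using assms by (simp add: isCont_def)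
  have "(\<phi> \<longlongrightarrow> \<phi> x) (at x)"
  proof (rule LIM_zero_cancel, rule Lim_null_comparison)
    have "\<bar>\<phi> y - \<phi> x\<bar> \<le> \<bar>S y - S x\<bar>" for y
      using increments_leD[OF dom, of x y] increments_leD[OF dom, of y x] by (cases "x \<le> y") (simp_all add: abs_minus_commute)
    then show "\<forall>\<^sub>F y in at x. norm (\<phi> y - \<phi> x) \<le> \<bar>S y - S x\<bar>" by simp
    show "((\<lambda>y. \<bar>S y - S x\<bar>) \<longlongrightarrow> 0) (at x)"
      using tendsto_rabs_zero[OF LIM_zero[OF S]] .
  qed
  then show "right_limit \<phi> x = \<phi> x" by (intro right_limitI) (rule tendsto_within_subset, auto)
  show Sx: "right_limit S x = S x" by (intro right_limitI tendsto_within_subset[OF S]) auto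
  have up: "((\<lambda>y. S (y + \<bar>y - x\<bar>)) \<longlongrightarrow> S x) (at x)"
  proof (rule isCont_tendsto_compose[OF assms])
    have "((\<lambda>y. y + \<bar>y - x\<bar>) \<longlongrightarrow> x + \<bar>x - x\<bar>) (at x)" by (intro tendsto_intros)
    then show "((\<lambda>y. y + \<bar>y - x\<bar>) \<longlongrightarrow> x) (at x)" by simp
  qed
  have "(right_limit S \<longlongrightarrow> S x) (at x)"
  proof (rule tendsto_sandwich[OF _ _ S up])
    show "\<forall>\<^sub>F y in at x. S y \<le> right_limit S y"
      using right_limit_between(1)[OF less_add_one] by simp
    have "right_limit S y \<le> S (y + \<bar>y - x\<bar>)" if "y \<noteq> x" for y
      by (rule right_limit_between(2)) (use that in auto)
    then show "\<forall>\<^sub>F y in at x. right_limit S y \<le> S (y + \<bar>y - x\<bar>)"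
      by (simp add: eventually_at_filter)
  qed
  then show "isCont (right_limit S) x" by (simp add: isCont_def Sx)
qed

end

lemma right_continuous_dominated:
  fixes W S :: "real \<Rightarrow> real"
  assumes "increments_le W S" "continuous (at_right x) S"
  shows "continuous (at_right x) W"
  unfolding continuous_within
proof (rule LIM_zero_cancel, rule Lim_null_comparison)
  show "\<forall>\<^sub>F y in at_right x. norm (W y - W x) \<le> S y - S x"
    using increments_leD[OF assms(1)] by (simp add: eventually_at_filter)
  show "((\<lambda>y. S y - S x) \<longlongrightarrow> 0) (at_right x)"
    using assms(2) by (intro LIM_zero) (simp add: continuous_within)
qed

lemma isCont_dominated:
  fixes W S :: "real \<Rightarrow> real"
  assumes dom: "increments_le W S" and "isCont S x"
  shows "isCont W x"
  unfolding isCont_def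
proof (rule LIM_zero_cancel, rule Lim_null_comparison)
  have "\<bar>W y - W x\<bar> \<le> \<bar>S y - S x\<bar>" for y
    using increments_leD[OF dom, of x y] increments_leD[OF dom, of y x] by (cases "x \<le> y") (simp_all add: abs_minus_commute)
  then show "\<forall>\<^sub>F y in at x. norm (W y - W x) \<le> \<bar>S y - S x\<bar>" by simp
  show "((\<lambda>y. \<bar>S y - S x\<bar>) \<longlongrightarrow> 0) (at x)"
    using assms(2) unfolding isCont_def by (intro tendsto_rabs_zero LIM_zero)
qed

section \<open>The potential of a Stieltjes measure\<close>

lemma emeasure_interval_measure_singleton_isCont:
  assumes W: "mono W" "\<And>a. continuous (at_right a) W" and x: "isCont W x"
  shows "emeasure (interval_measure W) {x} = 0"
proof -
  have "emeasure (interval_measure W) {x} \<le> ennreal (W x - W (x - h))" if "0 < h" for h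
  proof -
    have "emeasure (interval_measure W) {x} \<le> emeasure (interval_measure W) {x - h<..x}"
      using that by (intro emeasure_mono) auto
    also have "\<dots> = ennreal (W x - W (x - h))"
      using that W by (intro emeasure_interval_measure_Ioc) (auto simp: mono_def)
    finally show ?thesis .
  qed
  then have "\<forall>\<^sub>F h in at_right 0. emeasure (interval_measure W) {x} \<le> ennreal (W x - W (x - h))"
    by (simp add: eventually_at_filter)
  moreover have "((\<lambda>h. ennreal (W x - W (x - h))) \<longlongrightarrow> ennreal (W x - W x)) (at_right 0)"
  proof (intro tendsto_ennrealI tendsto_diff tendsto_const isCont_tendsto_compose[OF x])
    have "((\<lambda>h. x - h) \<longlongrightarrow> x - 0) (at_right 0)" by (intro tendsto_intros)
    then show "((\<lambda>h. x - h) \<longlongrightarrow> x) (at_right 0)" by simp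
  qed
  ultimately have "emeasure (interval_measure W) {x} \<le> ennreal (W x - W x)"
    by (intro tendsto_lowerbound) auto
  then show ?thesis by simp
qed

context rough_hurst
begin

text \<open>Tonelli's theorem for the measure of \<open>W\<close> and Lebesgue measure on the set \<open>x < s \<le> y\<close>: integrating over
  \<open>s\<close> first gives \<open>W y - W x\<close>, integrating over \<open>y\<close> first gives the tail of the kernel beyond \<open>s\<close>.\<close>

lemma stieltjes_potential_right:
  assumes W: "mono W" "\<And>a. continuous (at_right a) W"
  shows "(\<integral>\<^sup>+y. ennreal ((W y - W x) * kern H (x - y)) * indicator {x<..} y \<partial>lborel)
    = (\<integral>\<^sup>+s. ennreal ((s - x) powr (2 * H - 1) / (1 - 2 * H)) * indicator {x<..} s \<partial>interval_measure W)"
proof -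
  let ?\<mu> = "interval_measure W"
  have sf: "sigma_finite_measure ?\<mu>" using W by (intro sigma_finite_interval_measure) (auto simp: mono_def)
  interpret P: pair_sigma_finite lborel ?\<mu>
    using sf by (simp add: pair_sigma_finite_def lborel.sigma_finite_measure_axioms)
  have "(\<integral>\<^sup>+y. ennreal ((W y - W x) * kern H (x - y)) * indicator {x<..} y \<partial>lborel)
      = (\<integral>\<^sup>+y. \<integral>\<^sup>+s. ennreal (kern H (x - y)) * (indicator {x<..} s * indicator {s..} y) \<partial>?\<mu> \<partial>lborel)"
  proof (rule nn_integral_cong)
    fix y :: real
    have "(\<integral>\<^sup>+s. ennreal (kern H (x - y)) * (indicator {x<..} s * indicator {s..} y) \<partial>?\<mu>)
        = (\<integral>\<^sup>+s. ennreal (kern H (x - y)) * indicator {x<..y} s \<partial>?\<mu>)"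
      by (intro nn_integral_cong) (auto simp: indicator_def)
    also have "\<dots> = ennreal (kern H (x - y)) * emeasure ?\<mu> {x<..y}"
      by (subst nn_integral_cmult_indicator) auto
    also have "\<dots> = ennreal ((W y - W x) * kern H (x - y)) * indicator {x<..} y"
    proof (cases "x < y")
      case True
      then have "emeasure ?\<mu> {x<..y} = ennreal (W y - W x)"
        using W by (intro emeasure_interval_measure_Ioc) (auto simp: mono_def)
      then show ?thesis using True monoD[OF W(1), of x y] by (simp add: ennreal_mult mult.commute)
    qed simp
    finally show "ennreal ((W y - W x) * kern H (x - y)) * indicator {x<..} y
      = (\<integral>\<^sup>+s. ennreal (kern H (x - y)) * (indicator {x<..} s * indicator {s..} y) \<partial>?\<mu>)" ..
  qed
  also have "\<dots> = (\<integral>\<^sup>+s. \<integral>\<^sup>+y. ennreal (kern H (x - y)) * (indicator {x<..} s * indicator {s..} y) \<partial>lborel \<partial>?\<mu>)"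
    by (rule P.Fubini'[symmetric]) (unfold indicator_def atLeast_iff, measurable)
  also have "\<dots> = (\<integral>\<^sup>+s. ennreal ((s - x) powr (2 * H - 1) / (1 - 2 * H)) * indicator {x<..} s \<partial>?\<mu>)"
  proof (rule nn_integral_cong)
    fix s :: real
    show "(\<integral>\<^sup>+y. ennreal (kern H (x - y)) * (indicator {x<..} s * indicator {s..} y) \<partial>lborel)
        = ennreal ((s - x) powr (2 * H - 1) / (1 - 2 * H)) * indicator {x<..} s"
      by (cases "x < s") (simp_all add: nn_integral_kern_right)
  qed
  finally show ?thesis .
qed

text \<open>The mirror image, where \<open>W x - W y\<close> is the measure of \<open>{y<..x}\<close>. This interval contains the endpoint \<open>x\<close>,
  at which the kernel has no finite tail; continuity of \<open>W\<close> makes the endpoint a null set.\<close>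

lemma stieltjes_potential_left:
  assumes W: "mono W" "\<And>a. continuous (at_right a) W" and x: "isCont W x"
  shows "(\<integral>\<^sup>+y. ennreal ((W x - W y) * kern H (x - y)) * indicator {..<x} y \<partial>lborel)
    = (\<integral>\<^sup>+s. ennreal ((x - s) powr (2 * H - 1) / (1 - 2 * H)) * indicator {..<x} s \<partial>interval_measure W)"
proof -
  let ?\<mu> = "interval_measure W"
  have sf: "sigma_finite_measure ?\<mu>" using W by (intro sigma_finite_interval_measure) (auto simp: mono_def)
  interpret P: pair_sigma_finite lborel ?\<mu>
    using sf by (simp add: pair_sigma_finite_def lborel.sigma_finite_measure_axioms)
  have "(\<integral>\<^sup>+y. ennreal ((W x - W y) * kern H (x - y)) * indicator {..<x} y \<partial>lborel)
      = (\<integral>\<^sup>+y. \<integral>\<^sup>+s. ennreal (kern H (x - y)) * (indicator {..x} s * indicator {..<s} y) \<partial>?\<mu> \<partial>lborel)"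
  proof (rule nn_integral_cong)
    fix y :: real
    have "(\<integral>\<^sup>+s. ennreal (kern H (x - y)) * (indicator {..x} s * indicator {..<s} y) \<partial>?\<mu>)
        = (\<integral>\<^sup>+s. ennreal (kern H (x - y)) * indicator {y<..x} s \<partial>?\<mu>)"
      by (intro nn_integral_cong) (auto simp: indicator_def)
    also have "\<dots> = ennreal (kern H (x - y)) * emeasure ?\<mu> {y<..x}"
      by (subst nn_integral_cmult_indicator) auto
    also have "\<dots> = ennreal ((W x - W y) * kern H (x - y)) * indicator {..<x} y"
    proof (cases "y < x")
      case True
      then have "emeasure ?\<mu> {y<..x} = ennreal (W x - W y)"
        using W by (intro emeasure_interval_measure_Ioc) (auto simp: mono_def)
      then show ?thesis using True monoD[OF W(1), of y x] by (simp add: ennreal_mult mult.commute)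
    qed simp
    finally show "ennreal ((W x - W y) * kern H (x - y)) * indicator {..<x} y
      = (\<integral>\<^sup>+s. ennreal (kern H (x - y)) * (indicator {..x} s * indicator {..<s} y) \<partial>?\<mu>)" ..
  qed
  also have "\<dots> = (\<integral>\<^sup>+s. \<integral>\<^sup>+y. ennreal (kern H (x - y)) * (indicator {..x} s * indicator {..<s} y) \<partial>lborel \<partial>?\<mu>)"
    by (rule P.Fubini'[symmetric]) (unfold indicator_def lessThan_iff, measurable)
  also have "\<dots> = (\<integral>\<^sup>+s. ennreal ((x - s) powr (2 * H - 1) / (1 - 2 * H)) * indicator {..<x} s \<partial>?\<mu>)"
  proof (rule nn_integral_cong_AE, rule eventually_mono)
    show "AE s in ?\<mu>. s \<notin> {x}"
      using emeasure_interval_measure_singleton_isCont[OF assms] by (intro AE_not_in null_setsI) auto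
    fix s assume s: "s \<notin> {x}"
    have "(\<integral>\<^sup>+y. ennreal (kern H (x - y)) * indicator {..<s} y \<partial>lborel)
        = (\<integral>\<^sup>+y. ennreal (kern H (x - y)) * indicator {..s} y \<partial>lborel)"
      by (intro nn_integral_cong_AE, use AE_lborel_singleton[of s] in eventually_elim)
        (auto simp: indicator_def)
    then show "(\<integral>\<^sup>+y. ennreal (kern H (x - y)) * (indicator {..x} s * indicator {..<s} y) \<partial>lborel)
        = ennreal ((x - s) powr (2 * H - 1) / (1 - 2 * H)) * indicator {..<x} s"
      using s by (cases "s < x") (simp_all add: nn_integral_kern_left)
  qed
  finally show ?thesis .
qed

text \<open>Positive and negative parts correspond separately, so the identity also holds when the integrals
  diverge and both sides are \<open>0\<close> by convention. This matters for measurability in \<open>x\<close>, where no null set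
  may be discarded.\<close>

lemma stieltjes_potential:
  assumes W: "mono W" "\<And>a. continuous (at_right a) W" and x: "isCont W x"
  defines "q \<equiv> \<lambda>s. sgn (x - s) * \<bar>x - s\<bar> powr (2 * H - 1)"
    and "r \<equiv> \<lambda>y. (W x - W y) * kern H (x - y)"
  shows "integrable (interval_measure W) q \<longleftrightarrow> integrable lborel r"
    and "(LINT s|interval_measure W. q s) = (1 - 2 * H) * (LINT y|lborel. r y)"
proof -
  let ?\<mu> = "interval_measure W" and ?c = "ennreal (1 - 2 * H)"
  have [measurable]: "W \<in> borel_measurable borel" by (rule borel_measurable_mono[OF W(1)])
  have q[measurable]: "q \<in> borel_measurable ?\<mu>" unfolding q_def by measurable
  have r[measurable]: "r \<in> borel_measurable lborel" unfolding r_def by measurable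
  have c: "ennreal a = ?c * ennreal (a / (1 - 2 * H))" if "0 \<le> a" for a
    using H_half that by (subst ennreal_mult[symmetric]) auto
  have pos: "(\<integral>\<^sup>+s. ennreal (q s) \<partial>?\<mu>) = ?c * (\<integral>\<^sup>+y. ennreal (r y) \<partial>lborel)"
  proof -
    have "(\<integral>\<^sup>+s. ennreal (q s) \<partial>?\<mu>)
        = (\<integral>\<^sup>+s. ?c * (ennreal ((x - s) powr (2 * H - 1) / (1 - 2 * H)) * indicator {..<x} s) \<partial>?\<mu>)"
    proof (rule nn_integral_cong)
      fix s
      show "ennreal (q s) = ?c * (ennreal ((x - s) powr (2 * H - 1) / (1 - 2 * H)) * indicator {..<x} s)"
        using c[of "(x - s) powr (2 * H - 1)"]
        by (cases "s < x") (auto simp: q_def sgn_if ennreal_neg)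
    qed
    also have "\<dots> = ?c * (\<integral>\<^sup>+s. ennreal ((x - s) powr (2 * H - 1) / (1 - 2 * H)) * indicator {..<x} s \<partial>?\<mu>)"
      by (rule nn_integral_cmult) measurable
    also have "(\<integral>\<^sup>+s. ennreal ((x - s) powr (2 * H - 1) / (1 - 2 * H)) * indicator {..<x} s \<partial>?\<mu>)
        = (\<integral>\<^sup>+y. ennreal ((W x - W y) * kern H (x - y)) * indicator {..<x} y \<partial>lborel)"
      by (rule stieltjes_potential_left[OF assms(1-3), symmetric])
    also have "\<dots> = (\<integral>\<^sup>+y. ennreal (r y) \<partial>lborel)"
    proof (rule nn_integral_cong)
      fix y
      show "ennreal ((W x - W y) * kern H (x - y)) * indicator {..<x} y = ennreal (r y)"
      proof (cases "y < x")
        case False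
        then have "r y \<le> 0" using monoD[OF W(1), of x y] by (simp add: r_def mult_nonpos_nonneg)
        then show ?thesis using False by (simp add: ennreal_neg)
      qed (simp add: r_def)
    qed
    finally show ?thesis .
  qed
  have neg: "(\<integral>\<^sup>+s. ennreal (- q s) \<partial>?\<mu>) = ?c * (\<integral>\<^sup>+y. ennreal (- r y) \<partial>lborel)"
  proof -
    have "(\<integral>\<^sup>+s. ennreal (- q s) \<partial>?\<mu>)
        = (\<integral>\<^sup>+s. ?c * (ennreal ((s - x) powr (2 * H - 1) / (1 - 2 * H)) * indicator {x<..} s) \<partial>?\<mu>)"
    proof (rule nn_integral_cong)
      fix s
      show "ennreal (- q s) = ?c * (ennreal ((s - x) powr (2 * H - 1) / (1 - 2 * H)) * indicator {x<..} s)"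
        using c[of "(s - x) powr (2 * H - 1)"]
        by (cases "x < s") (auto simp: q_def sgn_if ennreal_neg)
    qed
    also have "\<dots> = ?c * (\<integral>\<^sup>+s. ennreal ((s - x) powr (2 * H - 1) / (1 - 2 * H)) * indicator {x<..} s \<partial>?\<mu>)"
      by (rule nn_integral_cmult) measurable
    also have "(\<integral>\<^sup>+s. ennreal ((s - x) powr (2 * H - 1) / (1 - 2 * H)) * indicator {x<..} s \<partial>?\<mu>)
        = (\<integral>\<^sup>+y. ennreal ((W y - W x) * kern H (x - y)) * indicator {x<..} y \<partial>lborel)"
      by (rule stieltjes_potential_right[OF assms(1-2), symmetric])
    also have "\<dots> = (\<integral>\<^sup>+y. ennreal (- r y) \<partial>lborel)"
    proof (rule nn_integral_cong)
      fix y
      show "ennreal ((W y - W x) * kern H (x - y)) * indicator {x<..} y = ennreal (- r y)"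
      proof (cases "x < y")
        case False
        then have "0 \<le> r y" using monoD[OF W(1), of y x] by (simp add: r_def)
        then show ?thesis using False by (simp add: ennreal_neg)
      qed (simp add: r_def minus_mult_left)
    qed
    finally show ?thesis .
  qed
  have fin: "?c * z \<noteq> \<infinity> \<longleftrightarrow> z \<noteq> \<infinity>" for z
    using H_half by (auto simp: ennreal_mult_eq_top_iff)
  show eq: "integrable ?\<mu> q \<longleftrightarrow> integrable lborel r"
    unfolding real_integrable_def pos neg fin using q r by simp
  show "(LINT s|?\<mu>. q s) = (1 - 2 * H) * (LINT y|lborel. r y)"
  proof (cases "integrable lborel r")
    case True
    then show ?thesis
      using eq H_half by (simp add: real_lebesgue_integral_def pos neg enn2real_mult right_diff_distrib)
  next
    case False
    then show ?thesis using eq by (simp add: not_integrable_integral_eq)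
  qed
qed

end

section \<open>Measurable dependence of the total variation on a parameter\<close>

definition grid_variation :: "(real \<Rightarrow> real) \<Rightarrow> real \<Rightarrow> nat \<Rightarrow> int list \<Rightarrow> real" where
  "grid_variation F y m zs = (\<Sum>i<length zs - 1.
     \<bar>F (min y (of_int (zs ! Suc i) / real m)) - F (min y (of_int (zs ! i) / real m))\<bar>)"

lemma grid_variation_in_variation_sums:
  assumes "sorted zs"
  shows "grid_variation F y m zs \<in> variation_sums F {..y}"
proof -
  let ?p = "\<lambda>i. min y (of_int (zs ! i) / real m)"
  have "mono_on {..length zs - 1} ?p"
  proof (rule mono_onI)
    fix i j assume ij: "i \<in> {..length zs - 1}" "j \<in> {..length zs - 1}" "i \<le> j"
    show "?p i \<le> ?p j"
    proof (cases "zs = []")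
      case False
      then have "zs ! i \<le> zs ! j" using ij assms by (intro sorted_nth_mono) (auto simp: Suc_le_eq[symmetric] Suc_pred' simp flip: length_greater_0_conv)
      then show ?thesis by (intro min.mono order_refl divide_right_mono) auto
    qed (use ij in auto)
  qed
  moreover have "?p ` {..length zs - 1} \<subseteq> {..y}" by auto
  ultimately show ?thesis unfolding grid_variation_def variation_sums_def
    by (intro CollectI exI[of _ "length zs - 1"] exI[of _ ?p]) auto
qed

text \<open>The points of a chain are approached from the right by points of the grids \<open>\<int> / m\<close>, and right-continuity
  of \<open>F\<close> makes the variation along them converge. The supremum thus runs over a countable set.\<close>

lemma total_variation_eq_grid_SUP:
  assumes rc: "\<And>y. continuous (at_right y) F" and bdd: "bdd_above (variation_sums F {..y})"
  shows "total_variation_on F {..y} = (SUP (m, zs)\<in>{(m, zs). sorted zs}. grid_variation F y m zs)"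
    (is "_ = ?S")
proof (rule antisym)
  have bdd': "bdd_above ((\<lambda>(m, zs). grid_variation F y m zs) ` {(m, zs). sorted zs})"
    by (rule bdd_above_mono[OF bdd]) (auto intro: grid_variation_in_variation_sums)
  have "(\<Sum>i<0. \<bar>F y - F y\<bar>) \<in> variation_sums F {..y}"
    unfolding variation_sums_def
    by (intro CollectI exI[of _ 0] exI[of _ "\<lambda>_. y"]) (auto intro: mono_onI)
  then have ne: "variation_sums F {..y} \<noteq> {}" by blast
  show "total_variation_on F {..y} \<le> ?S"
    unfolding total_variation_on_def
  proof (rule cSup_least[OF ne])
    fix v assume "v \<in> variation_sums F {..y}"
    then obtain n p where np: "v = (\<Sum>i<n. \<bar>F (p (Suc i)) - F (p i)\<bar>)" "mono_on {..n} p" "p ` {..n} \<subseteq> {..y}"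
      unfolding variation_sums_def by blast
    \<comment> \<open>The grid point following \<open>p i\<close>, pulled back to \<open>y\<close>; it exceeds \<open>p i\<close> strictly unless \<open>p i = y\<close>.\<close>
    define q where "q m i = min y (of_int (\<lfloor>real m * p i\<rfloor> + 1) / real m)" for m i
    have lim: "(\<lambda>m. F (q m i)) \<longlonglongrightarrow> F (p i)" if i: "i \<le> n" for i
    proof (cases "p i = y")
      case True
      have "q m i = y" if "0 < m" for m
      proof -
        have "real m * p i \<le> of_int (\<lfloor>real m * p i\<rfloor> + 1)" by linarith
        then have "p i \<le> of_int (\<lfloor>real m * p i\<rfloor> + 1) / real m"
          using that by (simp add: le_divide_eq mult.commute del: of_int_add)
        then show ?thesis unfolding q_def using True by simp
      qed
      then have "F (q m i) = F (p i)" if "0 < m" for m using that True by simp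
      then have "\<forall>\<^sub>F m in sequentially. F (q m i) = F (p i)"
        by (rule eventually_mono[OF eventually_gt_at_top[of 0]])
      then show ?thesis by (rule tendsto_eventually)
    next
      case False
      then have lt: "p i < y" using np(3) i by fastforce
      have b: "p i < q m i \<and> q m i \<le> p i + 1 / real m" if m: "0 < m" for m
      proof -
        have "real m * p i < of_int (\<lfloor>real m * p i\<rfloor> + 1)" "of_int (\<lfloor>real m * p i\<rfloor> + 1) \<le> real m * p i + 1"
          by linarith+
        then have "p i < of_int (\<lfloor>real m * p i\<rfloor> + 1) / real m"
          "of_int (\<lfloor>real m * p i\<rfloor> + 1) / real m \<le> (real m * p i + 1) / real m"
          using m by (simp_all add: less_divide_eq mult.commute divide_right_mono del: of_int_add)
        moreover have "(real m * p i + 1) / real m = p i + 1 / real m"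
          using m by (simp add: add_divide_distrib)
        ultimately show ?thesis unfolding q_def using lt by auto
      qed
      have ev: "\<forall>\<^sub>F m in sequentially. p i < q m i \<and> q m i \<le> p i + 1 / real m"
        by (rule eventually_mono[OF eventually_gt_at_top[of 0] b])
      have "(\<lambda>m. q m i) \<longlonglongrightarrow> p i"
      proof (rule tendsto_sandwich)
        show "\<forall>\<^sub>F m in sequentially. p i \<le> q m i" "\<forall>\<^sub>F m in sequentially. q m i \<le> p i + 1 / real m"
          by (rule eventually_mono[OF ev], simp)+
        show "(\<lambda>m. p i + 1 / real m) \<longlonglongrightarrow> p i"
          using tendsto_add[OF tendsto_const lim_1_over_n, of "p i"] by simp
      qed simp
      then have "filterlim (\<lambda>m. q m i) (at_right (p i)) sequentially"
        unfolding filterlim_at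
        by (intro conjI eventually_mono[OF ev]) simp_all
      moreover have "(F \<longlongrightarrow> F (p i)) (at_right (p i))" using rc by (simp add: continuous_within)
      ultimately show ?thesis by (rule filterlim_compose[rotated])
    qed
    define zs where "zs m = map (\<lambda>i. \<lfloor>real m * p i\<rfloor> + 1) [0..<Suc n]" for m
    have "(\<lambda>m. \<Sum>i<n. \<bar>F (q m (Suc i)) - F (q m i)\<bar>) \<longlonglongrightarrow> v"
      unfolding np(1) by (intro tendsto_sum tendsto_rabs tendsto_diff lim) auto
    moreover have "(\<Sum>i<n. \<bar>F (q m (Suc i)) - F (q m i)\<bar>) \<le> ?S" for m
    proof -
      have len: "length (zs m) = Suc n" by (simp add: zs_def)
      have nth: "zs m ! i = \<lfloor>real m * p i\<rfloor> + 1" if "i < Suc n" for i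
        unfolding zs_def using that by (simp del: upt_Suc)
      have "sorted (zs m)"
        unfolding sorted_iff_nth_mono len
      proof (intro allI impI)
        fix i j assume ij: "i \<le> j" "j < Suc n"
        then have "p i \<le> p j" using np(2) by (auto simp: mono_on_def)
        then have "\<lfloor>real m * p i\<rfloor> \<le> \<lfloor>real m * p j\<rfloor>" by (intro floor_mono mult_left_mono) auto
        then show "zs m ! i \<le> zs m ! j" using ij by (simp add: nth)
      qed
      moreover have "grid_variation F y m (zs m) = (\<Sum>i<n. \<bar>F (q m (Suc i)) - F (q m i)\<bar>)"
      proof -
        have l: "length (zs m) - 1 = n" by (simp add: len)
        show ?thesis unfolding grid_variation_def l q_def by (intro sum.cong refl) (simp add: nth)
      qed
      ultimately show ?thesis using cSUP_upper[OF _ bdd', of "(m, zs m)"] by simp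
    qed
    ultimately show "v \<le> ?S" by (intro LIMSEQ_le_const2[of _ v]) auto
  qed
  show "?S \<le> total_variation_on F {..y}"
    unfolding total_variation_on_def
  proof (rule cSUP_least)
    show "{(m :: nat, zs :: int list). sorted zs} \<noteq> {}" using sorted0 by blast
    fix z assume "z \<in> {(m :: nat, zs :: int list). sorted zs}"
    then show "(case z of (m, zs) \<Rightarrow> grid_variation F y m zs) \<le> Sup (variation_sums F {..y})"
      using cSup_upper[OF grid_variation_in_variation_sums bdd] by auto
  qed
qed

lemma total_variation_jointly_measurable:
  fixes F :: "'b \<Rightarrow> real \<Rightarrow> real"
  assumes F: "(\<lambda>p. F (fst p) (snd p)) \<in> borel_measurable (N \<Otimes>\<^sub>M borel)"
    and rc: "\<And>t y. continuous (at_right y) (F t)"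
    and bdd: "\<And>t y. bdd_above (variation_sums (F t) {..y})"
  shows "(\<lambda>p. total_variation_on (F (fst p)) {..snd p}) \<in> borel_measurable (N \<Otimes>\<^sub>M borel)"
proof -
  have c: "(\<lambda>p. F (fst p) (min (snd p) c)) \<in> borel_measurable (N \<Otimes>\<^sub>M borel)" for c
    using measurable_compose[OF _ F, of "\<lambda>p. (fst p, min (snd p) c)" "N \<Otimes>\<^sub>M borel"] by simp
  have "(\<lambda>p. SUP (m, zs)\<in>{(m, zs). sorted zs}. grid_variation (F (fst p)) (snd p) m zs) \<in> borel_measurable (N \<Otimes>\<^sub>M borel)"
  proof (rule borel_measurable_cSUP)
    fix z :: "nat \<times> int list"
    show "(\<lambda>p. case z of (m, zs) \<Rightarrow> grid_variation (F (fst p)) (snd p) m zs) \<in> borel_measurable (N \<Otimes>\<^sub>M borel)"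
      unfolding grid_variation_def case_prod_beta
      by (intro borel_measurable_sum borel_measurable_abs borel_measurable_diff c)
    fix p :: "'b \<times> real"
    show "bdd_above ((\<lambda>z. case z of (m, zs) \<Rightarrow> grid_variation (F (fst p)) (snd p) m zs) ` {(m, zs). sorted zs})"
      by (rule bdd_above_mono[OF bdd[of "fst p" "snd p"]]) (auto intro: grid_variation_in_variation_sums)
  qed (rule countableI_type)
  then show ?thesis by (subst total_variation_eq_grid_SUP[OF rc bdd])
qed

context rough_hurst
begin

section \<open>The Stieltjes integral of the covariance kernel\<close>

text \<open>The value of \<open>\<integral> (x powr (2H - 1) - sgn (x - s) * \<bar>x - s\<bar> powr (2H - 1)) dW s\<close> for one half \<open>W\<close> of a Jordan
  decomposition, including the value \<open>0\<close> in case of divergence.\<close>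

definition half_value :: "real \<Rightarrow> (real \<Rightarrow> real) \<Rightarrow> real \<Rightarrow> real" where
  "half_value T W x = (if integrable lborel (\<lambda>y. (W x - W y) * kern H (x - y))
     then x powr (2 * H - 1) * (W T - W (- 1)) - (1 - 2 * H) * (LINT y|lborel. (W x - W y) * kern H (x - y))
     else 0)"

text \<open>As \<open>W\<close> is constant to the left of \<open>0\<close> and to the right of \<open>T\<close>, its measure is carried by \<open>{0..T}\<close>, and the
  potential formula on the whole line applies.\<close>

lemma restricted_stieltjes_integral:
  assumes W: "mono W" "\<And>a. continuous (at_right a) W" and x: "isCont W x" and T: "0 < T"
    and const: "\<And>y. y < 0 \<Longrightarrow> W y = W (- 1)" "\<And>y. T \<le> y \<Longrightarrow> W y = W T"
  shows "(LINT s|restrict_space (interval_measure W) {0..T}.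
      x powr (2 * H - 1) - sgn (x - s) * \<bar>x - s\<bar> powr (2 * H - 1)) = half_value T W x"
proof -
  let ?\<mu> = "interval_measure W" and ?c = "x powr (2 * H - 1)"
  define q where "q s = sgn (x - s) * \<bar>x - s\<bar> powr (2 * H - 1)" for s
  have [measurable]: "q \<in> borel_measurable borel" unfolding q_def by measurable
  have Ioc: "emeasure ?\<mu> {a<..b} = ennreal (W b - W a)" if "a \<le> b" for a b
    using that W by (intro emeasure_interval_measure_Ioc) (auto simp: mono_def)
  have null: "AE s in ?\<mu>. s \<notin> {a<..b}" if "a \<le> b" "W a = W b" for a b
    using Ioc[OF that(1)] that(2) by (intro AE_not_in null_setsI) auto
  \<comment> \<open>The complement of \<open>{0..T}\<close> is exhausted by half-open intervals on which \<open>W\<close> is constant.\<close>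
  have "AE s in ?\<mu>. \<forall>n::nat. s \<notin> {- real (Suc n)<..- 1 / real (Suc n)} \<and> s \<notin> {T<..T + real n}"
    unfolding AE_all_countable
  proof
    fix n
    have "W (- real (Suc n)) = W (- 1 / real (Suc n))"
      using const(1)[of "- real (Suc n)"] const(1)[of "- 1 / real (Suc n)"] by simp
    moreover have "- real (Suc n) \<le> - 1 / real (Suc n)" by (simp add: field_simps)
    ultimately have "AE s in ?\<mu>. s \<notin> {- real (Suc n)<..- 1 / real (Suc n)}" by (intro null)
    moreover have "AE s in ?\<mu>. s \<notin> {T<..T + real n}" using const(2)[of "T + real n"] by (intro null) simp_all
    ultimately show "AE s in ?\<mu>. s \<notin> {- real (Suc n)<..- 1 / real (Suc n)} \<and> s \<notin> {T<..T + real n}"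
      by eventually_elim simp
  qed
  then have supp: "AE s in ?\<mu>. s \<in> {0..T}"
  proof (rule eventually_mono)
    fix s assume s: "\<forall>n::nat. s \<notin> {- real (Suc n)<..- 1 / real (Suc n)} \<and> s \<notin> {T<..T + real n}"
    obtain n :: nat where n: "max (- s) (1 / (- s)) < real n" "s - T < real n"
      using reals_Archimedean2[of "max (max (- s) (1 / (- s))) (s - T)"] by auto
    have "0 \<le> s"
    proof (rule ccontr)
      assume "\<not> 0 \<le> s"
      then have neg: "s < 0" by simp
      have "1 / (- s) \<le> real (Suc n)" "- s < real (Suc n)" using n(1) by auto
      then have "s \<le> - 1 / real (Suc n)" "- real (Suc n) < s" using neg by (simp_all add: field_simps)
      then show False using s[rule_format, of n] by simp
    qed
    moreover have "s \<le> T" using s[rule_format, of n] n(2) by auto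
    ultimately show "s \<in> {0..T}" by simp
  qed
  have "emeasure ?\<mu> UNIV = emeasure ?\<mu> {- 1<..T}"
    by (rule emeasure_eq_AE, rule eventually_mono[OF supp]) (use T in auto)
  also have "\<dots> = ennreal (W T - W (- 1))" using T by (intro Ioc) simp
  finally have mass: "emeasure ?\<mu> UNIV = ennreal (W T - W (- 1))" .
  have "0 \<le> W T - W (- 1)" using monoD[OF W(1), of "- 1" T] T by simp
  then have mass': "measure ?\<mu> UNIV = W T - W (- 1)" using mass by (simp add: measure_def)
  have ic: "integrable ?\<mu> (\<lambda>s. ?c)"
    by (rule finite_measure.integrable_const[OF finite_measureI]) (simp add: mass)
  have "(LINT s|restrict_space ?\<mu> {0..T}. ?c - q s) = (LINT s|?\<mu>. indicator {0..T} s *\<^sub>R (?c - q s))"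
    by (rule integral_restrict_space) simp
  also have "\<dots> = (LINT s|?\<mu>. ?c - q s)"
    by (rule integral_cong_AE, measurable, rule eventually_mono[OF supp]) simp
  also have "\<dots> = half_value T W x"
  proof (cases "integrable lborel (\<lambda>y. (W x - W y) * kern H (x - y))")
    case True
    then have "integrable ?\<mu> q" using stieltjes_potential(1)[OF W x] unfolding q_def by simp
    then have "(LINT s|?\<mu>. ?c - q s) = (LINT s|?\<mu>. ?c) - (LINT s|?\<mu>. q s)"
      by (rule Bochner_Integration.integral_diff[OF ic])
    also have "(LINT s|?\<mu>. q s) = (1 - 2 * H) * (LINT y|lborel. (W x - W y) * kern H (x - y))"
      unfolding q_def by (rule stieltjes_potential(2)[OF W x])
    also have "(LINT s|?\<mu>. ?c) = ?c * (W T - W (- 1))" using mass' by simp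
    finally show ?thesis using True by (simp add: half_value_def)
  next
    case False
    then have "\<not> integrable ?\<mu> q" using stieltjes_potential(1)[OF W x] unfolding q_def by simp
    then have "\<not> integrable ?\<mu> (\<lambda>s. ?c - q s)"
      using Bochner_Integration.integrable_diff[OF ic, of "\<lambda>s. ?c - q s"] by auto
    then show ?thesis using False by (simp add: half_value_def not_integrable_integral_eq)
  qed
  finally show ?thesis unfolding q_def .
qed

end

lemma ls_fun_eq_right_limit: "ls_fun T \<phi> = right_limit (zero_ext T \<phi>)"
  by (simp add: fun_eq_iff ls_fun_def right_limit_def)

context
  fixes T K :: real and \<phi> S :: "real \<Rightarrow> real"
  assumes T: "0 < T"
    and dom: "increments_le (zero_ext T \<phi>) S"
    and bound: "\<And>a. \<bar>S a\<bar> \<le> K"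
    and const: "\<forall>y<0. S y = S (- 1)" "\<forall>y>T. S y = S (T + 1)"
begin

lemma right_limit_bounded: "\<bar>right_limit S a\<bar> \<le> K"
  using right_limit_between[OF dom less_add_one, of a] bound[of a] bound[of "a + 1"] by linarith

lemma right_limit_constant:
  shows "y < 0 \<Longrightarrow> right_limit S y = right_limit S (- 1)" "T \<le> y \<Longrightarrow> right_limit S y = right_limit S T"
proof -
  have 1: "right_limit S y = S (- 1)" if "y < 0" for y
  proof (rule right_limitI, rule tendsto_eventually)
    show "\<forall>\<^sub>F z in at_right y. S z = S (- 1)"
      unfolding eventually_at_right_field using that const(1) by blast
  qed
  then show "y < 0 \<Longrightarrow> right_limit S y = right_limit S (- 1)" by simp
  have 2: "right_limit S y = S (T + 1)" if "T \<le> y" for y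
  proof (rule right_limitI, rule tendsto_eventually)
    have "S z = S (T + 1)" if "y < z" for z
      by (rule const(2)[rule_format]) (use that \<open>T \<le> y\<close> in linarith)
    then show "\<forall>\<^sub>F z in at_right y. S z = S (T + 1)"
      by (simp add: eventually_at_filter)
  qed
  then show "T \<le> y \<Longrightarrow> right_limit S y = right_limit S T" by simp
qed

lemma ls_fun_vanishes: "y < 0 \<or> T \<le> y \<Longrightarrow> ls_fun T \<phi> y = 0"
proof -
  assume y: "y < 0 \<or> T \<le> y"
  have "\<exists>b>y. \<forall>z>y. z < b \<longrightarrow> zero_ext T \<phi> z = 0"
    using y by (cases "y < 0") (auto simp: zero_ext_def intro: exI[of _ 0] exI[of _ "y + 1"])
  then show ?thesis unfolding ls_fun_eq_right_limit
    by (intro right_limitI tendsto_eventually) (simp add: eventually_at_right_field)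
qed

lemma ls_fun_right_continuous: "continuous (at_right y) (ls_fun T \<phi>)"
  unfolding ls_fun_eq_right_limit
  by (rule right_continuous_dominated[OF right_limit_dominated[OF dom] right_limit_mono_right_continuous[OF dom]])

lemma ls_fun_variation_bdd: "bdd_above (variation_sums (ls_fun T \<phi>) X)"
  unfolding ls_fun_eq_right_limit
  by (rule bdd_above_variation_sums_dominated[OF right_limit_dominated[OF dom] right_limit_bounded])

text \<open>The signs \<open>\<sigma> = 1\<close> and \<open>\<sigma> = - 1\<close> give the two halves of the Jordan decomposition. Domination by one
  nondecreasing function passes regularity and integrability on to both.\<close>

lemma ls_jordan_increment:
  fixes \<sigma> :: real
  assumes "a \<le> b" "\<bar>\<sigma>\<bar> = 1"
  defines "W \<equiv> \<lambda>x. (total_variation_on (ls_fun T \<phi>) {..x} + \<sigma> * ls_fun T \<phi> x) / 2"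
  shows "0 \<le> W b - W a" "W b - W a \<le> right_limit S b - right_limit S a"
proof -
  let ?V = "\<lambda>x. total_variation_on (ls_fun T \<phi>) {..x}" and ?F = "ls_fun T \<phi>"
  have F: "increments_le ?F (right_limit S)"
    unfolding ls_fun_eq_right_limit by (rule right_limit_dominated[OF dom])
  have V: "?V b \<le> ?V a + (right_limit S b - right_limit S a)"
    by (rule total_variation_on_dominated[OF F right_limit_bounded assms(1)])
  have V': "?V a + \<bar>?F b - ?F a\<bar> \<le> ?V b"
    using assms(1) by (intro total_variation_on_add_le ls_fun_variation_bdd) auto
  have s: "\<sigma> = 1 \<or> \<sigma> = - 1" using assms(2) by auto
  show "0 \<le> W b - W a" "W b - W a \<le> right_limit S b - right_limit S a"
    using V V' increments_leD[OF F assms(1)] s unfolding W_def by (auto simp: field_simps)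
qed

end

context rough_hurst
begin

text \<open>The first formula holds at every continuity point of the majorant. If moreover the potential of the
  majorant is finite at \<open>x\<close>, the halves can be subtracted: their masses agree, since
  the distribution function vanishes on both sides of \<open>{0..T}\<close>, and what remains is the potential of the
  distribution function, which equals \<open>zero_ext T \<phi>\<close> at all but countably many points.\<close>

lemma ls_integral_eq:
  fixes T K :: real and \<phi> S :: "real \<Rightarrow> real"
  assumes T: "0 < T"
    and dom: "increments_le (zero_ext T \<phi>) S"
    and bound: "\<And>a. \<bar>S a\<bar> \<le> K"
    and const: "\<forall>y<0. S y = S (- 1)" "\<forall>y>T. S y = S (T + 1)"
    and x: "isCont S x"
  defines "L \<equiv> ls_integral T \<phi> (\<lambda>s. x powr (2 * H - 1) - sgn (x - s) * \<bar>x - s\<bar> powr (2 * H - 1))"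
    and "W \<equiv> \<lambda>\<sigma> y. (total_variation_on (ls_fun T \<phi>) {..y} + \<sigma> * ls_fun T \<phi> y) / 2"
  shows "L = half_value T (W 1) x - half_value T (W (- 1)) x"
    and "integrable lborel (\<lambda>y. (S x - S y) * kern H (x - y)) \<Longrightarrow>
      L = - (1 - 2 * H) * (LINT y|lborel. (zero_ext T \<phi> x - zero_ext T \<phi> y) * kern H (x - y))"
proof -
  note inc = ls_jordan_increment[OF T dom bound const]
  note rlc = right_limit_constant[OF T dom bound const]
  let ?S = "right_limit S"
  have inc0: "0 \<le> W \<sigma> b - W \<sigma> a" "W \<sigma> b - W \<sigma> a \<le> ?S b - ?S a"
    if "\<bar>\<sigma>\<bar> = 1" "a \<le> b" for \<sigma> a b
    unfolding W_def by (rule inc[OF that(2,1)])+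
  have incW: "increments_le (W \<sigma>) ?S" if "\<bar>\<sigma>\<bar> = 1" for \<sigma>
    unfolding increments_le_def using inc0[OF that] by simp
  note domW = increments_leD[OF incW]
  have monoW: "mono (W \<sigma>)" if "\<bar>\<sigma>\<bar> = 1" for \<sigma>
  proof (rule monoI)
    fix a b :: real assume "a \<le> b"
    then show "W \<sigma> a \<le> W \<sigma> b" using inc0(1)[OF that] by fastforce
  qed
  have rcW: "continuous (at_right a) (W \<sigma>)" if "\<bar>\<sigma>\<bar> = 1" for \<sigma> a
    by (rule right_continuous_dominated[OF incW[OF that] right_limit_mono_right_continuous[OF dom]])
  have contW: "isCont (W \<sigma>) x" if "\<bar>\<sigma>\<bar> = 1" for \<sigma>
    by (rule isCont_dominated[OF incW[OF that] right_limit_at_cont(3)[OF dom x]])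
  have constW: "W \<sigma> y = W \<sigma> (- 1)" if "\<bar>\<sigma>\<bar> = 1" "y < 0" for \<sigma> y
  proof (cases "y \<le> - 1")
    case True
    from domW[OF that(1) True] show ?thesis unfolding rlc(1)[OF that(2)] by simp
  next
    case False
    then have "- 1 \<le> y" by simp
    from domW[OF that(1) this] show ?thesis unfolding rlc(1)[OF that(2)] by simp
  qed
  have constW': "W \<sigma> y = W \<sigma> T" if "\<bar>\<sigma>\<bar> = 1" "T \<le> y" for \<sigma> y
    using domW[OF that] unfolding rlc(2)[OF that(2)] by simp
  have half: "(LINT s|restrict_space (interval_measure (W \<sigma>)) {0..T}.
      x powr (2 * H - 1) - sgn (x - s) * \<bar>x - s\<bar> powr (2 * H - 1)) = half_value T (W \<sigma>) x" if "\<bar>\<sigma>\<bar> = 1" for \<sigma>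
    using that by (intro restricted_stieltjes_integral monoW rcW contW T constW constW')
  show L1: "L = half_value T (W 1) x - half_value T (W (- 1)) x"
    using half[of 1] half[of "- 1"] by (simp add: L_def ls_integral_def ls_pos_def ls_neg_def W_def)
  assume iS: "integrable lborel (\<lambda>y. (S x - S y) * kern H (x - y))"
  note S_mono = dominated_mono[OF dom]
  have cont: "AE y in lborel. isCont S y"
    using AE_not_in[OF countable_imp_null_set_lborel[OF mono_ctble_discont[OF S_mono(1)]]] by simp
  have [measurable]: "S \<in> borel_measurable borel" by (rule borel_measurable_mono[OF S_mono(1)])
  have [measurable]: "W 1 \<in> borel_measurable borel" "W (- 1) \<in> borel_measurable borel"
    by (intro borel_measurable_mono monoW; simp)+
  have [measurable]: "zero_ext T \<phi> \<in> borel_measurable borel"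
  proof -
    have "(\<lambda>y. S y - (S y - zero_ext T \<phi> y)) \<in> borel_measurable borel"
      using borel_measurable_mono[OF S_mono(2)] by measurable
    then show ?thesis by simp
  qed
  have iW: "integrable lborel (\<lambda>y. (W \<sigma> x - W \<sigma> y) * kern H (x - y))" if \<sigma>: "\<bar>\<sigma>\<bar> = 1" for \<sigma>
  proof (rule Bochner_Integration.integrable_bound[OF iS])
    have [measurable]: "W \<sigma> \<in> borel_measurable borel" by (rule borel_measurable_mono[OF monoW[OF \<sigma>]])
    show "(\<lambda>y. (W \<sigma> x - W \<sigma> y) * kern H (x - y)) \<in> borel_measurable lborel" by measurable
    show "AE y in lborel. norm ((W \<sigma> x - W \<sigma> y) * kern H (x - y)) \<le> norm ((S x - S y) * kern H (x - y))"
      using cont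
    proof eventually_elim
      case (elim y)
      have "?S x = S x" "?S y = S y"
        using right_limit_at_cont(2)[OF dom] x elim by auto
      then have "\<bar>W \<sigma> x - W \<sigma> y\<bar> \<le> \<bar>S x - S y\<bar>"
        using domW[OF \<sigma>, of x y] domW[OF \<sigma>, of y x] by (cases "x \<le> y") (auto simp: abs_minus_commute)
      then show ?case by (simp add: abs_mult mult_right_mono)
    qed
  qed
  have diff: "W 1 y - W (- 1) y = ls_fun T \<phi> y" for y by (simp add: W_def field_simps)
  have v: "ls_fun T \<phi> T = 0" "ls_fun T \<phi> (- 1) = 0"
    by (rule ls_fun_vanishes[OF T dom bound const]; use T in simp)+
  have mass: "W 1 T - W 1 (- 1) = W (- 1) T - W (- 1) (- 1)"
    using diff[of T] diff[of "- 1"] v by simp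
  have "L = - (1 - 2 * H) * ((LINT y|lborel. (W 1 x - W 1 y) * kern H (x - y)) - (LINT y|lborel. (W (- 1) x - W (- 1) y) * kern H (x - y)))"
    unfolding L1 half_value_def mass using iW[of 1] iW[of "- 1"] by (simp add: algebra_simps)
  also have "(LINT y|lborel. (W 1 x - W 1 y) * kern H (x - y)) - (LINT y|lborel. (W (- 1) x - W (- 1) y) * kern H (x - y))
      = (LINT y|lborel. (W 1 x - W 1 y) * kern H (x - y) - (W (- 1) x - W (- 1) y) * kern H (x - y))"
    by (rule Bochner_Integration.integral_diff[symmetric]) (intro iW; simp)+
  also have "\<dots> = (LINT y|lborel. (zero_ext T \<phi> x - zero_ext T \<phi> y) * kern H (x - y))"
  proof (rule integral_cong_AE)
    show "AE y in lborel. (W 1 x - W 1 y) * kern H (x - y) - (W (- 1) x - W (- 1) y) * kern H (x - y)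
        = (zero_ext T \<phi> x - zero_ext T \<phi> y) * kern H (x - y)"
      using cont
    proof eventually_elim
      case (elim y)
      have "ls_fun T \<phi> x = zero_ext T \<phi> x" "ls_fun T \<phi> y = zero_ext T \<phi> y"
        unfolding ls_fun_eq_right_limit
        using right_limit_at_cont(1)[OF dom] x elim by auto
      then show ?case using diff[of x] diff[of y]
        by (simp add: left_diff_distrib[symmetric])
    qed
  qed measurable
  finally show "L = - (1 - 2 * H) * (LINT y|lborel. (zero_ext T \<phi> x - zero_ext T \<phi> y) * kern H (x - y))" .
qed

end

section \<open>Localization to a moving window\<close>

lemma bounded_variation_on_mono:
  assumes "mono_on {0..T} w" "0 < T"
  shows "bounded_variation_on w {0..T}"
proof -
  let ?c = "monotone_clamp T w"
  have m: "mono ?c" by (rule mono_monotone_clamp[OF assms])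
  have "increments_le ?c ?c" using m by (auto simp: increments_le_def mono_def)
  moreover have "\<bar>?c a\<bar> \<le> \<bar>w 0\<bar> + \<bar>w T\<bar>" for a
  proof -
    have "w 0 \<le> ?c a" "?c a \<le> w T"
      unfolding monotone_clamp_def by (rule mono_onD[OF assms(1)]; use assms(2) in simp)+
    then show ?thesis by linarith
  qed
  ultimately have "bdd_above (variation_sums ?c {0..T})" by (rule bdd_above_variation_sums_dominated)
  moreover have "variation_sums w {0..T} \<subseteq> variation_sums ?c {0..T}"
  proof
    fix v assume "v \<in> variation_sums w {0..T}"
    then obtain n p where np: "v = (\<Sum>i<n. \<bar>w (p (Suc i)) - w (p i)\<bar>)" "mono_on {..n} p" "p ` {..n} \<subseteq> {0..T}"
      unfolding variation_sums_def by blast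
    have "?c (p i) = w (p i)" if "i \<le> n" for i
    proof -
      have "p i \<in> {0..T}" using np(3) that by auto
      then show ?thesis by (simp add: monotone_clamp_def)
    qed
    then have "v = (\<Sum>i<n. \<bar>?c (p (Suc i)) - ?c (p i)\<bar>)" unfolding np(1) by (intro sum.cong) auto
    then show "v \<in> variation_sums ?c {0..T}" unfolding variation_sums_def using np(2,3) by blast
  qed
  ultimately show ?thesis unfolding bounded_variation_on_def by (rule bdd_above_mono)
qed

definition window :: "real \<Rightarrow> real \<Rightarrow> real \<Rightarrow> (real \<Rightarrow> real) \<Rightarrow> real \<Rightarrow> real \<Rightarrow> real" where
  "window T \<epsilon>\<^sub>1 \<epsilon>\<^sub>2 f t = (\<lambda>s. f s * indicator {max (t - \<epsilon>\<^sub>1) 0..min (t + \<epsilon>\<^sub>2) T} s)"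

text \<open>Cutting a function bounded by \<open>K\<close> off at the ends of the window creates jumps of height at most \<open>K\<close>. The
  second jump comes after the right end, because the window is a closed interval.\<close>

definition window_majorant ::
    "real \<Rightarrow> real \<Rightarrow> real \<Rightarrow> (real \<Rightarrow> real) \<Rightarrow> real \<Rightarrow> real \<Rightarrow> real \<Rightarrow> real" where
  "window_majorant T \<epsilon>\<^sub>1 \<epsilon>\<^sub>2 w K t s = monotone_clamp T w s
     + (if max (t - \<epsilon>\<^sub>1) 0 \<le> s then K else 0) + (if min (t + \<epsilon>\<^sub>2) T < s then K else 0)"

lemma zero_ext_window:
  "zero_ext T (window T \<epsilon>\<^sub>1 \<epsilon>\<^sub>2 f t) s
    = (if max (t - \<epsilon>\<^sub>1) 0 \<le> s \<and> s \<le> min (t + \<epsilon>\<^sub>2) T then zero_ext T f s else 0)"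
  by (auto simp: zero_ext_def window_def)

context
  fixes T \<epsilon>\<^sub>1 \<epsilon>\<^sub>2 K :: real and f w :: "real \<Rightarrow> real"
  assumes T: "0 < T" and \<epsilon>: "0 < \<epsilon>\<^sub>1" "0 < \<epsilon>\<^sub>2"
    and w0: "\<And>x. 0 \<le> w x"
    and w: "\<And>x y. 0 \<le> x \<Longrightarrow> x \<le> y \<Longrightarrow> y \<le> T \<Longrightarrow> \<bar>f y - f x\<bar> \<le> w y - w x"
    and K: "0 \<le> K" "\<And>x. \<bar>zero_ext T f x\<bar> \<le> K"
begin

lemma mono_on_dominating: "mono_on {0..T} w"
proof (rule mono_onI)
  fix r s assume "r \<in> {0..T}" "s \<in> {0..T}" "r \<le> s"
  then show "w r \<le> w s" using w[of r s] by auto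
qed

lemma window_increments_le:
  "increments_le (zero_ext T (window T \<epsilon>\<^sub>1 \<epsilon>\<^sub>2 f t)) (window_majorant T \<epsilon>\<^sub>1 \<epsilon>\<^sub>2 w K t)"
  unfolding increments_le_def
proof (intro allI impI)
  fix s s' :: real assume s: "s \<le> s'"
  let ?a = "max (t - \<epsilon>\<^sub>1) 0" and ?b = "min (t + \<epsilon>\<^sub>2) T"
  let ?z = "zero_ext T (window T \<epsilon>\<^sub>1 \<epsilon>\<^sub>2 f t)" and ?S = "window_majorant T \<epsilon>\<^sub>1 \<epsilon>\<^sub>2 w K t"
  have m: "monotone_clamp T w s \<le> monotone_clamp T w s'"
    by (rule monoD[OF mono_monotone_clamp[OF mono_on_dominating T] s])
  consider "?a \<le> s" "s' \<le> ?b" | "?a \<le> s" "s \<le> ?b" "?b < s'" | "s < ?a" "?a \<le> s'" "s' \<le> ?b"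
    | "\<not> (?a \<le> s \<and> s \<le> ?b)" "\<not> (?a \<le> s' \<and> s' \<le> ?b)" by linarith
  then show "\<bar>?z s' - ?z s\<bar> \<le> ?S s' - ?S s"
  proof cases
    case 1
    then have "monotone_clamp T w s = w s" "monotone_clamp T w s' = w s'" using s by (auto simp: monotone_clamp_def)
    moreover have "?z s = f s" "?z s' = f s'" using 1 s by (auto simp: window_def zero_ext_def)
    ultimately show ?thesis using w[of s s'] 1 s by (auto simp: window_majorant_def)
  next
    case 2
    then have "?z s' = 0" "?z s = zero_ext T f s" by (auto simp: zero_ext_window)
    then show ?thesis using 2 m K(2)[of s] s by (auto simp: window_majorant_def)
  next
    case 3
    then have "?z s = 0" "?z s' = zero_ext T f s'" by (auto simp: zero_ext_window)
    then show ?thesis using 3 m K(1) K(2)[of s'] s by (auto simp: window_majorant_def)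
  next
    case 4
    then have "?z s = 0" "?z s' = 0" by (simp_all only: zero_ext_window if_False)
    moreover have "?S s \<le> ?S s'" unfolding window_majorant_def using m K(1) s by auto
    ultimately show ?thesis by simp
  qed
qed

lemma clamp_bounds: "0 \<le> monotone_clamp T w s" "monotone_clamp T w s \<le> w T"
  unfolding monotone_clamp_def
  by (rule w0, rule mono_onD[OF mono_on_dominating]) (use T in auto)

lemma window_majorant_bounded: "\<bar>window_majorant T \<epsilon>\<^sub>1 \<epsilon>\<^sub>2 w K t s\<bar> \<le> w T + 2 * K"
  using clamp_bounds[of s] K(1) by (auto simp: window_majorant_def)

lemma window_majorant_constant:
  assumes "0 \<le> t" "t \<le> T"
  shows "\<forall>y<0. window_majorant T \<epsilon>\<^sub>1 \<epsilon>\<^sub>2 w K t y = window_majorant T \<epsilon>\<^sub>1 \<epsilon>\<^sub>2 w K t (- 1)"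
    and "\<forall>y>T. window_majorant T \<epsilon>\<^sub>1 \<epsilon>\<^sub>2 w K t y = window_majorant T \<epsilon>\<^sub>1 \<epsilon>\<^sub>2 w K t (T + 1)"
  using assms T \<epsilon> by (auto simp: window_majorant_def monotone_clamp_def)

lemma window_majorant_isCont:
  assumes t: "0 < t" "t < T" and c: "isCont (monotone_clamp T w) t"
  shows "isCont (window_majorant T \<epsilon>\<^sub>1 \<epsilon>\<^sub>2 w K t) t"
proof -
  let ?a = "max (t - \<epsilon>\<^sub>1) 0" and ?b = "min (t + \<epsilon>\<^sub>2) T"
  have "t \<in> {?a<..<?b}" using t \<epsilon> by auto
  then have "\<forall>\<^sub>F s in nhds t. s \<in> {?a<..<?b}" by (intro eventually_nhds_in_open) auto
  then have "\<forall>\<^sub>F s in nhds t. window_majorant T \<epsilon>\<^sub>1 \<epsilon>\<^sub>2 w K t s = monotone_clamp T w s + K"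
    by (rule eventually_mono) (auto simp: window_majorant_def)
  then have "isCont (window_majorant T \<epsilon>\<^sub>1 \<epsilon>\<^sub>2 w K t) t \<longleftrightarrow> isCont (\<lambda>s. monotone_clamp T w s + K) t"
    by (rule isCont_cong)
  then show ?thesis using c by (simp add: continuous_intros)
qed

end

context rough_hurst
begin

lemma integrable_kern_away:
  assumes "0 < \<delta>"
  shows "integrable lborel (\<lambda>y. kern H (x - y) * indicator {y. \<delta> \<le> \<bar>x - y\<bar>} y)"
proof (rule integrableI_bounded)
  have "(\<integral>\<^sup>+y. ennreal (norm (kern H (x - y) * indicator {y. \<delta> \<le> \<bar>x - y\<bar>} y)) \<partial>lborel)
      = (\<integral>\<^sup>+y. ennreal (kern H (x - y)) * indicator {..x - \<delta>} y + ennreal (kern H (x - y)) * indicator {x + \<delta>..} y \<partial>lborel)"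
    using assms by (intro nn_integral_cong) (auto simp: indicator_def)
  also have "\<dots> = ennreal (\<delta> powr (2 * H - 1) / (1 - 2 * H)) + ennreal (\<delta> powr (2 * H - 1) / (1 - 2 * H))"
    using assms by (subst nn_integral_add) (auto simp: nn_integral_kern_left nn_integral_kern_right)
  also have "\<dots> < \<infinity>" by simp
  finally show "(\<integral>\<^sup>+y. ennreal (norm (kern H (x - y) * indicator {y. \<delta> \<le> \<bar>x - y\<bar>} y)) \<partial>lborel) < \<infinity>" .
qed measurable

text \<open>Close to \<open>t\<close> the majorant differs from \<open>w\<close> by a constant, and away from \<open>t\<close> the kernel is integrable. The
  finiteness of the potential at \<open>t\<close> is therefore a property of \<open>w\<close> alone, the same for all windows.\<close>

lemma window_majorant_integrable:
  fixes f w :: "real \<Rightarrow> real"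
  assumes T: "0 < T" and \<epsilon>: "0 < \<epsilon>\<^sub>1" "0 < \<epsilon>\<^sub>2"
    and w0: "\<And>x. 0 \<le> w x"
    and w: "\<And>x y. 0 \<le> x \<Longrightarrow> x \<le> y \<Longrightarrow> y \<le> T \<Longrightarrow> \<bar>f y - f x\<bar> \<le> w y - w x"
    and K: "0 \<le> K" "\<And>x. \<bar>zero_ext T f x\<bar> \<le> K"
    and t: "0 < t" "t < T"
    and iw: "integrable lborel (\<lambda>y. (zero_ext T w t - zero_ext T w y) * kern H (t - y))"
  shows "integrable lborel (\<lambda>y. (window_majorant T \<epsilon>\<^sub>1 \<epsilon>\<^sub>2 w K t t - window_majorant T \<epsilon>\<^sub>1 \<epsilon>\<^sub>2 w K t y) * kern H (t - y))"
proof -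
  let ?S = "window_majorant T \<epsilon>\<^sub>1 \<epsilon>\<^sub>2 w K t"
  \<comment> \<open>All points closer to \<open>t\<close> than \<open>\<delta>\<close> lie in the window and in the open interval from \<open>0\<close> to \<open>T\<close>.\<close>
  define \<delta> where "\<delta> = min (min t (T - t)) (min \<epsilon>\<^sub>1 \<epsilon>\<^sub>2)"
  have \<delta>: "0 < \<delta>" "\<delta> \<le> t" "\<delta> \<le> T - t" "\<delta> \<le> \<epsilon>\<^sub>1" "\<delta> \<le> \<epsilon>\<^sub>2" using t \<epsilon> by (auto simp: \<delta>_def)
  let ?C = "2 * (w T + 2 * K)"
  have bnd: "\<bar>?S s\<bar> \<le> w T + 2 * K" for s
    by (rule window_majorant_bounded[where f = f]; fact)
  have C: "0 \<le> ?C" using w0[of T] K(1) by simp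
  have m: "mono ?S"
    by (rule dominated_mono(1), rule window_increments_le[where f = f]; fact)
  have [measurable]: "?S \<in> borel_measurable borel" by (rule borel_measurable_mono[OF m])
  show ?thesis
  proof (rule Bochner_Integration.integrable_bound)
    show "integrable lborel (\<lambda>y. \<bar>(zero_ext T w t - zero_ext T w y) * kern H (t - y)\<bar>
        + ?C * (kern H (t - y) * indicator {y. \<delta> \<le> \<bar>t - y\<bar>} y))"
      using iw integrable_kern_away[OF \<delta>(1), of t]
      by (intro Bochner_Integration.integrable_add integrable_mult_right integrable_abs)
    show "(\<lambda>y. (?S t - ?S y) * kern H (t - y)) \<in> borel_measurable lborel" by measurable
    have "\<bar>(?S t - ?S y) * kern H (t - y)\<bar> \<le> \<bar>(zero_ext T w t - zero_ext T w y) * kern H (t - y)\<bar>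
        + ?C * (kern H (t - y) * indicator {y. \<delta> \<le> \<bar>t - y\<bar>} y)" for y
    proof (cases "\<delta> \<le> \<bar>t - y\<bar>")
      case True
      have "\<bar>?S t - ?S y\<bar> \<le> ?C" using abs_triangle_ineq4[of "?S t" "?S y"] bnd[of t] bnd[of y] by argo
      then have "\<bar>(?S t - ?S y) * kern H (t - y)\<bar> \<le> ?C * kern H (t - y)"
        by (simp add: abs_mult mult_right_mono)
      then show ?thesis using True by simp
    next
      case False
      then have y: "0 < y" "y < T" "t - \<epsilon>\<^sub>1 < y" "y < t + \<epsilon>\<^sub>2" using \<delta> by auto
      have "?S t - ?S y = zero_ext T w t - zero_ext T w y"
        using y t \<epsilon> by (auto simp: window_majorant_def zero_ext_def monotone_clamp_def)
      then show ?thesis using False by simp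
    qed
    then show "AE y in lborel. norm ((?S t - ?S y) * kern H (t - y))
        \<le> norm (\<bar>(zero_ext T w t - zero_ext T w y) * kern H (t - y)\<bar>
          + ?C * (kern H (t - y) * indicator {y. \<delta> \<le> \<bar>t - y\<bar>} y))"
      using C by (auto intro: order_trans)
  qed
qed

lemma half_value_measurable:
  assumes W: "(\<lambda>p. W (fst p) (snd p)) \<in> borel_measurable (borel \<Otimes>\<^sub>M borel)"
  shows "(\<lambda>t. half_value T (W t) t) \<in> borel_measurable borel"
proof -
  have [measurable]: "(\<lambda>t. W t c) \<in> borel_measurable borel" for c
    using measurable_compose[OF _ W, of "\<lambda>t. (t, c)" borel] by simp
  have [measurable]: "(\<lambda>p. W (fst p) (fst p)) \<in> borel_measurable (borel \<Otimes>\<^sub>M lborel)"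
    using measurable_compose[OF _ W, of "\<lambda>p. (fst p, fst p)" "borel \<Otimes>\<^sub>M lborel"] by simp
  have [measurable]: "(\<lambda>p. W (fst p) (snd p)) \<in> borel_measurable (borel \<Otimes>\<^sub>M lborel)"
    using W by (simp cong: measurable_cong_sets)
  have R[measurable]: "(\<lambda>(t, y). (W t t - W t y) * kern H (t - y)) \<in> borel_measurable (borel \<Otimes>\<^sub>M lborel)"
    unfolding case_prod_beta by measurable
  have [measurable]: "Measurable.pred borel (\<lambda>t. integrable lborel (\<lambda>y. (W t t - W t y) * kern H (t - y)))"
    by (rule lborel.borel_measurable_lebesgue_integrable) (rule R)
  have [measurable]: "(\<lambda>t. LINT y|lborel. (W t t - W t y) * kern H (t - y)) \<in> borel_measurable borel"
    by (rule lborel.borel_measurable_lebesgue_integral) (rule R)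
  show ?thesis unfolding half_value_def by measurable
qed

text \<open>For \<open>t\<close> in the open interval outside the countable set of discontinuities of \<open>w\<close>, the Stieltjes integral is
  a difference of two functions \<open>half_value\<close> whose argument depends measurably on \<open>t\<close>; countably many
  exceptional \<open>t\<close> do not affect Borel measurability. For almost every \<open>t\<close> the potential of \<open>w\<close> is finite,
  because \<open>w\<close> has bounded variation and thus an integrable increment.\<close>

lemma windowed_ls_integral:
  assumes f: "bounded_variation_on f {0..T}" and g: "bounded_variation_on g {0..T}" and T: "0 < T"
    and \<epsilon>: "0 < \<epsilon>\<^sub>1" "0 < \<epsilon>\<^sub>2"
  defines "L \<equiv> \<lambda>t. ls_integral T (window T \<epsilon>\<^sub>1 \<epsilon>\<^sub>2 f t)
      (\<lambda>s. t powr (2 * H - 1) - sgn (t - s) * \<bar>t - s\<bar> powr (2 * H - 1))"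
    and "z \<equiv> \<lambda>t. zero_ext T (window T \<epsilon>\<^sub>1 \<epsilon>\<^sub>2 f t)"
  shows "AE t in lborel. 0 < t \<longrightarrow> t < T \<longrightarrow>
      L t = - (1 - 2 * H) * (LINT y|lborel. (z t t - z t y) * kern H (t - y))"
    and "(\<lambda>t. zero_ext T g t * L t) \<in> borel_measurable borel"
proof -
  obtain w where w0: "\<And>x. 0 \<le> w x"
    and w: "\<And>x y. 0 \<le> x \<Longrightarrow> x \<le> y \<Longrightarrow> y \<le> T \<Longrightarrow> \<bar>f y - f x\<bar> \<le> w y - w x"
    by (rule bounded_variation_dominating_mono[OF f T]) (rule that; assumption)
  obtain K where K: "0 \<le> K" "\<And>x. \<bar>zero_ext T f x\<bar> \<le> K"
    by (rule zero_ext_bounded[OF f T]) (rule that; assumption)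
  have mono_w: "mono_on {0..T} w"
    by (rule mono_on_dominating[where f = f and K = K and \<epsilon>\<^sub>1 = \<epsilon>\<^sub>1 and \<epsilon>\<^sub>2 = \<epsilon>\<^sub>2]; fact)
  let ?S = "window_majorant T \<epsilon>\<^sub>1 \<epsilon>\<^sub>2 w K"
  define C where "C = {t. \<not> isCont (monotone_clamp T w) t}"
  have C: "countable C"
    unfolding C_def by (rule mono_ctble_discont[OF mono_monotone_clamp[OF mono_w T]])
  have inc: "increments_le (z t) (?S t)" for t
    unfolding z_def by (rule window_increments_le[where w = w]; fact)
  have bnd: "\<bar>?S t s\<bar> \<le> w T + 2 * K" for t s
    by (rule window_majorant_bounded[where f = f]; fact)
  have const: "\<forall>y<0. ?S t y = ?S t (- 1)" "\<forall>y>T. ?S t y = ?S t (T + 1)" if "0 \<le> t" "t \<le> T" for t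
    by (rule window_majorant_constant[where f = f and w = w and K = K]; fact)+
  have cont: "isCont (?S t) t" if "0 < t" "t < T" "t \<notin> C" for t
    by (rule window_majorant_isCont[where f = f]; (fact | use that in \<open>simp add: C_def\<close>))
  define W where "W \<sigma> t y = (total_variation_on (ls_fun T (window T \<epsilon>\<^sub>1 \<epsilon>\<^sub>2 f t)) {..y}
      + \<sigma> * ls_fun T (window T \<epsilon>\<^sub>1 \<epsilon>\<^sub>2 f t) y) / 2" for \<sigma> t y
  have eq: "L t = half_value T (W 1 t) t - half_value T (W (- 1) t) t"
    "integrable lborel (\<lambda>y. (?S t t - ?S t y) * kern H (t - y)) \<Longrightarrow>
      L t = - (1 - 2 * H) * (LINT y|lborel. (z t t - z t y) * kern H (t - y))"
    if t: "0 < t" "t < T" "t \<notin> C" for t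
    unfolding L_def W_def z_def
    by (rule ls_integral_eq[OF T inc[unfolded z_def] bnd const cont]; use t in simp)+
  have "AE t in lborel. integrable lborel (\<lambda>y. (zero_ext T w t - zero_ext T w y) * kern H (t - y))"
    by (rule energy_fibrewise(1)[OF bounded_variation_on_mono g T]) (rule mono_w, rule T)
  moreover have "AE t in lborel. t \<notin> C" by (rule AE_not_in[OF countable_imp_null_set_lborel[OF C]])
  ultimately show "AE t in lborel. 0 < t \<longrightarrow> t < T \<longrightarrow>
      L t = - (1 - 2 * H) * (LINT y|lborel. (z t t - z t y) * kern H (t - y))"
  proof eventually_elim
    case (elim t)
    show ?case
    proof (intro impI)
      assume t: "0 < t" "t < T"
      have "integrable lborel (\<lambda>y. (?S t t - ?S t y) * kern H (t - y))"
        by (rule window_majorant_integrable[OF T \<epsilon> w0 w K t elim(1)])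
      then show "L t = - (1 - 2 * H) * (LINT y|lborel. (z t t - z t y) * kern H (t - y))"
        by (rule eq(2)[OF t elim(2)])
    qed
  qed
  \<comment> \<open>Windows are parametrized by all real numbers below; those centred outside \<open>{0..T}\<close> are moved back, since
      the majorant need not be constant outside \<open>{0..T}\<close> for them.\<close>
  define c where "c t = max 0 (min T t)" for t :: real
  have c: "0 \<le> c t" "c t \<le> T" for t using T by (auto simp: c_def)
  have c_id: "c t = t" if "0 < t" "t < T" for t using that by (simp add: c_def)
  have [measurable]: "c \<in> borel_measurable borel" unfolding c_def by measurable
  have [measurable]: "zero_ext T f \<in> borel_measurable borel" "zero_ext T g \<in> borel_measurable borel"
    by (rule zero_ext_measurable[OF f T], rule zero_ext_measurable[OF g T])
  let ?F = "\<lambda>t. ls_fun T (window T \<epsilon>\<^sub>1 \<epsilon>\<^sub>2 f (c t))"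
  have Fm: "(\<lambda>p. ?F (fst p) (snd p)) \<in> borel_measurable (borel \<Otimes>\<^sub>M borel)"
  proof (rule borel_measurable_LIMSEQ_real)
    fix p :: "real \<times> real"
    have "filterlim (\<lambda>n. snd p + 1 / real (Suc n)) (at_right (snd p)) sequentially"
      unfolding filterlim_at using LIMSEQ_inverse_real_of_nat_add[of "snd p"]
      by (simp add: divide_inverse)
    from filterlim_compose[OF tendsto_right_limit[OF inc] this]
    show "(\<lambda>n. z (c (fst p)) (snd p + 1 / real (Suc n))) \<longlonglongrightarrow> ?F (fst p) (snd p)"
      unfolding ls_fun_eq_right_limit z_def .
  next
    fix n
    show "(\<lambda>p. z (c (fst p)) (snd p + 1 / real (Suc n))) \<in> borel_measurable (borel \<Otimes>\<^sub>M borel)"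
      unfolding z_def zero_ext_window by measurable
  qed
  have Vm: "(\<lambda>p. total_variation_on (?F (fst p)) {..snd p}) \<in> borel_measurable (borel \<Otimes>\<^sub>M borel)"
  proof (rule total_variation_jointly_measurable[OF Fm])
    show "continuous (at_right y) (?F t)" for t y
      by (rule ls_fun_right_continuous[OF T inc[unfolded z_def] bnd const[OF c]])
    show "bdd_above (variation_sums (?F t) {..y})" for t y
      by (rule ls_fun_variation_bdd[OF T inc[unfolded z_def] bnd const[OF c]])
  qed
  have Wm: "(\<lambda>p. W \<sigma> (c (fst p)) (snd p)) \<in> borel_measurable (borel \<Otimes>\<^sub>M borel)" for \<sigma>
    unfolding W_def using Fm Vm by measurable
  have [measurable]: "(\<lambda>t. half_value T (W \<sigma> (c t)) t) \<in> borel_measurable borel" for \<sigma>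
    by (rule half_value_measurable[OF Wm])
  show "(\<lambda>t. zero_ext T g t * L t) \<in> borel_measurable borel"
  proof (rule measurable_discrete_difference)
    show "(\<lambda>t. zero_ext T g t * (half_value T (W 1 (c t)) t - half_value T (W (- 1) (c t)) t)) \<in> borel_measurable borel"
      by measurable
    show "countable (insert 0 (insert T C))" using C by simp
    fix t assume t: "t \<notin> insert 0 (insert T C)"
    show "zero_ext T g t * (half_value T (W 1 (c t)) t - half_value T (W (- 1) (c t)) t) = zero_ext T g t * L t"
    proof (cases "0 < t \<and> t < T")
      case True
      then show ?thesis using t eq(1)[of t] c_id[of t] by simp
    next
      case False
      then show ?thesis using t by (auto simp: zero_ext_def)
    qed
  qed auto
qed

end

theorem proposition1p9:
  fixes M :: "'a measure" and B :: "real \<Rightarrow> 'a \<Rightarrow> real"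
    and H T :: real and f g :: "real \<Rightarrow> real"
  assumes "0 < H" and "H < 1 / 2" and "0 < T"
    and "fractional_brownian_motion M H T B"
    and "bounded_variation_on f {0..T}" and "bounded_variation_on g {0..T}"
  shows "(T \<ge> 1 \<longrightarrow>
      H_inner M B T (H_elem M B T f) (H_elem M B T g) =
        H * (2 * H - 1) *
          ((LINT t:{1..T}|lborel. g t * (LINT s:{0..t - 1}|lborel. f s * (t - s) powr (2 * H - 2))) +
           (LINT s:{1..T}|lborel. f s * (LINT t:{0..s - 1}|lborel. g t * (s - t) powr (2 * H - 2))))
        - H * (LINT t:{0..T}|lborel. g t *
            ls_integral T (\<lambda>s. f s * indicator {max (t - 1) 0..min (t + 1) T} s)
              (\<lambda>s. t powr (2 * H - 1) - sgn (t - s) * \<bar>t - s\<bar> powr (2 * H - 1))))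
    \<and> (\<forall>\<epsilon>\<^sub>1 \<epsilon>\<^sub>2. \<epsilon>\<^sub>1 \<in> {0<..<T} \<and> \<epsilon>\<^sub>2 \<in> {0<..<T} \<longrightarrow>
      H_inner M B T (H_elem M B T f) (H_elem M B T g) =
        H * (2 * H - 1) *
          ((LINT t:{\<epsilon>\<^sub>1..T}|lborel. g t * (LINT s:{0..t - \<epsilon>\<^sub>1}|lborel. f s * (t - s) powr (2 * H - 2))) +
           (LINT s:{\<epsilon>\<^sub>2..T}|lborel. f s * (LINT t:{0..s - \<epsilon>\<^sub>2}|lborel. g t * (s - t) powr (2 * H - 2))))
        - H * (LINT t:{0..T}|lborel. g t *
            ls_integral T (\<lambda>s. f s * indicator {max (t - \<epsilon>\<^sub>1) 0..min (t + \<epsilon>\<^sub>2) T} s)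
              (\<lambda>s. t powr (2 * H - 1) - sgn (t - s) * \<bar>t - s\<bar> powr (2 * H - 1))))"
proof -
  interpret rough_hurst H using assms(1,2) by unfold_locales
  note T = \<open>0 < T\<close> and f = assms(5) and g = assms(6)
  have main: "H_inner M B T (H_elem M B T f) (H_elem M B T g) =
        H * (2 * H - 1) *
          ((LINT t:{\<epsilon>\<^sub>1..T}|lborel. g t * (LINT s:{0..t - \<epsilon>\<^sub>1}|lborel. f s * (t - s) powr (2 * H - 2))) +
           (LINT s:{\<epsilon>\<^sub>2..T}|lborel. f s * (LINT t:{0..s - \<epsilon>\<^sub>2}|lborel. g t * (s - t) powr (2 * H - 2))))
        - H * (LINT t:{0..T}|lborel. g t *
            ls_integral T (\<lambda>s. f s * indicator {max (t - \<epsilon>\<^sub>1) 0..min (t + \<epsilon>\<^sub>2) T} s)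
              (\<lambda>s. t powr (2 * H - 1) - sgn (t - s) * \<bar>t - s\<bar> powr (2 * H - 1)))"
    if \<epsilon>: "0 < \<epsilon>\<^sub>1" "0 < \<epsilon>\<^sub>2" for \<epsilon>\<^sub>1 \<epsilon>\<^sub>2
    unfolding H_inner_eq_energy[OF assms(4) T f g]
    by (rule energy_near_far_split[OF f g T \<epsilon> windowed_ls_integral[OF f g T \<epsilon>, unfolded window_def]])
  then show ?thesis by auto
qed

end
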